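(* A function $v\in S_r^1(T^{\rm ps})$ is uniquely determined by the following degrees of freedom (DOFs): (a) $v(z_i),\ \operatorname{div}v(z_i)$, $1\le i\le3$ ($9$ DOFs); (b) $\int_{e_i}v\cdot n_i$, $1\le i\le3$, if $r=1$; (c) $v(z_{3+i})\cdot n_i,\ \operatorname{div}v(z_{3+i})$, $1\le i\le3$, if $r\ge2$ ($6$ DOFs); (d) $\int_ev\cdot w$ for all $w\in[\mathcal P_{r-2}(e)]^2$, $e\in\mathcal E^b(T^{\rm ps})$ ($12(r-1)$ DOFs); (e) $\int_e(\operatorname{div}v)q$ for all $q\in\mathcal P_{r-3}(e)$, $e\in\mathcal E^b(T^{\rm ps})$ ($6(r-2)$ DOFs); (f) $\int_Tv\cdot\operatorname{rot}q$ for all $q\in\mathring S_{r+1}^0(T^{\rm ps})$ ($3(r-1)(r-2)$ DOFs); (g) $\int_T(\operatorname{div}v)q$ for all $q\in\mathring L_{r-1}^2(T^{\rm ps})$ ($3(r-1)(r-2)$ DOFs).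
   Context: Here $r\ge1$ is an integer. Let $T\subset\mathbb R^2$ be a triangle with vertices $z_1,z_2,z_3$, labelled counter-clockwise, and let $z_0$ be an interior point of $T$. Let $e_i=[z_{i+1},z_{i+2}]$ (indices $1,2,3$ modulo $3$) be the edge opposite $z_i$, with outward unit normal $n_i$, and let $z_{3+i}$ be an interior point of the edge $e_i$, $i=1,2,3$. The Powell--Sabin split $T^{\rm ps}=\{T_1,\dots,T_6\}$ is the triangulation of $T$ obtained by connecting $z_0$ to each of $z_1,\dots,z_6$. $\mathcal E^b(T^{\rm ps})$ is the set of the six boundary edges of $T^{\rm ps}$ (each $e_i$ is divided in two by $z_{3+i}$). For scalar $q$, $\operatorname{rot}q=(\partial q/\partial x_2,-\partial q/\partial x_1)^\top$. $\mathcal P_k(S)$ is the space of polynomials of degree $\le k$ on $S$, with $\mathcal P_k(S)=\{0\}$ for $k<0$; $\mathcal P_k(T^{\rm ps})=\{q\in L^2(T): q|_S\in\mathcal P_k(S)\ \forall S\in T^{\rm ps}\}$; $S_k^1(T^{\rm ps})=\{v\in[\mathcal P_k(T^{\rm ps})\cap C(T)]^2:\operatorname{div}v\in C(T)\}$; $\mathring S_k^0(T^{\rm ps})=\{v\in\mathcal P_k(T^{\rm ps})\cap C(T):\operatorname{rot}v\in[C(T)]^2,\ v=0\text{ and }\operatorname{rot}v=0\text{ on }\partial T\}$; $\mathring L_k^2(T^{\rm ps})=\{q\in\mathcal P_k(T^{\rm ps})\cap C(T): q=0\text{ on }\partial T,\ \int_Tq=0\}$. *)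

theory Defs
  imports "HOL-Analysis.Analysis" "HOL-Library.Function_Algebras"
begin

section \<open>Dimension of spaces of functions\<close>

global_interpretation fun_vs: vector_space "\<lambda>(c::real) (f :: 'a \<Rightarrow> 'b::real_vector) x. c *\<^sub>R f x"
  defines fun_span = fun_vs.span and fun_dependent = fun_vs.dependent
  by unfold_locales (auto simp: fun_eq_iff algebra_simps)

text \<open>The library's dimension of an infinite-dimensional space is the junk value 0; a finite
  basis is therefore required explicitly.\<close>

definition has_dim :: "('a \<Rightarrow> 'b::real_vector) set \<Rightarrow> nat \<Rightarrow> bool" where
  "has_dim V n \<longleftrightarrow> (\<exists>B. finite B \<and> card B = n \<and> \<not> fun_dependent B \<and> fun_span B = V)"

definition linear_functional_on :: "('a \<Rightarrow> 'b::real_vector) set \<Rightarrow> (('a \<Rightarrow> 'b) \<Rightarrow> real) \<Rightarrow> bool" where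
  "linear_functional_on V F \<longleftrightarrow>
     (\<forall>f\<in>V. \<forall>g\<in>V. F (\<lambda>x. f x + g x) = F f + F g) \<and>
     (\<forall>c. \<forall>f\<in>V. F (\<lambda>x. c *\<^sub>R f x) = c * F f)"


section \<open>The Powell--Sabin split of a triangle\<close>

type_synonym R2 = "real \<times> real"

text \<open>An edge is given by its ordered pair of endpoints; boundary edges are oriented
  counter-clockwise.\<close>

type_synonym edge = "R2 \<times> R2"

definition edge_set :: "edge \<Rightarrow> R2 set" where
  "edge_set e = closed_segment (fst e) (snd e)"

text \<open>Successor of an index in 1, 2, 3 modulo 3.\<close>

definition nxt :: "nat \<Rightarrow> nat" where
  "nxt i = i mod 3 + 1"

definition triangle :: "(nat \<Rightarrow> R2) \<Rightarrow> R2 set" where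
  "triangle z = convex hull {z 1, z 2, z 3}"

definition opp_edge :: "(nat \<Rightarrow> R2) \<Rightarrow> nat \<Rightarrow> edge" where
  "opp_edge z i = (z (nxt i), z (nxt (nxt i)))"

text \<open>The points \<open>z 0, \<dots>, z 6\<close> form a Powell--Sabin configuration: the vertices \<open>z 1, z 2, z 3\<close>
  are not collinear and labelled counter-clockwise, \<open>z 0\<close> is an interior point of the triangle,
  and \<open>z (3 + i)\<close> is an interior point of the edge opposite \<open>z i\<close>.\<close>

definition powell_sabin :: "(nat \<Rightarrow> R2) \<Rightarrow> bool" where
  "powell_sabin z \<longleftrightarrow>
     0 < fst (z 2 - z 1) * snd (z 3 - z 1) - snd (z 2 - z 1) * fst (z 3 - z 1) \<and>
     z 0 \<in> interior (triangle z) \<and>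
     (\<forall>i\<in>{1,2,3}. z (3 + i) \<in> open_segment (z (nxt i)) (z (nxt (nxt i))))"

definition bdry_edges :: "(nat \<Rightarrow> R2) \<Rightarrow> edge set" where
  "bdry_edges z =
     (\<Union>i\<in>{1,2,3}. {(z (nxt i), z (3 + i)), (z (3 + i), z (nxt (nxt i)))})"

definition ps_split :: "(nat \<Rightarrow> R2) \<Rightarrow> R2 set set" where
  "ps_split z = (\<lambda>e. convex hull {z 0, fst e, snd e}) ` bdry_edges z"

text \<open>Clockwise rotation of the unit tangent: the outward unit normal, because the triangle lies
  to the left of its counter-clockwise oriented edges.\<close>

definition normal :: "edge \<Rightarrow> R2" where
  "normal e = (let t = snd e - fst e in (1 / norm t) *\<^sub>R (snd t, - fst t))"

text \<open>Integral over an edge with respect to arc length.\<close>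

definition edge_integral :: "edge \<Rightarrow> (R2 \<Rightarrow> real) \<Rightarrow> real" where
  "edge_integral e f =
     dist (fst e) (snd e) * integral {0..1} (\<lambda>t. f (linepath (fst e) (snd e) t))"


section \<open>Piecewise polynomial spaces\<close>

text \<open>A function on a set \<open>S\<close> is represented by its extension by zero to the whole plane, so that
  equality of functions is equality on \<open>S\<close>. The degree bound is an integer: for \<open>k < 0\<close> the sum
  is empty and the space is trivial. For an edge \<open>S\<close>, restrictions of polynomials in two variables
  are exactly the polynomials in the arc length parameter.\<close>

definition poly_on :: "int \<Rightarrow> R2 set \<Rightarrow> (R2 \<Rightarrow> real) set" where
  "poly_on k S = {f. \<exists>c :: nat \<Rightarrow> nat \<Rightarrow> real. \<forall>x. f x =
     (if x \<in> S then \<Sum>(i, j) \<in> {(i, j). int i + int j \<le> k}. c i j * fst x ^ i * snd x ^ j else 0)}"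

definition vec_poly_on :: "int \<Rightarrow> R2 set \<Rightarrow> (R2 \<Rightarrow> R2) set" where
  "vec_poly_on k S = {w. fst \<circ> w \<in> poly_on k S \<and> snd \<circ> w \<in> poly_on k S}"

text \<open>Only continuous members of the piecewise polynomial space are needed. For these, being
  polynomial almost everywhere on a triangle of the split is the same as being polynomial
  everywhere on it.\<close>

definition cont_pw_poly :: "int \<Rightarrow> (nat \<Rightarrow> R2) \<Rightarrow> (R2 \<Rightarrow> real) set" where
  "cont_pw_poly k z = {f. continuous_on (triangle z) f \<and> (\<forall>x. x \<notin> triangle z \<longrightarrow> f x = 0) \<and>
     (\<forall>S \<in> ps_split z. (\<lambda>x. if x \<in> S then f x else 0) \<in> poly_on k S)}"

text \<open>\<open>cont_rep z g d\<close>: the piecewise function \<open>g\<close>, of which only the values in the interiors of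
  the triangles of the split matter, has the continuous representative \<open>d\<close> on the triangle.
  Such a \<open>d\<close> is unique.\<close>

definition cont_rep :: "(nat \<Rightarrow> R2) \<Rightarrow> (R2 \<Rightarrow> 'a::real_normed_vector) \<Rightarrow> (R2 \<Rightarrow> 'a) \<Rightarrow> bool" where
  "cont_rep z g d \<longleftrightarrow> continuous_on (triangle z) d \<and> (\<forall>x. x \<notin> triangle z \<longrightarrow> d x = 0) \<and>
     (\<forall>S \<in> ps_split z. \<forall>x \<in> interior S. d x = g x)"

definition pw_div :: "(R2 \<Rightarrow> R2) \<Rightarrow> R2 \<Rightarrow> real" where
  "pw_div v x = fst (frechet_derivative v (at x) (1, 0)) + snd (frechet_derivative v (at x) (0, 1))"

definition pw_rot :: "(R2 \<Rightarrow> real) \<Rightarrow> R2 \<Rightarrow> R2" where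
  "pw_rot q x = (frechet_derivative q (at x) (0, 1), - frechet_derivative q (at x) (1, 0))"

definition cdiv :: "(nat \<Rightarrow> R2) \<Rightarrow> (R2 \<Rightarrow> R2) \<Rightarrow> R2 \<Rightarrow> real" where
  "cdiv z v = (THE d. cont_rep z (pw_div v) d)"

definition crot :: "(nat \<Rightarrow> R2) \<Rightarrow> (R2 \<Rightarrow> real) \<Rightarrow> R2 \<Rightarrow> R2" where
  "crot z q = (THE d. cont_rep z (pw_rot q) d)"

definition S1 :: "int \<Rightarrow> (nat \<Rightarrow> R2) \<Rightarrow> (R2 \<Rightarrow> R2) set" where
  "S1 k z = {v. fst \<circ> v \<in> cont_pw_poly k z \<and> snd \<circ> v \<in> cont_pw_poly k z \<and>
     (\<exists>d. cont_rep z (pw_div v) d)}"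

definition S0_ring :: "int \<Rightarrow> (nat \<Rightarrow> R2) \<Rightarrow> (R2 \<Rightarrow> real) set" where
  "S0_ring k z = {q \<in> cont_pw_poly k z. (\<exists>d. cont_rep z (pw_rot q) d) \<and>
     (\<forall>x \<in> frontier (triangle z). q x = 0 \<and> crot z q x = 0)}"

definition L2_ring :: "int \<Rightarrow> (nat \<Rightarrow> R2) \<Rightarrow> (R2 \<Rightarrow> real) set" where
  "L2_ring k z = {q \<in> cont_pw_poly k z.
     (\<forall>x \<in> frontier (triangle z). q x = 0) \<and> integral (triangle z) q = 0}"


section \<open>The degrees of freedom\<close>

text \<open>The degrees of freedom of \<open>v\<close> have the prescribed values. Where they are indexed by a space
  of test functions (moments on boundary edges \<open>D, E\<close> and on the triangle \<open>F, G\<close>), the prescribed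
  value is a function of the test function.\<close>

definition has_dofs ::
  "nat \<Rightarrow> (nat \<Rightarrow> R2) \<Rightarrow> (R2 \<Rightarrow> R2) \<Rightarrow>
   (nat \<Rightarrow> R2) \<Rightarrow> (nat \<Rightarrow> real) \<Rightarrow> (nat \<Rightarrow> real) \<Rightarrow> (nat \<Rightarrow> real) \<Rightarrow> (nat \<Rightarrow> real) \<Rightarrow>
   (edge \<Rightarrow> (R2 \<Rightarrow> R2) \<Rightarrow> real) \<Rightarrow> (edge \<Rightarrow> (R2 \<Rightarrow> real) \<Rightarrow> real) \<Rightarrow>
   ((R2 \<Rightarrow> real) \<Rightarrow> real) \<Rightarrow> ((R2 \<Rightarrow> real) \<Rightarrow> real) \<Rightarrow> bool" where
  "has_dofs r z v a a' b c c' D E F G \<longleftrightarrow>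
     (\<forall>i\<in>{1,2,3}. v (z i) = a i \<and> cdiv z v (z i) = a' i) \<and>
     (r = 1 \<longrightarrow> (\<forall>i\<in>{1,2,3}.
        edge_integral (opp_edge z i) (\<lambda>x. v x \<bullet> normal (opp_edge z i)) = b i)) \<and>
     (2 \<le> r \<longrightarrow> (\<forall>i\<in>{1,2,3}.
        v (z (3 + i)) \<bullet> normal (opp_edge z i) = c i \<and> cdiv z v (z (3 + i)) = c' i)) \<and>
     (\<forall>e\<in>bdry_edges z. \<forall>w\<in>vec_poly_on (int r - 2) (edge_set e).
        edge_integral e (\<lambda>x. v x \<bullet> w x) = D e w) \<and>
     (\<forall>e\<in>bdry_edges z. \<forall>q\<in>poly_on (int r - 3) (edge_set e).
        edge_integral e (\<lambda>x. cdiv z v x * q x) = E e q) \<and>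
     (\<forall>q\<in>S0_ring (int r + 1) z. integral (triangle z) (\<lambda>x. v x \<bullet> crot z q x) = F q) \<and>
     (\<forall>q\<in>L2_ring (int r - 1) z. integral (triangle z) (\<lambda>x. cdiv z v x * q x) = G q)"

end

theory Submission
  imports Defs "HOL-Computational_Algebra.Polynomial"
begin

text \<open>
  For uniqueness let all degrees of freedom of \<open>v\<close> vanish. A polynomial \<open>g\<close> of degree \<open>r\<close> on a
  boundary edge that is orthogonal to polynomials of degree \<open>r - 2\<close> is orthogonal to \<open>g''\<close>, so the
  boundary terms of \<open>g g'\<close> equal \<open>\<integral>(g')\<^sup>2\<close>. Applied to the normal component this gives \<open>v \<cdot> n = 0\<close> on
  the boundary; then continuity of the divergence at \<open>z\<^sub>3\<^sub>+\<^sub>i\<close> makes the tangential component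
  continuously differentiable there, the boundary terms of the two halves of an edge have opposite
  signs, and \<open>v = 0\<close> on the boundary. The same argument gives \<open>div v = 0\<close> on the boundary. Hence
  \<open>div v\<close> and afterwards the stream function of \<open>v\<close> are admissible test functions, and \<open>v = 0\<close>.

  For existence it suffices that \<open>S1 r\<close> has dimension at least the number \<open>6 r\<^sup>2 + 3\<close> of degrees of
  freedom. Continuity of the divergence across the six spokes imposes at most \<open>6 r - 1\<close> conditions on
  continuous piecewise polynomial fields, which form a space of dimension \<open>6 r (r + 1) + 2\<close>. The
  dimension of \<open>S0_ring (r + 1)\<close> is bounded above by expanding in powers of the hat function of \<open>z\<^sub>0\<close>;
  the lower bound comes out of the same count.
\<close>

section \<open>Linear functionals and dimension\<close>

text \<open>The two halves are coupled. Before the degrees of freedom are counted, the space of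
  stream functions is only known to have dimension at most \<open>3 * (r - 1) * (r - 2)\<close>, so
  the number of conditions in (f) is not yet known. Uniqueness bounds the dimension of
  \<open>S1\<close> by the number of functionals, the continuity conditions bound it from below by
  \<open>6 * r * r + 3\<close>, and the two bounds are compatible only if that dimension is
  attained. Then separating functionals, no more than there are dimensions, take arbitrary values.

  The squeeze needs \<open>2 \<le> r\<close>. For \<open>r = 1\<close> the divergence is a single
  constant, so its three vertex values cannot be prescribed independently and only uniqueness is
  asserted.

  Divergence and rotation are defined by derivatives inside the small triangles. The work is done
  with polynomial pieces, each determined by its values on one small triangle; continuity becomes
  equality of coefficients in coordinates whose axes are the spokes. A divergence theorem is needed
  only to give \<open>div v\<close> mean zero, and translation invariance of the integral supplies
  it without boundary integrals.\<close>

lemma fun_subspaceI: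
  assumes "(\<lambda>x. 0) \<in> V" "\<And>f g. f \<in> V \<Longrightarrow> g \<in> V \<Longrightarrow> (\<lambda>x. f x + g x) \<in> V"
    "\<And>c f. f \<in> V \<Longrightarrow> (\<lambda>x. c *\<^sub>R f x) \<in> V"
  shows "fun_vs.subspace V"
  using assms by (auto simp: fun_vs.subspace_def zero_fun_def plus_fun_def)

lemma fun_subspaceD:
  assumes "fun_vs.subspace V"
  shows "(\<lambda>x. 0) \<in> V" "f \<in> V \<Longrightarrow> g \<in> V \<Longrightarrow> (\<lambda>x. f x + g x) \<in> V"
    "f \<in> V \<Longrightarrow> (\<lambda>x. c *\<^sub>R f x) \<in> V"
  using assms by (auto simp: fun_vs.subspace_def zero_fun_def plus_fun_def)

lemma fun_subspace_diff:
  assumes "fun_vs.subspace V" "f \<in> V" "g \<in> V"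
  shows "(\<lambda>x. f x - g x) \<in> V"
  using fun_subspaceD(2)[OF assms(1,2) fun_subspaceD(3)[OF assms(1,3), of "-1"]] by simp

lemma fun_subspace_sum:
  assumes "fun_vs.subspace V" "\<And>i. i \<in> I \<Longrightarrow> b i \<in> V"
  shows "(\<lambda>x. \<Sum>i\<in>I. c i *\<^sub>R b i x) \<in> V"
  using assms(2)
  by (induction I rule: infinite_finite_induct) (auto simp: fun_subspaceD[OF assms(1)])

lemma linear_functional_onI:
  assumes "\<And>f g. f \<in> V \<Longrightarrow> g \<in> V \<Longrightarrow> F (\<lambda>x. f x + g x) = F f + F g"
    "\<And>c f. f \<in> V \<Longrightarrow> F (\<lambda>x. c *\<^sub>R f x) = c * F f"
  shows "linear_functional_on V F"
  using assms by (auto simp: linear_functional_on_def)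

lemma linear_functional_onD:
  assumes "linear_functional_on V F"
  shows "f \<in> V \<Longrightarrow> g \<in> V \<Longrightarrow> F (\<lambda>x. f x + g x) = F f + F g"
    "f \<in> V \<Longrightarrow> F (\<lambda>x. c *\<^sub>R f x) = c * F f"
  using assms by (auto simp: linear_functional_on_def)

lemma linear_functional_on_subset:
  "linear_functional_on V F \<Longrightarrow> U \<subseteq> V \<Longrightarrow> linear_functional_on U F"
  unfolding linear_functional_on_def by blast

lemma linear_functional_on_zero:
  assumes "linear_functional_on V F" "fun_vs.subspace V"
  shows "F (\<lambda>x. 0) = 0"
  using linear_functional_onD(2)[OF assms(1) fun_subspaceD(1)[OF assms(2)], of 0] by simp

lemma linear_functional_on_diff:
  assumes "linear_functional_on V F" "fun_vs.subspace V" "f \<in> V" "g \<in> V"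
  shows "F (\<lambda>x. f x - g x) = F f - F g"
  using linear_functional_onD(1)[OF assms(1,3) fun_subspaceD(3)[OF assms(2,4), of "-1"]]
    linear_functional_onD(2)[OF assms(1,4), of "-1"] by simp

lemma linear_functional_on_sum:
  assumes "linear_functional_on V F" "fun_vs.subspace V" "finite I" "\<And>i. i \<in> I \<Longrightarrow> b i \<in> V"
  shows "F (\<lambda>x. \<Sum>i\<in>I. c i *\<^sub>R b i x) = (\<Sum>i\<in>I. c i * F (b i))"
  using assms(3,4)
proof (induction I rule: finite_induct)
  case empty
  then show ?case using linear_functional_on_zero[OF assms(1,2)] by simp
next
  case (insert i I)
  have 1: "(\<lambda>x. c i *\<^sub>R b i x) \<in> V" using fun_subspaceD(3)[OF assms(2)] insert by auto
  have 2: "(\<lambda>x. \<Sum>i\<in>I. c i *\<^sub>R b i x) \<in> V" using insert by (intro fun_subspace_sum[OF assms(2)]) auto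
  show ?case
    using insert linear_functional_onD(1)[OF assms(1) 1 2] linear_functional_onD(2)[OF assms(1), of "b i" "c i"]
    by simp
qed

lemma fun_subspace_kernel:
  assumes "fun_vs.subspace V" "\<And>i. i \<in> I \<Longrightarrow> linear_functional_on V (F i)"
  shows "fun_vs.subspace {v\<in>V. \<forall>i\<in>I. F i v = 0}"
  using fun_subspaceD[OF assms(1)] linear_functional_onD[OF assms(2)]
    linear_functional_on_zero[OF assms(2,1)]
  by (intro fun_subspaceI) auto

section \<open>Dimension bounds obtained from functionals\<close>

lemma has_dim_unique: "has_dim V m \<Longrightarrow> has_dim V n \<Longrightarrow> m = n"
  unfolding has_dim_def using fun_vs.dim_span_eq_card_independent by metis

lemma has_dim_zero: "has_dim {\<lambda>x. 0} 0"
  unfolding has_dim_def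
  by (intro exI[of _ "{}"]) (auto simp: fun_vs.independent_empty zero_fun_def)

text \<open>What is recorded is that a functional is determined by its values on \<open>B\<close>,
  and how many functionals \<open>B\<close> contributes to a finite list.\<close>

definition spanning :: "('a \<Rightarrow> 'b::real_vector) set \<Rightarrow> nat \<Rightarrow> ('a
    \<Rightarrow> 'b) set \<Rightarrow> bool" where
  "spanning V n B \<longleftrightarrow>
     finite B \<and> card B = n \<and> B \<subseteq> V \<and> (\<forall>v\<in>V. \<exists>c. v =
         (\<lambda>x. \<Sum>b\<in>B. c b *\<^sub>R b x))"

lemma spanningD: "spanning V n B \<Longrightarrow> finite B \<and> card B = n \<and> B \<subseteq> V"
  by (simp add: spanning_def)

lemma has_dim_ex_spanning:
  assumes "has_dim V n" shows "\<exists>B. spanning V n B"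
proof -
  obtain B where B: "finite B" "card B = n" "fun_span B = V"
    using assms by (auto simp: has_dim_def)
  have "\<exists>c. v = (\<lambda>x. \<Sum>b\<in>B. c b *\<^sub>R b x)" if "v \<in> V" for v
  proof -
    obtain c where "v = (\<Sum>b\<in>B. (\<lambda>x. c b *\<^sub>R b x))"
      using B \<open>v \<in> V\<close> by (auto simp: fun_vs.span_finite)
    moreover have "(\<Sum>b\<in>C. (\<lambda>x. c b *\<^sub>R b x)) = (\<lambda>x. \<Sum>b\<in>C. c b
        *\<^sub>R b x)" for C
      by (induction C rule: infinite_finite_induct) (auto simp: zero_fun_def plus_fun_def)
    ultimately show ?thesis by auto
  qed
  then have "spanning V n B"
    unfolding spanning_def using B fun_vs.span_superset[of B] by blast
  then show ?thesis ..
qed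

text \<open>A maximal independent subset of \<open>U\<close> cannot be larger than a spanning set of
  \<open>V\<close>, so it is finite and serves as a basis.\<close>

lemma has_dim_subspace:
  assumes "has_dim V n" "fun_vs.subspace U" "U \<subseteq> V"
  shows "\<exists>m\<le>n. has_dim U m"
proof -
  obtain B where B: "finite B" "card B = n" "fun_span B = V"
    using assms(1) by (auto simp: has_dim_def)
  obtain C where C: "C \<subseteq> U" "\<not> fun_dependent C" "U \<subseteq> fun_span C"
    using fun_vs.maximal_independent_subset by metis
  have "finite C \<and> card C \<le> card B"
    using fun_vs.independent_span_bound[OF B(1) C(2)] C(1) assms(3) B(3) by auto
  moreover have "fun_span C = U"
    using C assms(2) fun_vs.span_minimal[of C U] by auto
  ultimately show ?thesis using C B unfolding has_dim_def by blast
qed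

text \<open>One vector outside the kernel completes a basis of the kernel: every \<open>w\<close>
  differs from the multiple \<open>F w / F v\<close> of \<open>v\<close> by a kernel
  element.\<close>

lemma has_dim_kernel_Suc:
  assumes V: "fun_vs.subspace V" and F: "linear_functional_on V F"
    and v: "v \<in> V" "F v \<noteq> 0" and m: "has_dim {w\<in>V. F w = 0} m"
  shows "has_dim V (Suc m)"
proof -
  obtain B where B: "finite B" "card B = m" "\<not> fun_dependent B" "fun_span B = {w\<in>V. F w = 0}"
    using m by (auto simp: has_dim_def)
  have nv: "v \<notin> fun_span B" using B(4) v by auto
  have ins: "\<not> fun_dependent (insert v B)"
    using fun_vs.independent_insertI[OF nv B(3)] .
  have "V \<subseteq> fun_span (insert v B)"
  proof
    fix w assume w: "w \<in> V"
    let ?k = "F w / F v"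
    have 1: "(\<lambda>x. ?k *\<^sub>R v x) \<in> V" by (rule fun_subspaceD(3)[OF V v(1)])
    have "F (\<lambda>x. w x - ?k *\<^sub>R v x) = 0"
      using linear_functional_on_diff[OF F V w 1] linear_functional_onD(2)[OF F v(1), of ?k] v by simp
    then have "w - (\<lambda>x. ?k *\<^sub>R v x) \<in> fun_span B"
      using B(4) fun_subspace_diff[OF V w 1] by (simp add: fun_diff_def)
    then show "w \<in> fun_span (insert v B)" using fun_vs.span_breakdown_eq by blast
  qed
  moreover have "insert v B \<subseteq> V" using B(4) v fun_vs.span_superset[of B] by auto
  then have "fun_span (insert v B) \<subseteq> V" using V fun_vs.span_minimal by blast
  moreover have "v \<notin> B" using nv fun_vs.span_superset[of B] by blast
  ultimately show ?thesis unfolding has_dim_def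
    using B ins by (intro exI[of _ "insert v B"]) auto
qed

text \<open>One functional is split off at a time; on its kernel the remaining ones still separate
  points. Finite dimension is part of the conclusion, which is what turns uniqueness into a
  dimension bound.\<close>

lemma has_dim_le_card:
  assumes "finite I" "fun_vs.subspace V" "\<And>i. i \<in> I \<Longrightarrow> linear_functional_on V (F i)"
    "\<And>v. v \<in> V \<Longrightarrow> (\<And>i. i \<in> I \<Longrightarrow> F i v = 0) \<Longrightarrow> v = (\<lambda>x. 0)"
  shows "\<exists>m\<le>card I. has_dim V m"
  using assms
proof (induction I arbitrary: V rule: finite_induct)
  case empty
  then have "V = {\<lambda>x. 0}" using fun_subspaceD(1) by fast
  then show ?case using has_dim_zero by auto
next
  case (insert i I)
  let ?U = "{v\<in>V. F i v = 0}"
  have sU: "fun_vs.subspace ?U"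
    using fun_subspace_kernel[of V "{i}" F] insert.prems by auto
  have "\<exists>m\<le>card I. has_dim ?U m"
    using insert.prems
    by (intro insert.IH[OF sU]) (auto intro: linear_functional_on_subset)
  then obtain m where m: "m \<le> card I" "has_dim ?U m" by auto
  show ?case
  proof (cases "\<exists>v\<in>V. F i v \<noteq> 0")
    case True
    then have "has_dim V (Suc m)" using has_dim_kernel_Suc[OF insert.prems(1) _ _ _ m(2)] insert.prems(2) by
        auto
    then show ?thesis using m insert.hyps by (intro exI[of _ "Suc m"]) auto
  next
    case False
    then have "?U = V" by auto
    then show ?thesis using m insert.hyps by (intro exI[of _ m]) auto
  qed
qed

text \<open>Passing to the kernel of one functional costs at most one dimension; this is how
  continuity conditions are counted.\<close>

lemma has_dim_kernel_ge:
  assumes "finite I" "fun_vs.subspace V" "\<And>i. i \<in> I \<Longrightarrow> linear_functional_on V (F i)" "has_dim V n"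
  shows "\<exists>k. has_dim {v\<in>V. \<forall>i\<in>I. F i v = 0} k \<and> n \<le> k + card I"
  using assms
proof (induction I arbitrary: V n rule: finite_induct)
  case empty
  then show ?case by auto
next
  case (insert i I)
  let ?U = "{v\<in>V. F i v = 0}"
  have sU: "fun_vs.subspace ?U"
    using fun_subspace_kernel[of V "{i}" F] insert.prems by auto
  obtain m where m: "has_dim ?U m"
    using has_dim_subspace[OF insert.prems(3) sU] by auto
  have nm: "n \<le> Suc m"
  proof (cases "\<exists>v\<in>V. F i v \<noteq> 0")
    case True
    then have "has_dim V (Suc m)" using has_dim_kernel_Suc[OF insert.prems(1) _ _ _ m] insert.prems(2) by auto
    then show ?thesis using has_dim_unique insert.prems(3) by fastforce
  next
    case False
    then have "?U = V" by auto
    then show ?thesis using m has_dim_unique insert.prems(3) by fastforce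
  qed
  have "\<exists>k. has_dim {v\<in>?U. \<forall>i\<in>I. F i v = 0} k \<and> m \<le> k + card I"
    using insert.prems m by (intro insert.IH[OF sU]) (auto intro: linear_functional_on_subset)
  moreover have "{v\<in>?U. \<forall>i\<in>I. F i v = 0} = {v\<in>V. \<forall>j\<in>insert i I. F j v = 0}" by auto
  ultimately show ?case using nm insert.hyps by force
qed

text \<open>Dropping one functional leaves, by counting, a nonzero vector in the common kernel of the
  others; rescaled, these vectors form a dual basis.\<close>

lemma functionals_surj:
  assumes I: "finite I" "card I \<le> n" and V: "fun_vs.subspace V"
    and F: "\<And>i. i \<in> I \<Longrightarrow> linear_functional_on V (F i)" and n: "has_dim V n"
    and inj: "\<And>v. v \<in> V \<Longrightarrow> (\<And>i. i \<in> I \<Longrightarrow> F i v = 0) \<Longrightarrow> v = (\<lambda>x. 0)"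
  shows "\<exists>v\<in>V. \<forall>i\<in>I. F i v = c i"
proof -
  have "\<exists>u\<in>V. F i u = 1 \<and> (\<forall>j\<in>I-{i}. F j u = 0)" if i: "i \<in> I" for i
  proof -
    let ?K = "{v\<in>V. \<forall>j\<in>I-{i}. F j v = 0}"
    obtain k where k: "has_dim ?K k" "n \<le> k + card (I - {i})"
      using has_dim_kernel_ge[of "I-{i}" V F n] I V F n by auto
    have "card (I - {i}) < card I" using I i by (meson card_Diff1_less)
    then have "k \<noteq> 0" using k(2) I(2) by auto
    then have "?K \<noteq> {\<lambda>x. 0}" using k(1) has_dim_unique has_dim_zero by metis
    moreover have "(\<lambda>x. 0) \<in> ?K"
      using fun_subspaceD(1)[OF fun_subspace_kernel[of V "I-{i}" F]] V F by auto
    ultimately obtain u where u: "u \<in> ?K" "u \<noteq> (\<lambda>x. 0)" by blast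
    then have nz: "F i u \<noteq> 0" using inj[of u] by blast
    let ?w = "\<lambda>x. (1 / F i u) *\<^sub>R u x"
    have "F j ?w = 1 / F i u * F j u" if "j \<in> I" for j
      using linear_functional_onD(2)[OF F[OF that]] u by auto
    then show ?thesis
      using u nz i fun_subspaceD(3)[OF V] by (intro bexI[of _ ?w]) auto
  qed
  then obtain u where u: "\<And>i. i \<in> I \<Longrightarrow> u i \<in> V \<and> F i (u i) = 1 \<and> (\<forall>j\<in>I-{i}. F j (u i) = 0)"
    by metis
  let ?v = "\<lambda>x. \<Sum>i\<in>I. c i *\<^sub>R u i x"
  have "F j ?v = c j" if j: "j \<in> I" for j
  proof -
    have "F j ?v = (\<Sum>i\<in>I. c i * F j (u i))"
      using u by (intro linear_functional_on_sum[OF F[OF j] V I(1)]) auto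
    also have "\<dots> = (\<Sum>i\<in>I. if i = j then c i else 0)"
      using u j by (intro sum.cong) auto
    finally show ?thesis using I j by simp
  qed
  moreover have "?v \<in> V" using u by (intro fun_subspace_sum[OF V]) auto
  ultimately show ?thesis by blast
qed

text \<open>Applying \<open>F j\<close> to a vanishing combination of the \<open>b i\<close>
  isolates its coefficient at \<open>j\<close>, so the \<open>b i\<close> are independent, while the
  separating \<open>F i\<close> bound the dimension from above by the same number. The spanning
  property comes for free.\<close>

lemma has_dim_biorthogonal:
  assumes I: "finite I" and V: "fun_vs.subspace V"
    and F: "\<And>i. i \<in> I \<Longrightarrow> linear_functional_on V (F i)"
    and b: "\<And>i. i \<in> I \<Longrightarrow> b i \<in> V"
    and Fb: "\<And>i j. i \<in> I \<Longrightarrow> j \<in> I \<Longrightarrow> F i (b j) = (if i = j then 1 else 0)"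
    and inj: "\<And>v. v \<in> V \<Longrightarrow> (\<And>i. i \<in> I \<Longrightarrow> F i v = 0) \<Longrightarrow> v = (\<lambda>x. 0)"
  shows "has_dim V (card I)"
proof -
  obtain m where m: "m \<le> card I" "has_dim V m" using has_dim_le_card[where F = F, OF I V F] inj by blast
  obtain B where B: "finite B" "card B = m" "fun_span B = V"
    using m(2) by (auto simp: has_dim_def)
  have injb: "inj_on b I" using Fb by (intro inj_onI) (metis zero_neq_one)
  have "\<not> fun_dependent (b ` I)"
  proof
    assume "fun_dependent (b ` I)"
    then obtain u where u: "(\<Sum>v\<in>b`I. (\<lambda>x. u v *\<^sub>R v x)) = 0" "\<exists>v\<in>b`I. u v \<noteq> 0"
      using fun_vs.dependent_finite[of "b`I"] I by auto
    then obtain j where j: "j \<in> I" "u (b j) \<noteq> 0" by auto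
    have s: "(\<Sum>i\<in>J. (\<lambda>x. u (b i) *\<^sub>R b i x)) = (\<lambda>x. \<Sum>i\<in>J. u (b i) *\<^sub>R b i x)" for J
      by (induction J rule: infinite_finite_induct) (auto simp: zero_fun_def plus_fun_def)
    have "(\<lambda>x. \<Sum>i\<in>I. u (b i) *\<^sub>R b i x) = (\<lambda>x. 0)"
      using u(1) unfolding sum.reindex[OF injb] o_def s by (simp add: zero_fun_def)
    then have "0 = F j (\<lambda>x. \<Sum>i\<in>I. u (b i) *\<^sub>R b i x)"
      using linear_functional_on_zero[OF F[OF j(1)] V] by simp
    also have "\<dots> = (\<Sum>i\<in>I. u (b i) * F j (b i))"
      by (rule linear_functional_on_sum[OF F[OF j(1)] V I b])
    also have "\<dots> = (\<Sum>i\<in>I. if i = j then u (b i) else 0)"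
      using Fb j by (intro sum.cong) auto
    finally show False using I j by simp
  qed
  then have "card (b ` I) \<le> card B"
    using fun_vs.independent_span_bound[OF B(1)] B(3) b by blast
  then show ?thesis using m B card_image[OF injb] by auto
qed

text \<open>A map that is linear and injective on \<open>V\<close> alone transports a basis. It is
  applied to multiplication by the hat function of the centre.\<close>

lemma has_dim_inj_image:
  fixes L :: "('a \<Rightarrow> 'b::real_vector) \<Rightarrow> ('c \<Rightarrow> 'd::real_vector)"
  assumes V: "fun_vs.subspace V" "has_dim V n"
    and add: "\<And>f g. f \<in> V \<Longrightarrow> g \<in> V \<Longrightarrow> L (\<lambda>x. f x + g x) = (\<lambda>x. L f x + L g x)"
    and scale: "\<And>c f. f \<in> V \<Longrightarrow> L (\<lambda>x. c *\<^sub>R f x) = (\<lambda>x. c *\<^sub>R L f x)"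
    and inj: "\<And>f. f \<in> V \<Longrightarrow> L f = (\<lambda>x. 0) \<Longrightarrow> f = (\<lambda>x. 0)"
  shows "has_dim (L ` V) n"
proof -
  obtain B where B: "finite B" "card B = n" "\<not> fun_dependent B" "fun_span B = V"
    using V(2) by (auto simp: has_dim_def)
  have BV: "B \<subseteq> V" using B(4) fun_vs.span_superset by blast
  have L0: "L (\<lambda>x. 0) = (\<lambda>x. 0)" using scale[OF fun_subspaceD(1)[OF V(1)], of 0] by simp
  have sL: "L (\<lambda>x. \<Sum>b\<in>C. c b *\<^sub>R b x) = (\<lambda>x. \<Sum>b\<in>C. c b *\<^sub>R L b x)" if "finite C" "C \<subseteq> V" for C c
    using that
  proof (induction C rule: finite_induct)
    case (insert b C)
    have 1: "(\<lambda>x. c b *\<^sub>R b x) \<in> V" using fun_subspaceD(3)[OF V(1)] insert by auto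
    have 2: "(\<lambda>x. \<Sum>b\<in>C. c b *\<^sub>R b x) \<in> V" using insert by (intro fun_subspace_sum[OF V(1)]) auto
    show ?case using insert add[OF 1 2] scale by simp
  qed (simp add: L0)
  have sums: "(\<Sum>i\<in>J. (\<lambda>x. u i *\<^sub>R f i x)) = (\<lambda>x. \<Sum>i\<in>J. u i *\<^sub>R f i x)"
    for J :: "'j set" and u and f :: "'j \<Rightarrow> 'e \<Rightarrow> 'f::real_vector"
    by (induction J rule: infinite_finite_induct) (auto simp: zero_fun_def plus_fun_def)
  have injL: "inj_on L V"
  proof (rule inj_onI)
    fix f g assume fg: "f \<in> V" "g \<in> V" "L f = L g"
    have "L (\<lambda>x. f x + (-1) *\<^sub>R g x) = (\<lambda>x. L f x + (-1) *\<^sub>R L g x)"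
      using add[OF fg(1) fun_subspaceD(3)[OF V(1) fg(2)], of "-1"] scale[OF fg(2), of "-1"] by simp
    then have "(\<lambda>x. f x - g x) = (\<lambda>x. 0)"
      using fg fun_subspace_diff[OF V(1) fg(1,2)] by (intro inj) auto
    then show "f = g" by (auto simp: fun_eq_iff)
  qed
  have injB: "inj_on L B" using injL BV inj_on_subset by blast
  have ind: "\<not> fun_dependent (L ` B)"
  proof
    assume "fun_dependent (L ` B)"
    then obtain u where u: "(\<Sum>v\<in>L`B. (\<lambda>x. u v *\<^sub>R v x)) = 0" "\<exists>v\<in>L`B. u v \<noteq> 0"
      using fun_vs.dependent_finite[of "L`B"] B(1) by auto
    have "L (\<lambda>x. \<Sum>b\<in>B. u (L b) *\<^sub>R b x) = (\<lambda>x. 0)"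
      using u(1) unfolding sum.reindex[OF injB] o_def sums sL[OF B(1) BV] by (simp add: zero_fun_def)
    then have "(\<lambda>x. \<Sum>b\<in>B. u (L b) *\<^sub>R b x) = (\<lambda>x. 0)"
      using BV by (intro inj fun_subspace_sum[OF V(1)]) auto
    then have "(\<Sum>b\<in>B. (\<lambda>x. u (L b) *\<^sub>R b x)) = 0" by (simp add: sums zero_fun_def)
    then have "fun_dependent B"
      using fun_vs.dependent_finite[OF B(1)] u(2) by auto
    then show False using B(3) by simp
  qed
  have "fun_span (L ` B) = L ` V"
  proof
    have sub: "fun_vs.subspace (L ` V)"
    proof (rule fun_subspaceI)
      show "(\<lambda>x. 0) \<in> L ` V" using L0 fun_subspaceD(1)[OF V(1)] by (metis imageI)
    next
      fix f g assume "f \<in> L ` V" "g \<in> L ` V"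
      then show "(\<lambda>x. f x + g x) \<in> L ` V"
        using add fun_subspaceD(2)[OF V(1)] by (auto simp: image_iff) metis
    next
      fix c f assume "f \<in> L ` V"
      then show "(\<lambda>x. c *\<^sub>R f x) \<in> L ` V"
        using scale fun_subspaceD(3)[OF V(1)] by (auto simp: image_iff) metis
    qed
    show "fun_span (L ` B) \<subseteq> L ` V" using fun_vs.span_minimal[OF _ sub] BV by blast
    show "L ` V \<subseteq> fun_span (L ` B)"
    proof
      fix w assume "w \<in> L ` V"
      then obtain v where v: "v \<in> V" "w = L v" by auto
      then obtain c where "v = (\<Sum>b\<in>B. (\<lambda>x. c b *\<^sub>R b x))"
        using B by (auto simp: fun_vs.span_finite)
      then have "w = (\<Sum>b\<in>B. (\<lambda>x. c b *\<^sub>R L b x))" using v sL[OF B(1) BV] by (simp add: sums)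
      moreover have "(\<lambda>x. c b *\<^sub>R L b x) \<in> fun_span (L ` B)" if "b \<in> B" for b
        using that by (intro fun_vs.span_scale fun_vs.span_base imageI)
      ultimately show "w \<in> fun_span (L ` B)"
        using fun_vs.span_sum[of B "\<lambda>b x. c b *\<^sub>R L b x"] by blast
    qed
  qed
  then show ?thesis using ind B card_image[OF injB] unfolding has_dim_def
    by (intro exI[of _ "L ` B"]) auto
qed

section \<open>Vector fields as pairs of scalar functions\<close>

definition pair_funs :: "('a \<Rightarrow> real) set \<Rightarrow> ('a \<Rightarrow> real) set \<Rightarrow> ('a \<Rightarrow> R2) set" where
  "pair_funs V W = {v. fst \<circ> v \<in> V \<and> snd \<circ> v \<in> W}"

lemma fun_subspace_pair_funs:
  assumes "fun_vs.subspace V" "fun_vs.subspace W"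
  shows "fun_vs.subspace (pair_funs V W)"
  using fun_subspaceD[OF assms(1)] fun_subspaceD[OF assms(2)]
  by (intro fun_subspaceI) (auto simp: pair_funs_def o_def)

lemma has_dim_pair_funs:
  assumes V: "fun_vs.subspace V" "has_dim V m" and W: "fun_vs.subspace W" "has_dim W n"
  shows "has_dim (pair_funs V W) (m + n)"
proof -
  obtain B where B: "finite B" "card B = m" "\<not> fun_dependent B" "fun_span B = V"
    using V(2) by (auto simp: has_dim_def)
  obtain C where C: "finite C" "card C = n" "\<not> fun_dependent C" "fun_span C = W"
    using W(2) by (auto simp: has_dim_def)
  \<comment> \<open>The indices live in a disjoint sum because \<open>V\<close> and
    \<open>W\<close>, and with them \<open>B\<close> and \<open>C\<close>, may coincide.\<close>
  define I where "I = Inl ` B \<union> Inr ` C"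
  define \<phi> where "\<phi> = (\<lambda>i v. case i of Inl b \<Rightarrow> fun_vs.representation B (fst \<circ> v) b
                          | Inr c \<Rightarrow> fun_vs.representation C (snd \<circ> v) c)"
  define \<beta> :: "('a \<Rightarrow> real) + ('a \<Rightarrow> real) \<Rightarrow> 'a \<Rightarrow> R2" where
    "\<beta> = (\<lambda>i. case i of Inl b \<Rightarrow> (\<lambda>x. (b x, 0)) | Inr c \<Rightarrow> (\<lambda>x. (0, c x)))"
  have BV: "B \<subseteq> V" and CW: "C \<subseteq> W" using B(4) C(4) fun_vs.span_superset by blast+
  have zB: "fun_vs.representation B (\<lambda>x. 0) = (\<lambda>_. 0)" and zC: "fun_vs.representation C (\<lambda>x. 0) = (\<lambda>_. 0)"
    using fun_vs.representation_zero[of B] fun_vs.representation_zero[of C] by (simp_all add: zero_fun_def)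
  have "has_dim (pair_funs V W) (card I)"
  proof (rule has_dim_biorthogonal[where F = \<phi> and b = \<beta>])
    show "finite I" using B C by (simp add: I_def)
    show "fun_vs.subspace (pair_funs V W)" by (rule fun_subspace_pair_funs[OF V(1) W(1)])
  next
    fix i assume "i \<in> I"
    show "linear_functional_on (pair_funs V W) (\<phi> i)"
    proof (rule linear_functional_onI)
      fix f g :: "'a \<Rightarrow> R2" assume fg: "f \<in> pair_funs V W" "g \<in> pair_funs V W"
      have "fst \<circ> (\<lambda>x. f x + g x) = (fst \<circ> f) + (fst \<circ> g)" "snd \<circ> (\<lambda>x. f x + g x) = (snd \<circ> f) + (snd \<circ> g)"
        by (auto simp: o_def plus_fun_def)
      then show "\<phi> i (\<lambda>x. f x + g x) = \<phi> i f + \<phi> i g"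
        using fg fun_vs.representation_add[OF B(3)] fun_vs.representation_add[OF C(3)] B(4) C(4)
        by (auto simp: \<phi>_def pair_funs_def split: sum.splits)
    next
      fix c :: real and f :: "'a \<Rightarrow> R2" assume f: "f \<in> pair_funs V W"
      have "fst \<circ> (\<lambda>x. c *\<^sub>R f x) = (\<lambda>x. c *\<^sub>R (fst \<circ> f) x)" "snd \<circ> (\<lambda>x. c *\<^sub>R f x) = (\<lambda>x. c *\<^sub>R (snd \<circ> f) x)"
        by auto
      then show "\<phi> i (\<lambda>x. c *\<^sub>R f x) = c * \<phi> i f"
        using f fun_vs.representation_scale[OF B(3), of "fst \<circ> f" c]
          fun_vs.representation_scale[OF C(3), of "snd \<circ> f" c] B(4) C(4)
        by (cases i) (simp_all add: \<phi>_def pair_funs_def)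
    qed
    show "\<beta> i \<in> pair_funs V W"
      using \<open>i \<in> I\<close> BV CW fun_subspaceD(1)[OF V(1)] fun_subspaceD(1)[OF W(1)]
      by (auto simp: I_def \<beta>_def pair_funs_def o_def)
  next
    fix i j assume ij: "i \<in> I" "j \<in> I"
    show "\<phi> i (\<beta> j) = (if i = j then 1 else 0)"
      using ij fun_vs.representation_basis[OF B(3)] fun_vs.representation_basis[OF C(3)]
      by (auto simp: I_def \<phi>_def \<beta>_def o_def zB[unfolded real_scaleR_def] zC[unfolded real_scaleR_def]
          split: if_splits)
  next
    fix v assume v: "v \<in> pair_funs V W" "\<And>i. i \<in> I \<Longrightarrow> \<phi> i v = 0"
    have "(\<Sum>b | fun_vs.representation B (fst \<circ> v) b \<noteq> 0. (\<lambda>x. fun_vs.representation B (fst \<circ> v) b *\<^sub>R b x)) =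
        fst \<circ> v"
      using fun_vs.sum_nonzero_representation_eq[OF B(3)] v(1) B(4) by (simp add: pair_funs_def)
    moreover have "{b. fun_vs.representation B (fst \<circ> v) b \<noteq> 0} = {}"
      using v(2) fun_vs.representation_ne_zero[of B] by (force simp: \<phi>_def I_def)
    ultimately have 1: "fst \<circ> v = 0" by simp
    have "(\<Sum>b | fun_vs.representation C (snd \<circ> v) b \<noteq> 0. (\<lambda>x. fun_vs.representation C (snd \<circ> v) b *\<^sub>R b x)) =
        snd \<circ> v"
      using fun_vs.sum_nonzero_representation_eq[OF C(3)] v(1) C(4) by (simp add: pair_funs_def)
    moreover have "{b. fun_vs.representation C (snd \<circ> v) b \<noteq> 0} = {}"
      using v(2) fun_vs.representation_ne_zero[of C] by (force simp: \<phi>_def I_def)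
    ultimately have "snd \<circ> v = 0" by simp
    then show "v = (\<lambda>x. 0)" using 1 by (auto simp: fun_eq_iff prod_eq_iff)
  qed
  moreover have "card I = m + n" unfolding I_def
    using B C by (subst card_Un_disjoint) (auto simp: card_image)
  ultimately show ?thesis by simp
qed

section \<open>Bivariate polynomials\<close>

definition tri :: "nat \<Rightarrow> (nat \<times> nat) set" where
  "tri n = {(i, j). i + j \<le> n}"

lemma finite_tri [simp]: "finite (tri n)"
  by (rule finite_subset[of _ "{..n} \<times> {..n}"]) (auto simp: tri_def)

lemma sum_tri: "sum f (tri n) = (\<Sum>i\<le>n. \<Sum>j\<le>n-i. f (i, j))"
proof -
  have "tri n = Sigma {..n} (\<lambda>i. {..n-i})" by (auto simp: tri_def)
  then show ?thesis by (simp add: sum.Sigma)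
qed

definition bpoly :: "nat \<Rightarrow> (R2 \<Rightarrow> real) set" where
  "bpoly n = {p. \<exists>c. \<forall>x. p x = (\<Sum>(i, j)\<in>tri n. c i j * fst x ^ i * snd x ^ j)}"

lemma bpolyI: "(\<And>x. p x = (\<Sum>(i, j)\<in>tri n. c i j * fst x ^ i * snd x ^ j)) \<Longrightarrow> p \<in> bpoly n"
  by (auto simp: bpoly_def)

lemma bpolyE:
  assumes "p \<in> bpoly n"
  obtains c where "\<And>x. p x = (\<Sum>(i, j)\<in>tri n. c i j * fst x ^ i * snd x ^ j)"
  using assms by (auto simp: bpoly_def)

lemma bpoly_monom: "i + j \<le> n \<Longrightarrow> (\<lambda>x. c * fst x ^ i * snd x ^ j) \<in> bpoly n"
proof (rule bpolyI[where c = "\<lambda>a b. if (a, b) = (i, j) then c else 0"])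
  fix x :: R2
  assume "i + j \<le> n"
  then have "(i, j) \<in> tri n" by (simp add: tri_def)
  moreover have "(\<Sum>(a, b)\<in>tri n. (if (a, b) = (i, j) then c else 0) * fst x ^ a * snd x ^ b)
    = (\<Sum>y\<in>tri n. if y = (i, j) then c * fst x ^ i * snd x ^ j else 0)"
    by (intro sum.cong) (auto split: if_splits)
  ultimately show "c * fst x ^ i * snd x ^ j = (\<Sum>(a, b)\<in>tri n. (if (a, b) = (i, j) then c else 0) * fst x ^
      a * snd x ^ b)"
    by simp
qed

lemma bpoly_const [simp]: "(\<lambda>x. c) \<in> bpoly n"
  using bpoly_monom[of 0 0 n c] by simp

lemma bpoly_fst: "1 \<le> n \<Longrightarrow> fst \<in> bpoly n"
  using bpoly_monom[of 1 0 n 1] by simp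

lemma bpoly_snd: "1 \<le> n \<Longrightarrow> snd \<in> bpoly n"
  using bpoly_monom[of 0 1 n 1] by simp

lemma bpoly_add:
  assumes "p \<in> bpoly n" "q \<in> bpoly n" shows "(\<lambda>x. p x + q x) \<in> bpoly n"
proof -
  obtain c where c: "\<And>x. p x = (\<Sum>(i, j)\<in>tri n. c i j * fst x ^ i * snd x ^ j)"
    using bpolyE[OF assms(1)] by blast
  obtain d where d: "\<And>x. q x = (\<Sum>(i, j)\<in>tri n. d i j * fst x ^ i * snd x ^ j)"
    using bpolyE[OF assms(2)] by blast
  show ?thesis
    by (rule bpolyI[where c = "\<lambda>i j. c i j + d i j"])
      (simp add: c d sum.distrib[symmetric] case_prod_beta ring_distribs)
qed

lemma bpoly_cmul:
  assumes "p \<in> bpoly n" shows "(\<lambda>x. k * p x) \<in> bpoly n"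
proof -
  obtain c where c: "\<And>x. p x = (\<Sum>(i, j)\<in>tri n. c i j * fst x ^ i * snd x ^ j)"
    using bpolyE[OF assms(1)] by blast
  show ?thesis
    by (rule bpolyI[where c = "\<lambda>i j. k * c i j"]) (simp add: c sum_distrib_left case_prod_beta mult.assoc)
qed

lemma bpoly_diff:
  assumes "p \<in> bpoly n" "q \<in> bpoly n" shows "(\<lambda>x. p x - q x) \<in> bpoly n"
  using bpoly_add[OF assms(1) bpoly_cmul[OF assms(2), of "-1"]] by simp

lemma bpoly_sum:
  assumes "\<And>i. i \<in> I \<Longrightarrow> p i \<in> bpoly n" shows "(\<lambda>x. \<Sum>i\<in>I. p i x) \<in> bpoly n"
  using assms by (induction I rule: infinite_finite_induct) (auto intro!: bpoly_add)

lemma bpoly_mono: "m \<le> n \<Longrightarrow> p \<in> bpoly m \<Longrightarrow> p \<in> bpoly n"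
proof -
  assume mn: "m \<le> n" and p: "p \<in> bpoly m"
  obtain c where c: "\<And>x. p x = (\<Sum>(i, j)\<in>tri m. c i j * fst x ^ i * snd x ^ j)"
    using bpolyE[OF p] by blast
  have "p = (\<lambda>x. \<Sum>y\<in>tri m. c (fst y) (snd y) * fst x ^ fst y * snd x ^ snd y)"
    by (auto simp: c case_prod_beta)
  also have "\<dots> \<in> bpoly n"
    by (intro bpoly_sum bpoly_monom) (use mn in \<open>auto simp: tri_def\<close>)
  finally show ?thesis .
qed

lemma bpoly_mult:
  assumes "p \<in> bpoly m" "q \<in> bpoly n" shows "(\<lambda>x. p x * q x) \<in> bpoly (m + n)"
proof -
  obtain c where c: "\<And>x. p x = (\<Sum>(i, j)\<in>tri m. c i j * fst x ^ i * snd x ^ j)"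
    using bpolyE[OF assms(1)] by blast
  obtain d where d: "\<And>x. q x = (\<Sum>(i, j)\<in>tri n. d i j * fst x ^ i * snd x ^ j)"
    using bpolyE[OF assms(2)] by blast
  have "(\<lambda>x. p x * q x) = (\<lambda>x. \<Sum>y\<in>tri m. \<Sum>z\<in>tri n.
      (c (fst y) (snd y) * d (fst z) (snd z)) * fst x ^ (fst y + fst z) * snd x ^ (snd y + snd z))"
    by (auto simp: c d case_prod_beta sum_product power_add mult_ac)
  also have "\<dots> \<in> bpoly (m + n)"
    by (intro bpoly_sum bpoly_monom) (auto simp: tri_def)
  finally show ?thesis .
qed

lemma bpoly_power:
  assumes "p \<in> bpoly m" shows "(\<lambda>x. p x ^ k) \<in> bpoly (m * k)"
  using assms by (induction k) (use bpoly_mult in \<open>auto simp: add.commute\<close>)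

lemma bpoly_compose:
  assumes p: "p \<in> bpoly n" and "f \<in> bpoly 1" "g \<in> bpoly 1"
  shows "(\<lambda>x. p (f x, g x)) \<in> bpoly n"
proof -
  obtain c where c: "\<And>x. p x = (\<Sum>(i, j)\<in>tri n. c i j * fst x ^ i * snd x ^ j)"
    using bpolyE[OF p] by blast
  have "(\<lambda>x. c i j * (f x ^ i * g x ^ j)) \<in> bpoly n" if "i + j \<le> n" for i j
    using bpoly_mono[OF _ bpoly_mult[OF bpoly_power[OF assms(2), of i] bpoly_power[OF assms(3), of j]], of
        n] that
    by (intro bpoly_cmul) auto
  then show ?thesis unfolding c case_prod_beta
    by (intro bpoly_sum) (auto simp: tri_def mult.assoc)
qed

lemma bpoly_continuous:
  assumes "p \<in> bpoly n" shows "continuous_on S p"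
proof -
  obtain c where "\<And>x. p x = (\<Sum>(i, j)\<in>tri n. c i j * fst x ^ i * snd x ^ j)"
    using bpolyE[OF assms] by blast
  then have "p = (\<lambda>x. \<Sum>y\<in>tri n. c (fst y) (snd y) * fst x ^ fst y * snd x ^ snd y)"
    by (auto simp: case_prod_beta)
  then show ?thesis by (auto intro!: continuous_intros)
qed

section \<open>Uniqueness of polynomial coefficients\<close>

lemma poly_sum_eq_0:
  fixes c :: "nat \<Rightarrow> real"
  assumes "a < b" "\<And>x. a < x \<Longrightarrow> x < b \<Longrightarrow> (\<Sum>i\<le>n. c i * x ^ i) = 0" "i \<le> n"
  shows "c i = 0"
proof (rule ccontr)
  assume "c i \<noteq> 0"
  then have "finite {x. (\<Sum>i\<le>n. c i * x ^ i) = 0}"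
    using polyfun_finite_roots[of c n] assms(3) by auto
  moreover have "{a<..<b} \<subseteq> {x. (\<Sum>i\<le>n. c i * x ^ i) = 0}" using assms(2) by auto
  ultimately show False using infinite_Ioo[OF assms(1)] finite_subset by blast
qed

text \<open>For fixed \<open>t\<close> the sum is a polynomial in \<open>s\<close> on an interval,
  so its coefficients vanish; these are polynomials in \<open>t\<close> on the unit interval. The
  open reference triangle is the region that matters because every small triangle is an affine image
  of its closure.\<close>

lemma bpoly_coeffs_eq_0:
  assumes "\<And>s t. 0 < s \<Longrightarrow> 0 < t \<Longrightarrow> s + t < 1 \<Longrightarrow> (\<Sum>(i, j)\<in>tri n. c i j * s ^ i * t ^ j) = (0::real)"
    "i + j \<le> n"
  shows "c i j = 0"
proof -
  have 1: "(\<Sum>j\<le>n - i. c i j * t ^ j) = 0" if t: "0 < t" "t < 1" for t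
  proof (rule poly_sum_eq_0[where a = 0 and b = "1 - t" and n = n and c = "\<lambda>i. \<Sum>j\<le>n-i. c i j * t ^ j"])
    fix s assume s: "0 < s" "s < 1 - t"
    have "(\<Sum>i\<le>n. (\<Sum>j\<le>n-i. c i j * t ^ j) * s ^ i) = (\<Sum>(i, j)\<in>tri n. c i j * s ^ i * t ^ j)"
      by (simp add: sum_tri sum_distrib_left mult_ac)
    then show "(\<Sum>i\<le>n. (\<Sum>j\<le>n-i. c i j * t ^ j) * s ^ i) = 0" using assms(1) s t by simp
  qed (use t assms in auto)
  show ?thesis
    by (rule poly_sum_eq_0[where a = 0 and b = 1 and n = "n - i"]) (use assms 1 in auto)
qed

text \<open>The family does not depend on a degree bound: the same polynomial regarded in
  \<open>bpoly m\<close> and in \<open>bpoly n\<close> has the same coefficients, padded by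
  zeros.\<close>

definition bcoeff :: "(R2 \<Rightarrow> real) \<Rightarrow> nat \<Rightarrow> nat \<Rightarrow> real" where
  "bcoeff p = (SOME c. \<exists>n. (\<forall>i j. n < i + j \<longrightarrow> c i j = 0) \<and>
     (\<forall>x. p x = (\<Sum>(i, j)\<in>tri n. c i j * fst x ^ i * snd x ^ j)))"

lemma sum_tri_mono:
  assumes "m \<le> n" "\<And>i j. m < i + j \<Longrightarrow> f i j = (0::real)"
  shows "(\<Sum>(i, j)\<in>tri n. f i j) = (\<Sum>(i, j)\<in>tri m. f i j)"
proof (rule sum.mono_neutral_right)
  show "\<forall>y\<in>tri n - tri m. (case y of (i, j) \<Rightarrow> f i j) = 0"
  proof clarify
    fix a b assume "(a, b) \<in> tri n" "(a, b) \<notin> tri m"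
    then show "f a b = 0" by (intro assms(2)) (simp add: tri_def)
  qed
qed (use assms(1) in \<open>simp, force simp: tri_def\<close>)

text \<open>Any expansion that is valid on the open reference triangle reveals the coefficients;
  this is the rule by which they are computed for sums, multiples and derivatives.\<close>

lemma bcoeff_unique:
  assumes c: "\<And>s t. 0 < s \<Longrightarrow> 0 < t \<Longrightarrow> s + t < 1 \<Longrightarrow> p (s, t) = (\<Sum>(i, j)\<in>tri n. c i j * s ^ i * t ^ j)"
    and p: "p \<in> bpoly m"
  shows "bcoeff p i j = (if i + j \<le> n then c i j else 0)"
proof -
  obtain d where d: "\<And>x. p x = (\<Sum>(i, j)\<in>tri m. d i j * fst x ^ i * snd x ^ j)"
    using bpolyE[OF p] by blast
  have "\<exists>c n. (\<forall>i j. n < i + j \<longrightarrow> c i j = 0) \<and> (\<forall>x. p x = (\<Sum>(i, j)\<in>tri n. c i j * fst x ^ i * snd x ^ j))"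
    by (intro exI[of _ "\<lambda>i j. if i + j \<le> m then d i j else 0"] exI[of _ m])
      (auto simp: d tri_def intro!: sum.cong)
  from someI_ex[OF this] obtain k where k: "\<forall>i j. k < i + j \<longrightarrow> bcoeff p i j = 0"
    "\<And>x. p x = (\<Sum>(i, j)\<in>tri k. bcoeff p i j * fst x ^ i * snd x ^ j)" unfolding bcoeff_def by blast
  let ?c = "\<lambda>i j. if i + j \<le> n then c i j else 0"
  \<comment> \<open>Including \<open>i + j\<close> keeps the compared coefficient inside the
    summation range even beyond both degree bounds.\<close>
  let ?N = "max (max n k) (i + j)"
  have "bcoeff p i j - ?c i j = 0"
  proof (rule bpoly_coeffs_eq_0[where n = ?N])
    fix s t :: real assume st: "0 < s" "0 < t" "s + t < 1"
    have "(\<Sum>(i, j)\<in>tri ?N. (bcoeff p i j - ?c i j) * s ^ i * t ^ j) =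
      (\<Sum>(i, j)\<in>tri ?N. bcoeff p i j * s ^ i * t ^ j) - (\<Sum>(i, j)\<in>tri ?N. ?c i j * s ^ i * t ^ j)"
      by (simp add: sum_subtractf[symmetric] case_prod_beta ring_distribs)
    also have "(\<Sum>(i, j)\<in>tri ?N. bcoeff p i j * s ^ i * t ^ j) = (\<Sum>(i, j)\<in>tri k. bcoeff p i j * s ^ i * t ^ j)"
      by (rule sum_tri_mono) (use k(1) in auto)
    also have "\<dots> = p (s, t)" using k(2) by simp
    also have "(\<Sum>(i, j)\<in>tri ?N. ?c i j * s ^ i * t ^ j) = (\<Sum>(i, j)\<in>tri n. ?c i j * s ^ i * t ^ j)"
      by (rule sum_tri_mono) auto
    also have "\<dots> = (\<Sum>(i, j)\<in>tri n. c i j * s ^ i * t ^ j)"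
      by (rule sum.cong) (auto simp: tri_def)
    finally show "(\<Sum>(i, j)\<in>tri ?N. (bcoeff p i j - ?c i j) * s ^ i * t ^ j) = 0"
      using c[OF st] by simp
  qed simp
  then show ?thesis by simp
qed

lemma bpoly_expand:
  assumes "p \<in> bpoly n"
  shows "p x = (\<Sum>(i, j)\<in>tri n. bcoeff p i j * fst x ^ i * snd x ^ j)"
proof -
  obtain c where c: "\<And>x. p x = (\<Sum>(i, j)\<in>tri n. c i j * fst x ^ i * snd x ^ j)"
    using bpolyE[OF assms] by blast
  have "bcoeff p i j = (if i + j \<le> n then c i j else 0)" for i j
    by (rule bcoeff_unique[OF _ assms]) (simp add: c)
  then show ?thesis unfolding c by (intro sum.cong) (auto simp: tri_def)
qed

lemma bcoeff_eq_0: "p \<in> bpoly n \<Longrightarrow> n < i + j \<Longrightarrow> bcoeff p i j = 0"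
  using bcoeff_unique[of p "bcoeff p" n n i j] bpoly_expand by auto

lemma bpoly_eqI:
  assumes "p \<in> bpoly m" "q \<in> bpoly n" "\<And>s t. 0 < s \<Longrightarrow> 0 < t \<Longrightarrow> s + t < 1 \<Longrightarrow> p (s, t) = q (s, t)"
  shows "p = q"
proof
  fix x
  have "p \<in> bpoly (max m n)" "q \<in> bpoly (max m n)" using assms by (auto intro: bpoly_mono[rotated])
  moreover have "bcoeff p i j = bcoeff q i j" for i j
    using bcoeff_unique[of p "bcoeff q" n m i j] bpoly_expand[OF assms(2)] assms bcoeff_eq_0[OF assms(2), of
        i j] by auto
  ultimately show "p x = q x" using bpoly_expand[of p "max m n" x] bpoly_expand[of q "max m n" x] by simp
qed

lemma bcoeff_add:
  assumes "p \<in> bpoly m" "q \<in> bpoly n"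
  shows "bcoeff (\<lambda>x. p x + q x) i j = bcoeff p i j + bcoeff q i j"
proof -
  have pq: "p \<in> bpoly (max m n)" "q \<in> bpoly (max m n)" using assms by (auto intro: bpoly_mono[rotated])
  have "bcoeff (\<lambda>x. p x + q x) i j = (if i + j \<le> max m n then bcoeff p i j + bcoeff q i j else 0)"
  proof (rule bcoeff_unique[OF _ bpoly_add[OF pq]])
    fix s t :: real
    show "p (s, t) + q (s, t) = (\<Sum>(i, j)\<in>tri (max m n). (bcoeff p i j + bcoeff q i j) * s ^ i * t ^ j)"
      using bpoly_expand[OF pq(1), of "(s, t)"] bpoly_expand[OF pq(2), of "(s, t)"]
      by (simp add: sum.distrib[symmetric] case_prod_beta ring_distribs)
  qed
  then show ?thesis using bcoeff_eq_0[OF pq(1), of i j] bcoeff_eq_0[OF pq(2), of i j]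
    by (cases "i + j \<le> max m n") (simp_all add: not_le)
qed

lemma bcoeff_cmul:
  assumes "p \<in> bpoly m"
  shows "bcoeff (\<lambda>x. k * p x) i j = k * bcoeff p i j"
  using bcoeff_unique[of "\<lambda>x. k * p x" "\<lambda>i j. k * bcoeff p i j" m m i j]
      bpoly_expand[OF assms] bcoeff_eq_0[OF assms] bpoly_cmul[OF assms, of k]
  by (auto simp: sum_distrib_left case_prod_beta mult.assoc)

lemma bcoeff_monom:
  "bcoeff (\<lambda>x. fst x ^ a * snd x ^ b) i j = (if i = a \<and> j = b then 1 else 0)"
proof -
  have "(\<lambda>x. fst x ^ a * snd x ^ b) \<in> bpoly (a + b)" using bpoly_monom[of a b "a+b" 1] by simp
  moreover have "(\<Sum>(i, j)\<in>tri (a + b). (if i = a \<and> j = b then 1 else 0) * s ^ i * t ^ j) = s ^ a * t ^ b"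
      for s t :: real
  proof -
    have "(\<Sum>(i, j)\<in>tri (a + b). (if i = a \<and> j = b then 1 else 0) * s ^ i * t ^ j) =
      (\<Sum>y\<in>tri (a + b). if y = (a, b) then s ^ a * t ^ b else 0)"
      by (intro sum.cong) (auto split: if_splits)
    also have "(a, b) \<in> tri (a + b)" by (simp add: tri_def)
    ultimately show ?thesis by simp
  qed
  ultimately show ?thesis
    using bcoeff_unique[of "\<lambda>x. fst x ^ a * snd x ^ b" "\<lambda>i j. if i = a \<and> j = b then 1 else 0" "a + b" "a +
        b" i j]
    by auto
qed

section \<open>Directional derivatives and restriction to lines\<close>

definition dirD :: "R2 \<Rightarrow> (R2 \<Rightarrow> real) \<Rightarrow> R2 \<Rightarrow> real" where
  "dirD w p x = frechet_derivative p (at x) w"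

lemma bpoly_has_derivative_coeffs:
  assumes "p \<in> bpoly n"
  shows "(p has_derivative (\<lambda>h. \<Sum>(i, j)\<in>tri n. bcoeff p i j *
     (real i * fst x ^ (i - 1) * fst h * snd x ^ j + fst x ^ i * (real j * snd x ^ (j - 1) * snd h)))) (at x)"
proof -
  have "((\<lambda>x. \<Sum>y\<in>tri n. bcoeff p (fst y) (snd y) * (fst x ^ fst y * snd x ^ snd y)) has_derivative (\<lambda>h.
      \<Sum>y\<in>tri n. bcoeff p (fst y) (snd y) *
     (real (fst y) * fst x ^ (fst y - 1) * fst h * snd x ^ snd y + fst x ^ fst y * (real (snd y) * snd x ^
         (snd y - 1) * snd h)))) (at x)"
    by (intro has_derivative_sum has_derivative_mult_right)
      (auto intro!: derivative_eq_intros simp: algebra_simps)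
  moreover have "p = (\<lambda>x. \<Sum>y\<in>tri n. bcoeff p (fst y) (snd y) * (fst x ^ fst y * snd x ^ snd y))"
    using bpoly_expand[OF assms] by (auto simp: case_prod_beta mult.assoc)
  ultimately show ?thesis by (simp add: case_prod_beta)
qed

lemma bpoly_differentiable: "p \<in> bpoly n \<Longrightarrow> p differentiable (at x)"
  unfolding differentiable_def by (rule exI, erule bpoly_has_derivative_coeffs)

lemma bpoly_has_derivative: "p \<in> bpoly n \<Longrightarrow> (p has_derivative (\<lambda>w. dirD w p x)) (at x)"
  using bpoly_differentiable[of p n x] unfolding frechet_derivative_works dirD_def by simp

lemma dirD_coeffs:
  assumes "p \<in> bpoly n"
  shows "dirD w p x = (\<Sum>(i, j)\<in>tri n. bcoeff p i j *
     (real i * fst x ^ (i - 1) * fst w * snd x ^ j + fst x ^ i * (real j * snd x ^ (j - 1) * snd w)))"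
  unfolding dirD_def
  by (rule fun_cong[OF frechet_derivative_at[OF bpoly_has_derivative_coeffs[OF assms]], symmetric])

lemma dirD_eqI: "(p has_derivative D) (at x) \<Longrightarrow> dirD w p x = D w"
  unfolding dirD_def by (rule fun_cong[OF frechet_derivative_at, symmetric])

lemma dirD_bpoly:
  assumes "p \<in> bpoly n"
  shows "dirD w p \<in> bpoly (n - 1)"
proof -
  have "dirD w p = (\<lambda>x. \<Sum>y\<in>tri n. (bcoeff p (fst y) (snd y) * real (fst y) * fst w) * fst x ^ (fst y - 1) *
      snd x ^ snd y
      + (bcoeff p (fst y) (snd y) * real (snd y) * snd w) * fst x ^ fst y * snd x ^ (snd y - 1))"
    unfolding dirD_coeffs[OF assms] case_prod_beta by (intro ext sum.cong refl) (simp add: algebra_simps)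
  also have "\<dots> \<in> bpoly (n - 1)"
  proof (intro bpoly_sum bpoly_add)
    fix y assume y: "y \<in> tri n"
    show "(\<lambda>x. (bcoeff p (fst y) (snd y) * real (fst y) * fst w) * fst x ^ (fst y - 1) * snd x ^ snd y) \<in>
        bpoly (n - 1)"
    proof (cases "fst y = 0")
      case False
      then show ?thesis using y by (intro bpoly_monom) (auto simp: tri_def)
    qed simp
    show "(\<lambda>x. (bcoeff p (fst y) (snd y) * real (snd y) * snd w) * fst x ^ fst y * snd x ^ (snd y - 1)) \<in>
        bpoly (n - 1)"
    proof (cases "snd y = 0")
      case False
      then show ?thesis using y by (intro bpoly_monom) (auto simp: tri_def)
    qed simp
  qed
  finally show ?thesis .
qed

lemma dirD_linear:
  assumes "p \<in> bpoly n"
  shows "dirD (a *\<^sub>R v + b *\<^sub>R w) p x = a * dirD v p x + b * dirD w p x"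
proof -
  have "linear (\<lambda>w. dirD w p x)"
    by (rule bounded_linear.linear[OF has_derivative_bounded_linear[OF bpoly_has_derivative[OF assms]]])
  from linear_add[OF this] linear_scale[OF this] show ?thesis by simp
qed

lemma dirD_components:
  assumes "p \<in> bpoly n"
  shows "dirD w p x = fst w * dirD (1, 0) p x + snd w * dirD (0, 1) p x"
  using dirD_linear[OF assms, of "fst w" "(1, 0)" "snd w" "(0, 1)" x] by simp

lemma dirD_add:
  assumes "p \<in> bpoly m" "q \<in> bpoly n"
  shows "dirD w (\<lambda>x. p x + q x) x = dirD w p x + dirD w q x"
  by (rule dirD_eqI[OF has_derivative_add[OF bpoly_has_derivative[OF assms(1)] bpoly_has_derivative[OF
      assms(2)]]])

lemma dirD_diff:
  assumes "p \<in> bpoly m" "q \<in> bpoly n"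
  shows "dirD w (\<lambda>x. p x - q x) x = dirD w p x - dirD w q x"
  by (rule dirD_eqI[OF has_derivative_diff[OF bpoly_has_derivative[OF assms(1)] bpoly_has_derivative[OF
      assms(2)]]])

lemma dirD_cmul:
  assumes "p \<in> bpoly m"
  shows "dirD w (\<lambda>x. k * p x) x = k * dirD w p x"
  by (rule dirD_eqI[OF has_derivative_mult_right[OF bpoly_has_derivative[OF assms(1)]]])

text \<open>Substituting the line into each monomial does not raise the degree. The univariate form
  makes \<open>pderiv\<close> and integration by parts available on edges and spokes.\<close>

lemma bpoly_along_line:
  assumes "p \<in> bpoly n"
  shows "\<exists>G. degree G \<le> n \<and> (\<forall>t. p (a + t *\<^sub>R w) = poly G t)"
proof -
  let ?m = "\<lambda>i j. [:fst a, fst w:] ^ i * [:snd a, snd w:] ^ j"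
  let ?G = "\<Sum>y\<in>tri n. smult (bcoeff p (fst y) (snd y)) (?m (fst y) (snd y))"
  have deg: "degree (?m i j) \<le> n" if "i + j \<le> n" for i j
  proof -
    have "degree ([:fst a, fst w:] ^ i) \<le> 1 * i"
      by (rule order_trans[OF degree_power_le]) (intro mult_right_mono, auto)
    moreover have "degree ([:snd a, snd w:] ^ j) \<le> 1 * j"
      by (rule order_trans[OF degree_power_le]) (intro mult_right_mono, auto)
    ultimately show ?thesis
      using that degree_mult_le[of "[:fst a, fst w:] ^ i" "[:snd a, snd w:] ^ j"] by linarith
  qed
  have "degree ?G \<le> n"
  proof (rule degree_sum_le)
    fix y assume "y \<in> tri n"
    then show "degree (smult (bcoeff p (fst y) (snd y)) (?m (fst y) (snd y))) \<le> n"
      by (intro order.trans[OF degree_smult_le deg]) (auto simp: tri_def)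
  qed simp
  moreover have "p (a + t *\<^sub>R w) = poly ?G t" for t
  proof -
    have "p (a + t *\<^sub>R w) = (\<Sum>y\<in>tri n. bcoeff p (fst y) (snd y) * fst (a + t *\<^sub>R w) ^ fst y * snd (a + t *\<^sub>R w)
        ^ snd y)"
      using bpoly_expand[OF assms] by (simp add: case_prod_beta)
    also have "\<dots> = poly ?G t"
      unfolding poly_sum by (intro sum.cong refl) simp
    finally show ?thesis .
  qed
  ultimately show ?thesis by blast
qed

lemma has_derivative_along_line:
  assumes "p \<in> bpoly n"
  shows "((\<lambda>t. p (a + t *\<^sub>R w)) has_real_derivative dirD w p (a + t *\<^sub>R w)) (at t)"
proof -
  have "((\<lambda>t. p (a + t *\<^sub>R w)) has_derivative (\<lambda>h. dirD (h *\<^sub>R w) p (a + t *\<^sub>R w))) (at t)"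
    by (rule has_derivative_compose[of "\<lambda>t. a + t *\<^sub>R w" "\<lambda>h. h *\<^sub>R w" _ UNIV, simplified])
      (auto intro!: derivative_eq_intros bpoly_has_derivative[OF assms])
  moreover have "dirD (h *\<^sub>R w) p x = h * dirD w p x" for h x
    using dirD_linear[OF assms, of h w 0 0] by simp
  ultimately show ?thesis by (simp add: has_field_derivative_def mult_commute_abs)
qed

lemma dirD_along_line:
  assumes "p \<in> bpoly n" "\<And>t. p (a + t *\<^sub>R w) = poly G t"
  shows "dirD w p (a + t *\<^sub>R w) = poly (pderiv G) t"
  using has_derivative_along_line[OF assms(1), of a w t] poly_DERIV[of G t] unfolding assms(2)
  by (rule DERIV_unique)

section \<open>Geometry of the split\<close>

definition cross :: "R2 \<Rightarrow> R2 \<Rightarrow> real" where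
  "cross a b = fst a * snd b - snd a * fst b"

lemma cross_simps [simp]:
  "cross (a + b) c = cross a c + cross b c" "cross a (b + c) = cross a b + cross a c"
  "cross (k *\<^sub>R a) b = k * cross a b" "cross a (k *\<^sub>R b) = k * cross a b"
  "cross (a - b) c = cross a c - cross b c" "cross a (b - c) = cross a b - cross a c"
  "cross (- a) b = - cross a b" "cross a (- b) = - cross a b"
  "cross a a = 0" "cross 0 a = 0" "cross a 0 = 0"
  by (simp_all add: cross_def algebra_simps)

lemma cross_commute: "cross a b = - cross b a"
  by (simp add: cross_def)

definition aff :: "R2 \<Rightarrow> R2 \<Rightarrow> R2 \<Rightarrow> R2 \<Rightarrow> R2" where
  "aff a v w y = a + fst y *\<^sub>R v + snd y *\<^sub>R w"

text \<open>Cramer's rule for the inverse of \<open>aff\<close>, meaningful when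
  \<open>cross v w\<close> is nonzero.\<close>

definition acoord :: "R2 \<Rightarrow> R2 \<Rightarrow> R2 \<Rightarrow> R2 \<Rightarrow> R2" where
  "acoord a v w x = (cross (x - a) w / cross v w, cross v (x - a) / cross v w)"

lemma acoord_aff [simp]: "cross v w \<noteq> 0 \<Longrightarrow> acoord a v w (aff a v w y) = y"
  by (cases y) (simp add: acoord_def aff_def)

lemma aff_acoord [simp]:
  assumes "cross v w \<noteq> 0" shows "aff a v w (acoord a v w x) = x"
proof -
  have "fst v * cross (x - a) w + fst w * cross v (x - a) = cross v w * (fst x - fst a)"
       "snd v * cross (x - a) w + snd w * cross v (x - a) = cross v w * (snd x - snd a)"
    by (simp_all add: cross_def algebra_simps)
  then have "(fst v * cross (x - a) w + fst w * cross v (x - a)) / cross v w = fst x - fst a"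
       "(snd v * cross (x - a) w + snd w * cross v (x - a)) / cross v w = snd x - snd a"
    using assms by (simp_all del: cross_simps)
  then show ?thesis
    by (simp add: aff_def acoord_def prod_eq_iff add_divide_distrib mult.commute del: cross_simps)
qed

lemma bpoly_affine: "(\<lambda>x. a + b * fst x + c * snd x) \<in> bpoly 1"
  by (intro bpoly_add bpoly_cmul bpoly_const bpoly_fst bpoly_snd) auto

lemma bpoly_fst_acoord: "(\<lambda>x. fst (acoord a v w x)) \<in> bpoly 1"
proof -
  have "(\<lambda>x. fst (acoord a v w x)) = (\<lambda>x. (snd a * fst w - fst a * snd w) / cross v w + (snd w / cross v w)
      * fst x + (- fst w / cross v w) * snd x)"
    by (rule ext) (simp add: acoord_def cross_def[of "_ - _"] add_divide_distrib[symmetric]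
        diff_divide_distrib[symmetric] del: cross_simps, simp add: algebra_simps)
  also have "\<dots> \<in> bpoly 1" by (rule bpoly_affine)
  finally show ?thesis .
qed

lemma bpoly_snd_acoord: "(\<lambda>x. snd (acoord a v w x)) \<in> bpoly 1"
proof -
  have "(\<lambda>x. snd (acoord a v w x)) = (\<lambda>x. (snd v * fst a - fst v * snd a) / cross v w + (- snd v / cross v
      w) * fst x + (fst v / cross v w) * snd x)"
    by (rule ext) (simp add: acoord_def cross_def[of _ "_ - _"] add_divide_distrib[symmetric]
        diff_divide_distrib[symmetric] del: cross_simps, simp add: algebra_simps)
  also have "\<dots> \<in> bpoly 1" by (rule bpoly_affine)
  finally show ?thesis .
qed

lemma bpoly_comp_aff:
  assumes "p \<in> bpoly n" shows "(\<lambda>y. p (aff a v w y)) \<in> bpoly n"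
  using bpoly_compose[OF assms bpoly_affine[of "fst a" "fst v" "fst w"] bpoly_affine[of "snd a" "snd v" "snd
      w"]]
  by (simp add: aff_def plus_prod_def scaleR_prod_def mult.commute)

lemma dirD_comp_aff:
  assumes "p \<in> bpoly n"
  shows "dirD h (\<lambda>y. p (aff a v w y)) y = dirD (fst h *\<^sub>R v + snd h *\<^sub>R w) p (aff a v w y)"
proof (rule dirD_eqI)
  show "((\<lambda>y. p (aff a v w y)) has_derivative (\<lambda>h. dirD (fst h *\<^sub>R v + snd h *\<^sub>R w) p (aff a v w y))) (at y)"
    by (rule has_derivative_compose[of "aff a v w" _ y UNIV p, OF _ bpoly_has_derivative[OF assms], simplified])
      (auto intro!: derivative_eq_intros simp: aff_def[abs_def])
qed

text \<open>The hexagon of boundary points in counter-clockwise order: corners at even, edge points at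
  odd positions.\<close>

definition hex :: "(nat \<Rightarrow> R2) \<Rightarrow> nat \<Rightarrow> R2" where
  "hex z j = z ([1, 6, 2, 4, 3, 5] ! (j mod 6))"

definition tri_ps :: "(nat \<Rightarrow> R2) \<Rightarrow> nat \<Rightarrow> R2 set" where
  "tri_ps z j = convex hull {z 0, hex z j, hex z (Suc j)}"

lemma less_6_cases: "j < 6 \<Longrightarrow> j = 0 \<or> j = 1 \<or> j = 2 \<or> j = 3 \<or> j = 4 \<or> j = (5::nat)"
  by auto

lemma lessThan_6: "{..<6::nat} = {0, 1, 2, 3, 4, 5}"
  by auto

lemma hex_simps: "hex z 0 = z 1" "hex z 1 = z 6" "hex z (Suc 0) = z 6" "hex z 2 = z 2" "hex z 3 = z 4"
    "hex z 4 = z 3" "hex z 5 = z 5" "hex z 6 = z 1" "hex z (Suc (Suc 0)) = z 2"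
  by (simp_all add: hex_def)

lemma hex_mod: "hex z (j mod 6) = hex z j" "hex z (Suc (j mod 6)) = hex z (Suc j)"
  by (simp_all add: hex_def mod_Suc_eq)

lemma bdry_edges_hex: "bdry_edges z = (\<lambda>j. (hex z j, hex z (Suc j))) ` {..<6}"
proof -
  have "nxt 1 = 2" "nxt 2 = 3" "nxt 3 = 1" by (simp_all add: nxt_def)
  then have "bdry_edges z = {(z 2, z 4), (z 4, z 3), (z 3, z 5), (z 5, z 1), (z 1, z 6), (z 6, z 2)}"
    by (simp add: bdry_edges_def) blast
  also have "\<dots> = (\<lambda>j. (hex z j, hex z (Suc j))) ` {..<6}"
    unfolding lessThan_6 image_insert image_empty by (simp add: hex_simps) blast
  finally show ?thesis .
qed

lemma ps_split_hex: "ps_split z = tri_ps z ` {..<6}"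
  by (simp add: ps_split_def bdry_edges_hex image_image tri_ps_def)

section \<open>Orientation of the spokes\<close>

locale ps_config =
  fixes z :: "nat \<Rightarrow> R2"
  assumes ps: "powell_sabin z"
begin

definition u :: "nat \<Rightarrow> R2" where "u j = hex z j - z 0"

lemma u_mod: "u (j mod 6) = u j" "u (Suc (j mod 6)) = u (Suc j)"
  by (simp_all add: u_def hex_mod)

lemma u_6: "u 6 = u 0" by (simp add: u_def hex_def)

lemma not_collinear: "\<not> collinear {z 1, z 2, z 3}"
proof
  assume "collinear {z 1, z 2, z 3}"
  then have "collinear {z 2, z 1, z 3}" by (simp add: insert_commute)
  then have "z 2 - z 1 = 0 \<or> z 3 - z 1 = 0 \<or> (\<exists>k. z 3 - z 1 = k *\<^sub>R (z 2 - z 1))"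
    by (subst (asm) collinear_3) (simp_all only: collinear_lemma NO_MATCH_def)
  then show False using ps
    by (auto simp: powell_sabin_def prod_eq_iff)
qed

lemma edge_points:
  "z 6 \<in> open_segment (z 1) (z 2)" "z 4 \<in> open_segment (z 2) (z 3)" "z 5 \<in> open_segment (z 3) (z 1)"
proof -
  have n: "nxt 1 = 2" "nxt 2 = 3" "nxt 3 = 1" by (simp_all add: nxt_def)
  have "\<forall>i\<in>{1,2,3}. z (3 + i) \<in> open_segment (z (nxt i)) (z (nxt (nxt i)))"
    using ps unfolding powell_sabin_def by blast
  from this[THEN bspec, of 1] this[THEN bspec, of 2] this[THEN bspec, of 3]
  show "z 6 \<in> open_segment (z 1) (z 2)" "z 4 \<in> open_segment (z 2) (z 3)" "z 5 \<in> open_segment (z 3) (z 1)"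
    unfolding n by simp_all
qed

lemma center_bary:
  obtains l1 l2 l3 where "0 < l1" "0 < l2" "0 < l3" "l1 + l2 + l3 = 1"
    "z 0 = l1 *\<^sub>R z 1 + l2 *\<^sub>R z 2 + l3 *\<^sub>R z 3"
proof -
  have "z 0 \<in> interior (convex hull {z 1, z 2, z 3})"
    using ps by (simp add: powell_sabin_def triangle_def)
  then show ?thesis
    using interior_convex_hull_3_minimal[OF not_collinear] that by auto
qed

lemma mids:
  obtains t1 t3 t5 where "0 < t1" "t1 < 1" "0 < t3" "t3 < 1" "0 < t5" "t5 < 1"
    "u 1 = (1 - t1) *\<^sub>R u 0 + t1 *\<^sub>R u 2"
    "u 3 = (1 - t3) *\<^sub>R u 2 + t3 *\<^sub>R u 4"
    "u 5 = (1 - t5) *\<^sub>R u 4 + t5 *\<^sub>R u 0"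
proof -
  from edge_points obtain t1 t3 t5 where "0 < t1" "t1 < 1" "0 < t3" "t3 < 1" "0 < t5" "t5 < 1"
    "z 6 = (1 - t1) *\<^sub>R z 1 + t1 *\<^sub>R z 2"
    "z 4 = (1 - t3) *\<^sub>R z 2 + t3 *\<^sub>R z 3"
    "z 5 = (1 - t5) *\<^sub>R z 3 + t5 *\<^sub>R z 1"
    by (auto simp: in_segment)
  then show ?thesis by (intro that[of t1 t3 t5]) (auto simp: u_def hex_simps algebra_simps)
qed

lemma u_center:
  obtains l1 l2 l3 where "0 < l1" "0 < l2" "0 < l3" "l1 + l2 + l3 = 1"
    "l1 *\<^sub>R u 0 + l2 *\<^sub>R u 2 + l3 *\<^sub>R u 4 = 0"
proof -
  obtain l1 l2 l3 where l: "0 < l1" "0 < l2" "0 < l3" "l1 + l2 + l3 = 1"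
    "z 0 = l1 *\<^sub>R z 1 + l2 *\<^sub>R z 2 + l3 *\<^sub>R z 3" using center_bary by blast
  have "l1 *\<^sub>R u 0 + l2 *\<^sub>R u 2 + l3 *\<^sub>R u 4 = (l1 *\<^sub>R z 1 + l2 *\<^sub>R z 2 + l3 *\<^sub>R z 3) - (l1 + l2 + l3) *\<^sub>R z 0"
    by (simp add: u_def hex_simps algebra_simps)
  then show ?thesis using l that by simp
qed

text \<open>Crossing the barycentric relation of the centre with \<open>u 0\<close> and
  \<open>u 2\<close> makes the three products proportional to its barycentric coordinates, and their
  sum is the positive cross product of two sides of the triangle. Strictness comes from the interior
  position of the centre.\<close>

lemma cross_macro: "0 < cross (u 0) (u 2)" "0 < cross (u 2) (u 4)" "0 < cross (u 4) (u 0)"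
proof -
  obtain l1 l2 l3 where l: "0 < l1" "0 < l2" "0 < l3" "l1 + l2 + l3 = 1"
    "l1 *\<^sub>R u 0 + l2 *\<^sub>R u 2 + l3 *\<^sub>R u 4 = 0" using u_center by blast
  have "cross (u 2 - u 0) (u 4 - u 0) > 0"
    using ps by (simp add: powell_sabin_def u_def hex_simps cross_def algebra_simps)
  then have D: "cross (u 0) (u 2) + cross (u 2) (u 4) + cross (u 4) (u 0) > 0"
    by (simp add: cross_commute[of "u 2" "u 0"] cross_commute[of "u 0" "u 4"])
  have "cross (l1 *\<^sub>R u 0 + l2 *\<^sub>R u 2 + l3 *\<^sub>R u 4) (u 0) = 0"
    "cross (l1 *\<^sub>R u 0 + l2 *\<^sub>R u 2 + l3 *\<^sub>R u 4) (u 2) = 0"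
    using l(5) by simp_all
  then have e: "l2 * cross (u 0) (u 2) = l3 * cross (u 4) (u 0)" "l1 * cross (u 0) (u 2) = l3 * cross (u 2)
      (u 4)"
    by (simp_all add: cross_commute[of "u 2" "u 0"] cross_commute[of "u 4" "u 2"])
  have "l3 * (cross (u 0) (u 2) + cross (u 2) (u 4) + cross (u 4) (u 0)) = (l1 + l2 + l3) * cross (u 0) (u 2)"
    using e by (simp add: algebra_simps)
  then have c: "cross (u 0) (u 2) = l3 * (cross (u 0) (u 2) + cross (u 2) (u 4) + cross (u 4) (u 0))"
    using l(4) by simp
  then show 1: "0 < cross (u 0) (u 2)" using mult_pos_pos[OF l(3) D] by simp
  show "0 < cross (u 2) (u 4)" "0 < cross (u 4) (u 0)"
    using e mult_pos_pos[OF l(1) 1] mult_pos_pos[OF l(2) 1] l(3)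
    by (simp_all add: zero_less_mult_iff)
qed

lemma cross_micro: "0 < cross (u 0) (u 1)" "0 < cross (u 1) (u 2)" "0 < cross (u 2) (u 3)"
  "0 < cross (u 3) (u 4)" "0 < cross (u 4) (u 5)" "0 < cross (u 5) (u 0)"
proof -
  obtain t1 t3 t5 where t: "0 < t1" "t1 < 1" "0 < t3" "t3 < 1" "0 < t5" "t5 < 1"
    "u 1 = (1 - t1) *\<^sub>R u 0 + t1 *\<^sub>R u 2"
    "u 3 = (1 - t3) *\<^sub>R u 2 + t3 *\<^sub>R u 4"
    "u 5 = (1 - t5) *\<^sub>R u 4 + t5 *\<^sub>R u 0" using mids by blast
  show "0 < cross (u 0) (u 1)" "0 < cross (u 1) (u 2)" "0 < cross (u 2) (u 3)"
  "0 < cross (u 3) (u 4)" "0 < cross (u 4) (u 5)" "0 < cross (u 5) (u 0)"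
    using cross_macro t by simp_all
qed

lemma cross_u_Suc: "0 < cross (u j) (u (Suc j))"
proof -
  have "0 < cross (u (j mod 6)) (u (Suc (j mod 6)))"
  proof -
    have "j mod 6 < 6" by simp
    from less_6_cases[OF this] show ?thesis
      by (elim disjE) (use cross_micro u_6 in \<open>simp_all add: numeral_2_eq_2[symmetric]\<close>)
  qed
  then show ?thesis by (simp add: u_mod)
qed

lemma hex_in_triangle: "hex z j \<in> triangle z"
proof -
  have "z 6 \<in> closed_segment (z 1) (z 2)" "z 4 \<in> closed_segment (z 2) (z 3)" "z 5 \<in> closed_segment (z 3) (z 1)"
    using edge_points by (auto simp: open_segment_def)
  then have "z 6 \<in> triangle z" "z 4 \<in> triangle z" "z 5 \<in> triangle z" "z 1 \<in> triangle z" "z 2 \<in> triangle z"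
      "z 3 \<in> triangle z"
    unfolding triangle_def segment_convex_hull
    using hull_mono[of "{z 1, z 2}" "{z 1, z 2, z 3}" convex] hull_mono[of "{z 2, z 3}" "{z 1, z 2, z 3}"
        convex]
      hull_mono[of "{z 3, z 1}" "{z 1, z 2, z 3}" convex] hull_subset[of "{z 1, z 2, z 3}" convex] by auto
  then have "hex z (j mod 6) \<in> triangle z"
    using less_6_cases[of "j mod 6"] by (auto simp: hex_simps)
  then show ?thesis by (simp add: hex_mod)
qed

lemma convex_triangle: "convex (triangle z)"
  by (simp add: triangle_def)

lemma compact_triangle: "compact (triangle z)"
  by (simp add: triangle_def finite_imp_compact_convex_hull)

lemma closed_triangle: "closed (triangle z)"
  using compact_triangle compact_imp_closed by blast

lemma center_in_triangle: "z 0 \<in> triangle z"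
  using ps interior_subset by (auto simp: powell_sabin_def)

lemma tri_ps_subset: "tri_ps z j \<subseteq> triangle z"
  unfolding tri_ps_def
  by (rule hull_minimal) (auto simp: hex_in_triangle center_in_triangle convex_triangle)

lemma convex_tri_ps: "convex (tri_ps z j)" by (simp add: tri_ps_def)

lemma compact_tri_ps: "compact (tri_ps z j)"
  by (simp add: tri_ps_def finite_imp_compact_convex_hull)

lemma closed_tri_ps: "closed (tri_ps z j)"
  using compact_tri_ps compact_imp_closed by blast

text \<open>The origin is the centre and the axes are the two spokes of the small triangle, so the
  trace of a polynomial on a spoke is read off from its coefficients on one coordinate axis.\<close>

definition E :: "nat \<Rightarrow> R2 \<Rightarrow> R2" where "E j = aff (z 0) (u j) (u (Suc j))"

lemma E_eq: "E j y = z 0 + fst y *\<^sub>R u j + snd y *\<^sub>R u (Suc j)"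
  by (simp add: E_def aff_def)

lemma tri_ps_eq: "tri_ps z j = {E j (s, t) | s t. 0 \<le> s \<and> 0 \<le> t \<and> s + t \<le> 1}"
proof -
  have eq: "a *\<^sub>R z 0 + b *\<^sub>R hex z j + c *\<^sub>R hex z (Suc j) = E j (b, c)" if "a + b + c = 1" for a b c
  proof -
    have a: "a = 1 - b - c" using that by simp
    show ?thesis unfolding a by (simp add: E_eq u_def algebra_simps)
  qed
  show ?thesis unfolding tri_ps_def convex_hull_3
  proof (intro set_eqI iffI)
    fix x assume "x \<in> {a *\<^sub>R z 0 + b *\<^sub>R hex z j + c *\<^sub>R hex z (Suc j) |a b c. 0 \<le> a \<and> 0 \<le> b \<and> 0 \<le> c \<and> a + b +
        c = 1}"
    then show "x \<in> {E j (s, t) |s t. 0 \<le> s \<and> 0 \<le> t \<and> s + t \<le> 1}" using eq by force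
  next
    fix x assume "x \<in> {E j (s, t) |s t. 0 \<le> s \<and> 0 \<le> t \<and> s + t \<le> 1}"
    then obtain s t where "x = E j (s, t)" "0 \<le> s" "0 \<le> t" "s + t \<le> 1" by blast
    then have "x = (1 - s - t) *\<^sub>R z 0 + s *\<^sub>R hex z j + t *\<^sub>R hex z (Suc j) \<and> 0 \<le> 1 - s - t \<and> 0 \<le> s \<and> 0 \<le> t \<and>
        (1 - s - t) + s + t = 1"
      using eq[of "1 - s - t" s t] by simp
    then show "x \<in> {a *\<^sub>R z 0 + b *\<^sub>R hex z j + c *\<^sub>R hex z (Suc j) |a b c. 0 \<le> a \<and> 0 \<le> b \<and> 0 \<le> c \<and> a + b + c = 1}"
      by blast
  qed
qed

lemma E_in_tri_ps: "0 \<le> s \<Longrightarrow> 0 \<le> t \<Longrightarrow> s + t \<le> 1 \<Longrightarrow> E j (s, t) \<in> tri_ps z j"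
  unfolding tri_ps_eq by blast

lemma tri_ps_mod: "tri_ps z (j mod 6) = tri_ps z j"
  by (simp add: tri_ps_def hex_mod)

lemma spoke_in_tri_ps:
  assumes "0 \<le> t" "t \<le> 1"
  shows "z 0 + t *\<^sub>R u j \<in> tri_ps z j" "z 0 + t *\<^sub>R u (Suc j) \<in> tri_ps z j"
  using E_in_tri_ps[of t 0 j] E_in_tri_ps[of 0 t j] assms by (simp_all add: E_eq)

lemma center_in_tri_ps: "z 0 \<in> tri_ps z j"
  using spoke_in_tri_ps[of 0] by simp

text \<open>The identity theorem, transported by the coordinates \<open>E j\<close>; it makes the
  polynomial piece on a small triangle unique.\<close>

lemma bpoly_eq_on_tri_ps:
  assumes "p \<in> bpoly m" "q \<in> bpoly n" "\<And>x. x \<in> tri_ps z j \<Longrightarrow> p x = q x"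
  shows "p = q"
proof -
  have J: "cross (u j) (u (Suc j)) \<noteq> 0" using cross_u_Suc[of j] by simp
  have "(\<lambda>y. p (E j y)) = (\<lambda>y. q (E j y))"
    unfolding E_def
    by (rule bpoly_eqI[OF bpoly_comp_aff[OF assms(1)] bpoly_comp_aff[OF assms(2)]])
      (use E_in_tri_ps in \<open>simp add: assms(3) E_def\<close>)
  then have "p (E j (acoord (z 0) (u j) (u (Suc j)) x)) = q (E j (acoord (z 0) (u j) (u (Suc j)) x))" for x
    by metis
  then show ?thesis using J by (auto simp: E_def)
qed

section \<open>Covering the triangle by the six small triangles\<close>

lemma hull_split:
  fixes a b c :: R2
  assumes "0 < t" "t < 1" "m = (1 - t) *\<^sub>R b + t *\<^sub>R c"
  shows "convex hull {a, b, c} \<subseteq> convex hull {a, b, m} \<union> convex hull {a, m, c}"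
proof
  fix x assume "x \<in> convex hull {a, b, c}"
  then obtain p q r where x: "x = p *\<^sub>R a + q *\<^sub>R b + r *\<^sub>R c" "0 \<le> p" "0 \<le> q" "0 \<le> r" "p + q + r = 1"
    by (auto simp: convex_hull_3)
  have mult_div: "r / t = r * (1 - t) / t + r" "q / (1 - t) = q + q * t / (1 - t)"
    using assms(1,2) by (simp_all add: field_simps)
  \<comment> \<open>The cases tell on which side of the line through \<open>a\<close> and
    \<open>m\<close> the point lies. On the side of \<open>b\<close> the whole weight
    \<open>r\<close> of \<open>c\<close> is moved into \<open>m\<close>, on the other side the whole
    weight \<open>q\<close> of \<open>b\<close>.\<close>
  show "x \<in> convex hull {a, b, m} \<union> convex hull {a, m, c}"
  proof (cases "r * (1 - t) \<le> q * t")
    case True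
    have "(r / t) *\<^sub>R m = (r * (1 - t) / t) *\<^sub>R b + r *\<^sub>R c"
      using assms(1) by (simp add: assms(3) scaleR_add_right)
    then have "x = p *\<^sub>R a + (q - r * (1 - t) / t) *\<^sub>R b + (r / t) *\<^sub>R m"
      by (simp add: x(1) scaleR_diff_left)
    moreover have "0 \<le> q - r * (1 - t) / t" using True assms(1) by (simp add: pos_divide_le_eq)
    moreover have "0 \<le> r / t" using assms(1) x(4) by simp
    moreover have "p + (q - r * (1 - t) / t) + r / t = 1" using mult_div(1) x(5) by linarith
    ultimately show ?thesis using x(2) unfolding convex_hull_3 by blast
  next
    case False
    have "(q / (1 - t)) *\<^sub>R m = q *\<^sub>R b + (q * t / (1 - t)) *\<^sub>R c"
      using assms(2) by (simp add: assms(3) scaleR_add_right)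
    then have "x = p *\<^sub>R a + (q / (1 - t)) *\<^sub>R m + (r - q * t / (1 - t)) *\<^sub>R c"
      by (simp add: x(1) scaleR_diff_left)
    moreover have "0 \<le> r - q * t / (1 - t)" using False assms(2) by (simp add: pos_divide_le_eq)
    moreover have "0 \<le> q / (1 - t)" using assms(2) x(3) by simp
    moreover have "p + q / (1 - t) + (r - q * t / (1 - t)) = 1" using mult_div(2) x(5) by linarith
    ultimately show ?thesis using x(2) unfolding convex_hull_3 by blast
  qed
qed

lemma hull_split_open_segment:
  fixes a b c :: R2
  assumes "m \<in> open_segment b c"
  shows "convex hull {a, b, c} \<subseteq> convex hull {a, b, m} \<union> convex hull {a, m, c}"
  using assms hull_split[of _ m b c a] unfolding in_segment by blast

text \<open>The ratio \<open>x1 / l1\<close> is the smallest of the three, so trading that multiple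
  of \<open>o'\<close> for the vertex \<open>a\<close> leaves nonnegative weights on
  \<open>b\<close> and \<open>c\<close>.\<close>

lemma hull_recenter:
  fixes a b c o' :: R2
  assumes l: "0 < l1" "0 < l2" "0 < l3" "l1 + l2 + l3 = 1" "o' = l1 *\<^sub>R a + l2 *\<^sub>R b + l3 *\<^sub>R c"
    and x: "x = x1 *\<^sub>R a + x2 *\<^sub>R b + x3 *\<^sub>R c" "0 \<le> x1" "x1 + x2 + x3 = 1"
    and min: "x1 * l2 \<le> x2 * l1" "x1 * l3 \<le> x3 * l1"
  shows "x \<in> convex hull {o', b, c}"
proof -
  have "(x1 / l1) *\<^sub>R o' = x1 *\<^sub>R a + (x1 * l2 / l1) *\<^sub>R b + (x1 * l3 / l1) *\<^sub>R c"
    using l(1) by (simp add: l(5) scaleR_add_right)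
  then have "x = (x1 / l1) *\<^sub>R o' + (x2 - x1 * l2 / l1) *\<^sub>R b + (x3 - x1 * l3 / l1) *\<^sub>R c"
    by (simp add: x(1) scaleR_diff_left)
  moreover have "0 \<le> x1 / l1" "0 \<le> x2 - x1 * l2 / l1" "0 \<le> x3 - x1 * l3 / l1"
    using l x min by (simp_all add: field_simps)
  moreover have "x1 / l1 + (x2 - x1 * l2 / l1) + (x3 - x1 * l3 / l1) = 1"
  proof -
    have "x1 / l1 + (x2 - x1 * l2 / l1) + (x3 - x1 * l3 / l1) = x1 * (1 - l2 - l3) / l1 + x2 + x3"
      using l(1) by (simp add: field_simps)
    also have "1 - l2 - l3 = l1" using l(4) by simp
    finally show ?thesis using l(1) x(3) by simp
  qed
  ultimately show ?thesis unfolding convex_hull_3 by blast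
qed

lemma triangle_eq_Union: "triangle z = (\<Union>j<6. tri_ps z j)"
proof
  show "(\<Union>j<6. tri_ps z j) \<subseteq> triangle z" using tri_ps_subset by auto
  show "triangle z \<subseteq> (\<Union>j<6. tri_ps z j)"
  proof
    fix x assume "x \<in> triangle z"
    then obtain x1 x2 x3 where x: "x = x1 *\<^sub>R z 1 + x2 *\<^sub>R z 2 + x3 *\<^sub>R z 3" "0 \<le> x1" "0 \<le> x2" "0 \<le> x3" "x1 +
        x2 + x3 = 1"
      by (auto simp: triangle_def convex_hull_3)
    obtain l1 l2 l3 where l: "0 < l1" "0 < l2" "0 < l3" "l1 + l2 + l3 = 1"
      "z 0 = l1 *\<^sub>R z 1 + l2 *\<^sub>R z 2 + l3 *\<^sub>R z 3" using center_bary by blast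
    \<comment> \<open>The vertex with the smallest ratio is the one opposite to the part containing
      \<open>x\<close>; the three cases are cyclic shifts of each other.\<close>
    have "x1 / l1 \<le> x2 / l2 \<and> x1 / l1 \<le> x3 / l3 \<or> x2 / l2 \<le> x3 / l3 \<and> x2 / l2 \<le> x1 / l1
       \<or> x3 / l3 \<le> x1 / l1 \<and> x3 / l3 \<le> x2 / l2" by linarith
    then have "x1 * l2 \<le> x2 * l1 \<and> x1 * l3 \<le> x3 * l1 \<or> x2 * l3 \<le> x3 * l2 \<and> x2 * l1 \<le> x1 * l2
       \<or> x3 * l1 \<le> x1 * l3 \<and> x3 * l2 \<le> x2 * l3"
      using l(1,2,3) by (simp add: divide_le_eq pos_le_divide_eq mult.commute)
    moreover have "l2 + l3 + l1 = 1" "l3 + l1 + l2 = 1" "z 0 = l2 *\<^sub>R z 2 + l3 *\<^sub>R z 3 + l1 *\<^sub>R z 1"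
      "z 0 = l3 *\<^sub>R z 3 + l1 *\<^sub>R z 1 + l2 *\<^sub>R z 2" "x = x2 *\<^sub>R z 2 + x3 *\<^sub>R z 3 + x1 *\<^sub>R z 1"
      "x = x3 *\<^sub>R z 3 + x1 *\<^sub>R z 1 + x2 *\<^sub>R z 2" "x2 + x3 + x1 = 1" "x3 + x1 + x2 = 1"
      using l x by (simp_all add: add_ac)
    ultimately have "x \<in> convex hull {z 0, z 2, z 3} \<or> x \<in> convex hull {z 0, z 3, z 1} \<or> x \<in> convex hull {z
        0, z 1, z 2}"
      using hull_recenter[of l1 l2 l3 "z 0" "z 1" "z 2" "z 3" x x1 x2 x3]
        hull_recenter[of l2 l3 l1 "z 0" "z 2" "z 3" "z 1" x x2 x3 x1]
        hull_recenter[of l3 l1 l2 "z 0" "z 3" "z 1" "z 2" x x3 x1 x2] l x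
      by blast
    moreover have "convex hull {z 0, z 1, z 2} \<subseteq> tri_ps z 0 \<union> tri_ps z 1"
      "convex hull {z 0, z 2, z 3} \<subseteq> tri_ps z 2 \<union> tri_ps z 3"
      "convex hull {z 0, z 3, z 1} \<subseteq> tri_ps z 4 \<union> tri_ps z 5"
      using edge_points[THEN hull_split_open_segment, of "z 0"]
      by (simp_all add: tri_ps_def hex_simps)
    ultimately have "\<exists>j\<in>{0,1,2,3,4,5::nat}. x \<in> tri_ps z j" by blast
    then show "x \<in> (\<Union>j<6. tri_ps z j)" by (auto simp: lessThan_6)
  qed
qed

lemma frontier_triangle: "frontier (triangle z) = (\<Union>j<6. closed_segment (hex z j) (hex z (Suc j)))"
proof -
  have "z 6 \<in> closed_segment (z 1) (z 2)" "z 4 \<in> closed_segment (z 2) (z 3)" "z 5 \<in> closed_segment (z 3) (z 1)"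
    using edge_points by (auto simp: open_segment_def)
  note this[THEN Un_closed_segment]
  moreover have "frontier (triangle z) = closed_segment (z 1) (z 2) \<union> closed_segment (z 2) (z 3) \<union>
      closed_segment (z 3) (z 1)"
    unfolding triangle_def by (rule frontier_of_triangle) simp
  ultimately show ?thesis unfolding lessThan_6 by (auto simp: hex_def)
qed

section \<open>Pairwise intersections of the small triangles\<close>

lemma sector_separate:
  assumes "s *\<^sub>R a + t *\<^sub>R b = s' *\<^sub>R c + t' *\<^sub>R d" "0 \<le> s" "0 \<le> t" "0 \<le> s'" "0 \<le> t'"
    "0 \<le> cross a w" "0 \<le> cross b w" "0 \<le> cross w c" "0 \<le> cross w d"
  shows "s * cross a w = 0" "t * cross b w = 0" "s' * cross w c = 0" "t' * cross w d = 0"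
proof -
  \<comment> \<open>The line spanned by \<open>w\<close> separates the two sectors, so at a common
    point a sum of nonnegative terms is zero.\<close>
  have "cross (s *\<^sub>R a + t *\<^sub>R b) w = cross (s' *\<^sub>R c + t' *\<^sub>R d) w" using assms(1) by simp
  then have "s * cross a w + t * cross b w + s' * cross w c + t' * cross w d = 0"
    by (simp add: cross_commute[of c w] cross_commute[of d w])
  moreover have "0 \<le> s * cross a w" "0 \<le> t * cross b w" "0 \<le> s' * cross w c" "0 \<le> t' * cross w d"
    using assms by simp_all
  ultimately show "s * cross a w = 0" "t * cross b w = 0" "s' * cross w c = 0" "t' * cross w d = 0"
    by linarith+
qed

text \<open>Each pair of sectors is separated by a line through the centre. The available signs
  concern neighbouring spokes and pairs of corner spokes, so non-adjacent triangles are separated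
  along a corner spoke and adjacent ones along their common spoke. Because of the order
  \<open>i < j\<close>, the neighbours \<open>(0, 5)\<close> appear as an exceptional pair.\<close>

lemma tri_ps_Int_less:
  assumes "i < j" "j < 6" "x \<in> tri_ps z i" "x \<in> tri_ps z j"
  shows "x = z 0 \<or> j = Suc i \<and> (\<exists>t. 0 \<le> t \<and> t \<le> 1 \<and> x = z 0 + t *\<^sub>R u j)
    \<or> i = 0 \<and> j = 5 \<and> (\<exists>t. 0 \<le> t \<and> t \<le> 1 \<and> x = z 0 + t *\<^sub>R u 0)"
proof -
  obtain s t where 1: "x = z 0 + s *\<^sub>R u i + t *\<^sub>R u (Suc i)" "0 \<le> s" "0 \<le> t" "s + t \<le> 1"
    using assms(3) by (auto simp: tri_ps_eq E_eq)
  obtain s' t' where 2: "x = z 0 + s' *\<^sub>R u j + t' *\<^sub>R u (Suc j)" "0 \<le> s'" "0 \<le> t'" "s' + t' \<le> 1"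
    using assms(4) by (auto simp: tri_ps_eq E_eq)
  have eq: "s *\<^sub>R u i + t *\<^sub>R u (Suc i) = s' *\<^sub>R u j + t' *\<^sub>R u (Suc j)" using 1 2 by (simp add: add.assoc)
  note sep = sector_separate[OF eq 1(2,3) 2(2,3)]
  note sep' = sector_separate[OF eq[symmetric] 2(2,3) 1(2,3)]
  note pos = cross_micro cross_macro cross_micro[THEN less_imp_le] cross_macro[THEN less_imp_le]
  have u6: "u 6 = u 0" by (rule u_6)
  have zero: "x = z 0" if "s = 0 \<and> t = 0 \<or> s' = 0 \<and> t' = 0"
    using that 1(1) 2(1) by auto
  have pairs: "(i, j) \<in> {(0,1), (0,2), (0,3), (0,4), (0,5), (1,2), (1,3), (1,4), (1,5), (2,3), (2,4), (2,5),
      (3,4), (3,5), (4,5)}"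
    using less_6_cases[OF assms(2)] less_6_cases[of i] assms(1,2) by (elim disjE) simp_all
  have u2: "u (Suc (Suc 0)) = u 2" by (simp add: numeral_2_eq_2)
  have adj: "s = 0" if "(i, j) \<in> {(0,1), (1,2), (2,3), (3,4), (4,5)}"
    using that sep(1)[of "u j"] pos u6 u2 by auto
  have far1: "s = 0 \<and> t = 0" if w: "0 < cross (u i) w" "0 < cross (u (Suc i)) w" "0 \<le> cross w (u j)" "0 \<le>
      cross w (u (Suc j))" for w
    using sep(1,2)[of w] w by auto
  have far2: "s' = 0 \<and> t' = 0" if w: "0 \<le> cross (u i) w" "0 \<le> cross (u (Suc i)) w" "0 < cross w (u j)" "0 <
      cross w (u (Suc j))" for w
    using sep(3,4)[of w] w by auto
  have far3: "s' = 0 \<and> t' = 0" if w: "0 < cross (u j) w" "0 < cross (u (Suc j)) w" "0 \<le> cross w (u i)" "0 \<le>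
      cross w (u (Suc i))" for w
    using sep'(1,2)[of w] w by auto
  have far4: "s = 0 \<and> t = 0" if w: "0 \<le> cross (u j) w" "0 \<le> cross (u (Suc j)) w" "0 < cross w (u i)" "0 <
      cross w (u (Suc i))" for w
    using sep'(3,4)[of w] w by auto
  have far: "s = 0 \<and> t = 0 \<or> s' = 0 \<and> t' = 0"
    if ij: "(i, j) \<in> {(0,2), (0,3), (2,4), (2,5), (1,3), (3,5), (0,4), (1,4), (1,5)}"
  proof -
    consider "i = 0" "j = 2 \<or> j = 3" | "i = 2" "j = 4 \<or> j = 5" | "i = 1" "j = 3" | "i = 3" "j = 5"
      | "i = 0" "j = 4" | "i = 1" "j = 4 \<or> j = 5"
      using ij by auto
    then show ?thesis
    proof cases
      case 1 then show ?thesis using far1[of "u 2"] pos u6 u2 by auto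
    next
      case 2 then show ?thesis using far1[of "u 4"] pos u6 u2 by auto
    next
      case 3 then show ?thesis using far2[of "u 2"] pos u6 u2 by auto
    next
      case 4 then show ?thesis using far2[of "u 4"] pos u6 u2 by auto
    next
      case 5 then show ?thesis using far3[of "u 0"] pos u6 u2 by auto
    next
      case 6 then show ?thesis using far4[of "u 0"] pos u6 u2 by auto
    qed
  qed
  have wrap: "t = 0" if "(i, j) = (0, 5)"
    using that sep'(4)[of "u 0"] pos u6 by auto
  consider "(i, j) \<in> {(0,1), (1,2), (2,3), (3,4), (4,5)}" | "(i, j) = (0, 5)"
    | "(i, j) \<in> {(0,2), (0,3), (2,4), (2,5), (1,3), (3,5), (0,4), (1,4), (1,5)}" using pairs by auto
  then show ?thesis
  proof cases
    case 1
    then have "j = Suc i" by auto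
    then show ?thesis using adj[OF 1] \<open>x = z 0 + s *\<^sub>R u i + t *\<^sub>R u (Suc i)\<close> \<open>0 \<le> t\<close> \<open>s + t \<le> 1\<close> by auto
  next
    case 2
    then show ?thesis using wrap[OF 2] \<open>x = z 0 + s *\<^sub>R u i + t *\<^sub>R u (Suc i)\<close> \<open>0 \<le> s\<close> \<open>s + t \<le> 1\<close> by auto
  next
    case 3
    show ?thesis using far[OF 3] zero by blast
  qed
qed

text \<open>Neighbours share a spoke, all other pairs only the centre. Equality at the centre
  travels around the cycle through the case \<open>t = 0\<close>, so comparing along the six spokes
  suffices.\<close>

lemma spokes_agree:
  assumes "\<And>j t. j < 6 \<Longrightarrow> 0 \<le> t \<Longrightarrow> t \<le> 1 \<Longrightarrow> Q j (z 0 + t *\<^sub>R u (Suc j)) = Q (Suc j mod 6) (z 0 + t *\<^sub>R u (Suc j))"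
    and "i < 6" "j < 6" "x \<in> tri_ps z i" "x \<in> tri_ps z j"
  shows "Q i x = Q j x"
proof -
  have c: "Q j (z 0) = Q 0 (z 0)" if "j < 6" for j
    using that
  proof (induction j)
    case (Suc j)
    then show ?case using assms(1)[of j 0] by simp
  qed simp
  have center: "Q i (z 0) = Q j (z 0)" if "i < 6" "j < 6" for i j
    using c[OF that(1)] c[OF that(2)] by simp
  have *: "Q i x = Q j x" if ij: "i < j" "j < 6" "x \<in> tri_ps z i" "x \<in> tri_ps z j" for i j
  proof -
    consider "x = z 0" | t where "j = Suc i" "0 \<le> t" "t \<le> 1" "x = z 0 + t *\<^sub>R u j"
      | t where "i = 0" "j = 5" "0 \<le> t" "t \<le> 1" "x = z 0 + t *\<^sub>R u 0"
      using tri_ps_Int_less[OF ij] by blast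
    then show ?thesis
    proof cases
      case 1 then show ?thesis using center[of i j] ij by auto
    next
      case 2 then show ?thesis using assms(1)[of i t] ij by auto
    next
      case 3
      show ?thesis using assms(1)[of 5 t] 3 by (simp add: u_6)
    qed
  qed
  show ?thesis
    using *[of i j, OF _ assms(3,4,5)] *[of j i, OF _ assms(2,5,4)] by (metis linorder_neqE_nat)
qed

end

section \<open>Piecewise polynomials\<close>

lemma poly_on_int_iff:
  "f \<in> poly_on (int n) S \<longleftrightarrow> (\<exists>p\<in>bpoly n. f = (\<lambda>x. if x \<in> S then p x else 0))"
proof -
  have "{(i, j). int i + int j \<le> int n} = tri n" by (auto simp: tri_def)
  then have "f \<in> poly_on (int n) S \<longleftrightarrow> (\<exists>c. \<forall>x. f x = (if x \<in> S then \<Sum>(i, j)\<in>tri n. c i j * fst x ^ i * snd x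
      ^ j else 0))"
    by (simp add: poly_on_def)
  also have "\<dots> \<longleftrightarrow> (\<exists>p\<in>bpoly n. f = (\<lambda>x. if x \<in> S then p x else 0))"
    unfolding bpoly_def Bex_def mem_Collect_eq fun_eq_iff
  proof (intro iffI; clarify)
    fix c :: "nat \<Rightarrow> nat \<Rightarrow> real"
    assume "\<forall>x. f x = (if x \<in> S then \<Sum>(i, j)\<in>tri n. c i j * fst x ^ i * snd x ^ j else 0)"
    then show "\<exists>p. (\<exists>c. \<forall>x. p x = (\<Sum>(i, j)\<in>tri n. c i j * fst x ^ i * snd x ^ j)) \<and> (\<forall>x. f x = (if x \<in> S
        then p x else 0))"
      by (intro exI[of _ "\<lambda>x. \<Sum>(i, j)\<in>tri n. c i j * fst x ^ i * snd x ^ j"] conjI exI[of _ c]) auto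
  next
    fix p and c :: "nat \<Rightarrow> nat \<Rightarrow> real"
    assume "\<forall>x. p x = (\<Sum>(i, j)\<in>tri n. c i j * fst x ^ i * snd x ^ j)" "\<forall>x. f x = (if x \<in> S then p x else 0)"
    then show "\<exists>c. \<forall>x. f x = (if x \<in> S then \<Sum>(i, j)\<in>tri n. c i j * fst x ^ i * snd x ^ j else 0)"
      by (intro exI[of _ c]) auto
  qed
  finally show ?thesis .
qed

lemma poly_on_neg: "k < 0 \<Longrightarrow> poly_on k S = {\<lambda>x. 0}"
proof -
  assume "k < 0"
  then have "{(i, j). int i + int j \<le> k} = {}" by auto
  then show ?thesis by (auto simp: poly_on_def)
qed

context ps_config
begin

section \<open>Polynomial pieces and gluing\<close>

lemma interior_tri_ps_nonempty: "interior (tri_ps z j) \<noteq> {}"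
proof -
  have J: "cross (u j) (u (Suc j)) \<noteq> 0" using cross_u_Suc[of j] by simp
  let ?c = "acoord (z 0) (u j) (u (Suc j))"
  let ?S = "{x. 0 < fst (?c x)} \<inter> {x. 0 < snd (?c x)} \<inter> {x. fst (?c x) + snd (?c x) < 1}"
  have "open ?S"
    using bpoly_continuous[OF bpoly_fst_acoord[of "z 0" "u j" "u (Suc j)"], of UNIV] bpoly_continuous[OF
        bpoly_snd_acoord[of "z 0" "u j" "u (Suc j)"], of UNIV]
    by (intro open_Int open_Collect_less continuous_on_add) auto
  moreover have "?S \<subseteq> tri_ps z j"
  proof
    fix x assume "x \<in> ?S"
    then have "E j (fst (?c x), snd (?c x)) \<in> tri_ps z j" by (intro E_in_tri_ps) auto
    then show "x \<in> tri_ps z j" using J by (simp add: E_def)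
  qed
  moreover have "E j (1/3, 1/3) \<in> ?S" using J by (simp add: E_def)
  ultimately show ?thesis using interior_maximal by blast
qed

lemma closure_interior_tri_ps: "closure (interior (tri_ps z j)) = tri_ps z j"
  using convex_closure_interior[OF convex_tri_ps interior_tri_ps_nonempty] closed_tri_ps by simp

text \<open>The piece is extended to the whole plane, so pieces of neighbouring triangles can be
  differentiated and compared without one-sided limits. The value is arbitrary when \<open>f\<close>
  is not polynomial on the triangle.\<close>

definition pc :: "nat \<Rightarrow> (R2 \<Rightarrow> real) \<Rightarrow> R2 \<Rightarrow> real" where
  "pc j f = (SOME p. (\<exists>n. p \<in> bpoly n) \<and> (\<forall>x\<in>tri_ps z j. f x = p x))"

lemma pc_eqI:
  assumes "p \<in> bpoly n" "\<And>x. x \<in> tri_ps z j \<Longrightarrow> f x = p x"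
  shows "pc j f = p"
proof -
  have "\<exists>p. (\<exists>n. p \<in> bpoly n) \<and> (\<forall>x\<in>tri_ps z j. f x = p x)" using assms by blast
  from someI_ex[OF this] obtain m where "pc j f \<in> bpoly m" "\<forall>x\<in>tri_ps z j. f x = pc j f x"
    unfolding pc_def by blast
  then show ?thesis using assms by (intro bpoly_eq_on_tri_ps[where j = j]) auto
qed

lemma pc_mod: "pc (j mod 6) f = pc j f"
  by (simp add: pc_def tri_ps_mod)

definition CP :: "nat \<Rightarrow> (R2 \<Rightarrow> real) set" where "CP n = cont_pw_poly (int n) z"

text \<open>Continuity is recovered by pasting over six closed sets. Matching across the spokes is
  contained in \<open>f\<close> being one function that takes the values of every piece.\<close>

lemma CP_iff:
  "f \<in> CP n \<longleftrightarrow> (\<forall>x. x \<notin> triangle z \<longrightarrow> f x = 0) \<and> (\<forall>j<6. \<exists>p\<in>bpoly n. \<forall>x\<in>tri_ps z j. f x = p x)"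
proof -
  have *: "(\<lambda>x. if x \<in> S then f x else 0) \<in> poly_on (int n) S \<longleftrightarrow> (\<exists>p\<in>bpoly n. \<forall>x\<in>S. f x = p x)" for S
    unfolding poly_on_int_iff by (metis (no_types, lifting))
  have "continuous_on (triangle z) f" if "\<forall>j<6. \<exists>p\<in>bpoly n. \<forall>x\<in>tri_ps z j. f x = p x"
    unfolding triangle_eq_Union
  proof (rule continuous_on_closed_Union)
    fix j :: nat assume "j \<in> {..<6}"
    then obtain p where "p \<in> bpoly n" "\<forall>x\<in>tri_ps z j. f x = p x" using \<open>\<forall>j<6. _ j\<close> by auto
    then show "continuous_on (tri_ps z j) f"
      using bpoly_continuous continuous_on_cong by metis
  qed (use closed_tri_ps in auto)
  then show ?thesis unfolding CP_def cont_pw_poly_def mem_Collect_eq ps_split_hex * by auto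
qed

lemma
  assumes "f \<in> CP n"
  shows pc_bpoly: "pc j f \<in> bpoly n" and pc_eq: "x \<in> tri_ps z j \<Longrightarrow> f x = pc j f x"
    and CP_outside: "x \<notin> triangle z \<Longrightarrow> f x = 0"
proof -
  have "j mod 6 < 6" by simp
  then obtain p where p: "p \<in> bpoly n" "\<forall>x\<in>tri_ps z j. f x = p x"
    using assms unfolding CP_iff by (metis tri_ps_mod)
  then have "pc j f = p" by (intro pc_eqI) auto
  then show "pc j f \<in> bpoly n" "x \<in> tri_ps z j \<Longrightarrow> f x = pc j f x" using p by auto
  show "x \<notin> triangle z \<Longrightarrow> f x = 0" using assms CP_iff[of f n] by blast
qed

lemma in_some_tri: "x \<in> triangle z \<Longrightarrow> \<exists>j<6. x \<in> tri_ps z j"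
  using triangle_eq_Union by auto

lemma CP_eqI:
  assumes "f \<in> CP m" "g \<in> CP n" "\<And>j. j < 6 \<Longrightarrow> pc j f = pc j g"
  shows "f = g"
proof
  fix x show "f x = g x"
    using in_some_tri[of x] pc_eq[OF assms(1)] pc_eq[OF assms(2)] CP_outside[OF assms(1)] CP_outside[OF
        assms(2)] assms(3)
    by metis
qed

lemma CP_glue:
  assumes "\<And>j. j < 6 \<Longrightarrow> Q j \<in> bpoly n"
    "\<And>i j x. i < 6 \<Longrightarrow> j < 6 \<Longrightarrow> x \<in> tri_ps z i \<Longrightarrow> x \<in> tri_ps z j \<Longrightarrow> Q i x = Q j x"
  obtains f where "f \<in> CP n" "\<And>j. j < 6 \<Longrightarrow> pc j f = Q j"
proof -
  define f where "f = (\<lambda>x. if x \<in> triangle z then Q (SOME j. j < 6 \<and> x \<in> tri_ps z j) x else 0)"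
  have f: "f x = Q j x" if "j < 6" "x \<in> tri_ps z j" for j x
  proof -
    define k where "k = (SOME j. j < 6 \<and> x \<in> tri_ps z j)"
    have k: "k < 6 \<and> x \<in> tri_ps z k"
      unfolding k_def using that by (intro someI_ex[of "\<lambda>j. j < 6 \<and> x \<in> tri_ps z j"]) blast
    have "x \<in> triangle z" using that tri_ps_subset by auto
    then have "f x = Q k x" by (simp add: f_def k_def)
    also have "\<dots> = Q j x" using assms(2)[of k j x] k that by blast
    finally show ?thesis .
  qed
  have "f \<in> CP n" unfolding CP_iff using f assms(1) by (auto simp: f_def)
  moreover have "pc j f = Q j" if "j < 6" for j
    using f[OF that] assms(1)[OF that] by (intro pc_eqI) auto
  ultimately show ?thesis using that by blast
qed

lemma pc_add: "f \<in> CP m \<Longrightarrow> g \<in> CP n \<Longrightarrow> pc j (\<lambda>x. f x + g x) = (\<lambda>x. pc j f x + pc j g x)"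
  using pc_eq[of f m _ j] pc_eq[of g n _ j]
  by (intro pc_eqI[of _ "max m n"] bpoly_add bpoly_mono[OF _ pc_bpoly]) auto

lemma pc_cmul: "f \<in> CP m \<Longrightarrow> pc j (\<lambda>x. c * f x) = (\<lambda>x. c * pc j f x)"
  using pc_eq[of f m _ j] by (intro pc_eqI[of _ m] bpoly_cmul pc_bpoly) auto

lemma pc_zero: "pc j (\<lambda>x. 0) = (\<lambda>x. 0)"
  by (rule pc_eqI[of _ 0]) auto

lemma
  shows CP_zero: "(\<lambda>x. 0) \<in> CP n"
    and CP_add: "f \<in> CP n \<Longrightarrow> g \<in> CP n \<Longrightarrow> (\<lambda>x. f x + g x) \<in> CP n"
    and CP_cmul: "f \<in> CP n \<Longrightarrow> (\<lambda>x. c * f x) \<in> CP n"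
    and CP_mult: "f \<in> CP n \<Longrightarrow> h \<in> CP m \<Longrightarrow> (\<lambda>x. f x * h x) \<in> CP (n + m)"
proof -
  show "(\<lambda>x. 0) \<in> CP n" unfolding CP_iff by (auto intro!: bexI[of _ "\<lambda>x. 0"])
  show "(\<lambda>x. f x + g x) \<in> CP n" if f: "f \<in> CP n" "g \<in> CP n"
    unfolding CP_iff
  proof (intro conjI allI impI)
    fix j show "\<exists>p\<in>bpoly n. \<forall>x\<in>tri_ps z j. f x + g x = p x"
      by (rule bexI[OF _ bpoly_add[OF pc_bpoly[OF f(1), of j] pc_bpoly[OF f(2), of j]]]) (use pc_eq f in auto)
  qed (use CP_outside[OF f(1)] CP_outside[OF f(2)] in auto)
  show "(\<lambda>x. c * f x) \<in> CP n" if f: "f \<in> CP n"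
    unfolding CP_iff
  proof (intro conjI allI impI)
    fix j show "\<exists>p\<in>bpoly n. \<forall>x\<in>tri_ps z j. c * f x = p x"
      by (rule bexI[OF _ bpoly_cmul[OF pc_bpoly[OF f, of j]]]) (use pc_eq f in auto)
  qed (use CP_outside f in auto)
  show "(\<lambda>x. f x * h x) \<in> CP (n + m)" if f: "f \<in> CP n" "h \<in> CP m"
    unfolding CP_iff
  proof (intro conjI allI impI)
    fix j show "\<exists>p\<in>bpoly (n + m). \<forall>x\<in>tri_ps z j. f x * h x = p x"
      by (rule bexI[OF _ bpoly_mult[OF pc_bpoly[OF f(1), of j] pc_bpoly[OF f(2), of j]]]) (use pc_eq f in auto)
  qed (use CP_outside[OF f(1)] in auto)
qed

lemma fun_subspace_CP: "fun_vs.subspace (CP n)"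
  by (rule fun_subspaceI) (auto simp: CP_zero CP_add CP_cmul)

lemma pc_mult: "f \<in> CP m \<Longrightarrow> g \<in> CP n \<Longrightarrow> pc j (\<lambda>x. f x * g x) = (\<lambda>x. pc j f x * pc j g x)"
  using pc_eq[of f m _ j] pc_eq[of g n _ j]
  by (intro pc_eqI[of _ "m + n"] bpoly_mult pc_bpoly) auto

lemma CP_continuous: "f \<in> CP n \<Longrightarrow> continuous_on (triangle z) f"
  by (simp add: CP_def cont_pw_poly_def)

text \<open>On the interior of a small triangle \<open>d\<close> equals \<open>G j\<close>; both are
  continuous and the triangle is the closure of its interior, so equality extends to the closed
  triangle. Derivatives at interior points are thus replaced by polynomials on closed
  pieces.\<close>

lemma cont_rep_iff:
  fixes G :: "nat \<Rightarrow> R2 \<Rightarrow> 'a::real_normed_vector"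
  assumes "\<And>j x. j < 6 \<Longrightarrow> x \<in> interior (tri_ps z j) \<Longrightarrow> g x = G j x"
    "\<And>j. j < 6 \<Longrightarrow> continuous_on UNIV (G j)"
  shows "cont_rep z g d \<longleftrightarrow> (\<forall>x. x \<notin> triangle z \<longrightarrow> d x = 0) \<and> (\<forall>j<6. \<forall>x\<in>tri_ps z j. d x = G j x)"
proof
  assume d: "cont_rep z g d"
  have "d x = G j x" if jx: "j < 6" "x \<in> tri_ps z j" for j x
  proof -
    have "continuous_on (closure (interior (tri_ps z j))) (\<lambda>x. d x - G j x)"
      unfolding closure_interior_tri_ps
      using d assms(2)[OF jx(1)] tri_ps_subset
      by (intro continuous_on_diff) (auto simp: cont_rep_def intro: continuous_on_subset)
    moreover have "d x - G j x = 0" if "x \<in> interior (tri_ps z j)" for x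
      using d assms(1)[OF jx(1) that] jx(1) that by (auto simp: cont_rep_def ps_split_hex)
    moreover have "x \<in> closure (interior (tri_ps z j))" using jx(2) by (simp add: closure_interior_tri_ps)
    ultimately have "d x - G j x = 0" by (rule continuous_constant_on_closure)
    then show ?thesis by simp
  qed
  then show "(\<forall>x. x \<notin> triangle z \<longrightarrow> d x = 0) \<and> (\<forall>j<6. \<forall>x\<in>tri_ps z j. d x = G j x)"
    using d by (auto simp: cont_rep_def)
next
  assume d: "(\<forall>x. x \<notin> triangle z \<longrightarrow> d x = 0) \<and> (\<forall>j<6. \<forall>x\<in>tri_ps z j. d x = G j x)"
  have "continuous_on (triangle z) d"
    unfolding triangle_eq_Union
  proof (rule continuous_on_closed_Union)
    fix j :: nat assume j: "j \<in> {..<6}"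
    have "continuous_on (tri_ps z j) (G j)"
      using assms(2) j by (meson continuous_on_subset subset_UNIV lessThan_iff)
    then show "continuous_on (tri_ps z j) d"
      using continuous_on_cong[of "tri_ps z j" "tri_ps z j" d "G j"] d j by auto
  qed (use closed_tri_ps in auto)
  moreover have "d x = g x" if "j < 6" "x \<in> interior (tri_ps z j)" for j x
    using d assms(1)[OF that] that interior_subset by fastforce
  ultimately show "cont_rep z g d"
    using d by (auto simp: cont_rep_def ps_split_hex)
qed

section \<open>Divergence and rotation of the pieces\<close>

definition divp :: "nat \<Rightarrow> (R2 \<Rightarrow> R2) \<Rightarrow> R2 \<Rightarrow> real" where
  "divp j v = (\<lambda>x. dirD (1, 0) (pc j (fst \<circ> v)) x + dirD (0, 1) (pc j (snd \<circ> v)) x)"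

definition rotp :: "nat \<Rightarrow> (R2 \<Rightarrow> real) \<Rightarrow> R2 \<Rightarrow> R2" where
  "rotp j q = (\<lambda>x. (dirD (0, 1) (pc j q) x, - dirD (1, 0) (pc j q) x))"

definition VP :: "nat \<Rightarrow> (R2 \<Rightarrow> R2) set" where "VP n = pair_funs (CP n) (CP n)"

lemma VP_D: "v \<in> VP n \<Longrightarrow> fst \<circ> v \<in> CP n" "v \<in> VP n \<Longrightarrow> snd \<circ> v \<in> CP n"
  by (simp_all add: VP_def pair_funs_def)

lemma divp_bpoly: "v \<in> VP n \<Longrightarrow> divp j v \<in> bpoly (n - 1)"
  unfolding divp_def using VP_D by (intro bpoly_add dirD_bpoly pc_bpoly) auto

lemma divp_mod: "divp (j mod 6) v = divp j v"
  by (simp add: divp_def pc_mod)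

lemma pw_div_eq:
  assumes "v \<in> VP n" "x \<in> interior (tri_ps z j)"
  shows "pw_div v x = divp j v x"
proof -
  let ?p = "pc j (fst \<circ> v)" and ?q = "pc j (snd \<circ> v)"
  have "((\<lambda>x. (?p x, ?q x)) has_derivative (\<lambda>h. (dirD h ?p x, dirD h ?q x))) (at x)"
    by (intro has_derivative_Pair bpoly_has_derivative[OF pc_bpoly[OF VP_D(1)[OF assms(1)]]]
        bpoly_has_derivative[OF pc_bpoly[OF VP_D(2)[OF assms(1)]]])
  then have "(v has_derivative (\<lambda>h. (dirD h ?p x, dirD h ?q x))) (at x)"
  proof (rule has_derivative_transform_within_open[OF _ open_interior assms(2)])
    fix y assume "y \<in> interior (tri_ps z j)"
    then have "y \<in> tri_ps z j" using interior_subset by auto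
    then show "(?p y, ?q y) = v y"
      using pc_eq[OF VP_D(1)[OF assms(1)]] pc_eq[OF VP_D(2)[OF assms(1)]] by (simp add: prod_eq_iff)
  qed
  from frechet_derivative_at[OF this, symmetric] show ?thesis by (simp add: pw_div_def divp_def)
qed

lemma pw_rot_eq:
  assumes "q \<in> CP n" "x \<in> interior (tri_ps z j)"
  shows "pw_rot q x = rotp j q x"
proof -
  let ?p = "pc j q"
  have "(?p has_derivative (\<lambda>h. dirD h ?p x)) (at x)"
    by (rule bpoly_has_derivative[OF pc_bpoly[OF assms(1)]])
  then have "(q has_derivative (\<lambda>h. dirD h ?p x)) (at x)"
  proof (rule has_derivative_transform_within_open[OF _ open_interior assms(2)])
    fix y assume "y \<in> interior (tri_ps z j)"
    then have "y \<in> tri_ps z j" using interior_subset by auto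
    then show "?p y = q y" using pc_eq[OF assms(1)] by simp
  qed
  from frechet_derivative_at[OF this, symmetric] show ?thesis by (simp add: pw_rot_def rotp_def)
qed

lemma cont_rep_div_iff:
  assumes "v \<in> VP n"
  shows "cont_rep z (pw_div v) d \<longleftrightarrow> (\<forall>x. x \<notin> triangle z \<longrightarrow> d x = 0) \<and> (\<forall>j<6. \<forall>x\<in>tri_ps z j. d x = divp j v x)"
  by (rule cont_rep_iff[OF pw_div_eq[OF assms] bpoly_continuous[OF divp_bpoly[OF assms]]])

lemma rotp_continuous:
  assumes "q \<in> CP n" shows "continuous_on S (rotp j q)"
  unfolding rotp_def
  by (intro continuous_intros bpoly_continuous[OF dirD_bpoly[OF pc_bpoly[OF assms]]])

lemma cont_rep_rot_iff:
  assumes "q \<in> CP n"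
  shows "cont_rep z (pw_rot q) d \<longleftrightarrow> (\<forall>x. x \<notin> triangle z \<longrightarrow> d x = 0) \<and> (\<forall>j<6. \<forall>x\<in>tri_ps z j. d x = rotp j q x)"
  by (rule cont_rep_iff[OF pw_rot_eq[OF assms] rotp_continuous[OF assms]])

text \<open>Compatibility of a family of pieces on overlaps; the value type is left open because
  scalar divergences and vector-valued rotations are treated alike.\<close>

definition agree :: "(nat \<Rightarrow> R2 \<Rightarrow> 'a) \<Rightarrow> bool" where
  "agree G \<longleftrightarrow> (\<forall>i<6. \<forall>j<6. \<forall>x\<in>tri_ps z i \<inter> tri_ps z j. G i x = G j x)"

lemma agreeD: "agree G \<Longrightarrow> i < 6 \<Longrightarrow> j < 6 \<Longrightarrow> x \<in> tri_ps z i \<Longrightarrow> x \<in> tri_ps z j \<Longrightarrow> G i x = G j x"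
  unfolding agree_def by blast

lemma agree_const: "agree (\<lambda>j. g)" by (simp add: agree_def)

lemma agree_comp2: "agree G \<Longrightarrow> agree H \<Longrightarrow> agree (\<lambda>j x. F (G j x) (H j x))"
  unfolding agree_def by metis

lemma agree_comp1: "agree G \<Longrightarrow> agree (\<lambda>j x. F (G j x))"
  unfolding agree_def by metis

text \<open>Combined with \<open>cont_rep_iff\<close> this reduces the existence of a continuous
  divergence or rotation to the agreement of polynomial pieces on overlaps.\<close>

lemma pieces_exist_iff:
  fixes G :: "nat \<Rightarrow> R2 \<Rightarrow> 'a::zero"
  shows "(\<exists>d. (\<forall>x. x \<notin> triangle z \<longrightarrow> d x = 0) \<and> (\<forall>j<6. \<forall>x\<in>tri_ps z j. d x = G j x)) \<longleftrightarrow> agree G"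
proof
  assume a: "agree G"
  let ?d = "\<lambda>x. if x \<in> triangle z then G (SOME j. j < 6 \<and> x \<in> tri_ps z j) x else 0"
  have "?d x = G j x" if "j < 6" "x \<in> tri_ps z j" for j x
  proof -
    define k where "k = (SOME j. j < 6 \<and> x \<in> tri_ps z j)"
    have k: "k < 6 \<and> x \<in> tri_ps z k"
      unfolding k_def using that by (intro someI_ex[of "\<lambda>j. j < 6 \<and> x \<in> tri_ps z j"]) blast
    have "x \<in> triangle z" using that tri_ps_subset by auto
    then have "?d x = G k x" by (simp add: k_def)
    also have "\<dots> = G j x" using agreeD[OF a] k that by blast
    finally show ?thesis .
  qed
  then show "\<exists>d. (\<forall>x. x \<notin> triangle z \<longrightarrow> d x = 0) \<and> (\<forall>j<6. \<forall>x\<in>tri_ps z j. d x = G j x)"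
    by (intro exI[of _ ?d]) auto
qed (unfold agree_def, metis IntE)

lemma S1_iff:
  "v \<in> S1 (int n) z \<longleftrightarrow> v \<in> VP n \<and> agree (\<lambda>j. divp j v)"
proof -
  have "v \<in> S1 (int n) z \<longleftrightarrow> v \<in> VP n \<and> (\<exists>d. cont_rep z (pw_div v) d)"
    by (auto simp: S1_def VP_def pair_funs_def CP_def)
  also have "\<dots> \<longleftrightarrow> v \<in> VP n \<and> agree (\<lambda>j. divp j v)"
    by (intro conj_cong refl) (simp only: cont_rep_div_iff[of v n] pieces_exist_iff)
  finally show ?thesis .
qed

lemma cont_rep_The:
  assumes "\<And>d. cont_rep z g d \<longleftrightarrow> (\<forall>x. x \<notin> triangle z \<longrightarrow> d x = 0) \<and> (\<forall>j<6. \<forall>x\<in>tri_ps z j. d x = G j x)"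
    and "cont_rep z g d"
  shows "(THE d. cont_rep z g d) = d"
proof (rule the_equality)
  fix e assume "cont_rep z g e"
  then show "e = d" using assms in_some_tri by (metis ext)
qed (rule assms(2))

lemma S1_VP: "v \<in> S1 (int n) z \<Longrightarrow> v \<in> VP n" using S1_iff by blast

lemma cdiv_eq:
  assumes "v \<in> S1 (int n) z"
  shows "x \<in> tri_ps z j \<Longrightarrow> cdiv z v x = divp j v x" "x \<notin> triangle z \<Longrightarrow> cdiv z v x = 0"
proof -
  obtain d where d: "cont_rep z (pw_div v) d" using assms by (auto simp: S1_def)
  note iff = cont_rep_div_iff[OF S1_VP[OF assms]]
  have "cdiv z v = d" unfolding cdiv_def by (rule cont_rep_The[OF iff d])
  moreover have "j mod 6 < 6" by simp
  ultimately show "x \<in> tri_ps z j \<Longrightarrow> cdiv z v x = divp j v x" "x \<notin> triangle z \<Longrightarrow> cdiv z v x = 0"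
    using d unfolding iff by (metis divp_mod tri_ps_mod, blast)
qed

lemma cdiv_CP:
  assumes "v \<in> S1 (int n) z"
  shows "cdiv z v \<in> CP (n - 1)" "pc j (cdiv z v) = divp j v"
proof -
  show "cdiv z v \<in> CP (n - 1)"
    unfolding CP_iff using cdiv_eq[OF assms] divp_bpoly[OF S1_VP[OF assms]] by blast
  show "pc j (cdiv z v) = divp j v"
    using cdiv_eq[OF assms] divp_bpoly[OF S1_VP[OF assms]] by (intro pc_eqI)
qed

lemma cdiv_eqI:
  assumes "v \<in> S1 (int n) z" "\<And>x j. j < 6 \<Longrightarrow> x \<in> tri_ps z j \<Longrightarrow> d x = divp j v x" "\<And>x. x \<notin> triangle z \<Longrightarrow> d x = 0"
  shows "cdiv z v = d"
proof
  fix x show "cdiv z v x = d x"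
    using cdiv_eq[OF assms(1), of x] in_some_tri[of x] assms(2,3) by metis
qed

lemma comp_simps: "fst \<circ> (\<lambda>x. v x + w x) = (\<lambda>x. (fst \<circ> v) x + (fst \<circ> w) x)"
  "snd \<circ> (\<lambda>x. v x + w x) = (\<lambda>x. (snd \<circ> v) x + (snd \<circ> w) x)"
  "fst \<circ> (\<lambda>x. c *\<^sub>R v x) = (\<lambda>x. c * (fst \<circ> v) x)" "snd \<circ> (\<lambda>x. c *\<^sub>R v x) = (\<lambda>x. c * (snd \<circ> v) x)"
  for v w :: "'a \<Rightarrow> R2"
  by auto

lemma divp_add:
  assumes "v \<in> VP n" "w \<in> VP n"
  shows "divp j (\<lambda>x. v x + w x) = (\<lambda>x. divp j v x + divp j w x)"
  using pc_add[OF VP_D(1)[OF assms(1)] VP_D(1)[OF assms(2)]] pc_add[OF VP_D(2)[OF assms(1)] VP_D(2)[OF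
      assms(2)]]
    dirD_add[OF pc_bpoly[OF VP_D(1)[OF assms(1)]] pc_bpoly[OF VP_D(1)[OF assms(2)]]]
    dirD_add[OF pc_bpoly[OF VP_D(2)[OF assms(1)]] pc_bpoly[OF VP_D(2)[OF assms(2)]]]
  unfolding divp_def comp_simps by (simp add: add_ac)

lemma divp_scale:
  assumes "v \<in> VP n"
  shows "divp j (\<lambda>x. c *\<^sub>R v x) = (\<lambda>x. c * divp j v x)"
  using pc_cmul[OF VP_D(1)[OF assms(1)]] pc_cmul[OF VP_D(2)[OF assms(1)]]
    dirD_cmul[OF pc_bpoly[OF VP_D(1)[OF assms(1)]]] dirD_cmul[OF pc_bpoly[OF VP_D(2)[OF assms(1)]]]
  unfolding divp_def comp_simps by (simp add: distrib_left)

lemma fun_subspace_VP: "fun_vs.subspace (VP n)"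
  unfolding VP_def by (intro fun_subspace_pair_funs fun_subspace_CP)

lemma VP_zero: "(\<lambda>x. 0) \<in> VP n" by (rule fun_subspaceD(1)[OF fun_subspace_VP])

lemma divp_zero: "divp j (\<lambda>x. 0) = (\<lambda>x. 0)"
  using divp_scale[OF VP_zero, of j 0] by simp

lemma fun_subspace_S1: "fun_vs.subspace (S1 (int n) z)"
  using fun_subspaceD[OF fun_subspace_VP[of n]]
  by (intro fun_subspaceI)
    (auto simp: S1_iff divp_zero divp_add[where n = n] divp_scale[where n = n] intro: agree_const
        agree_comp1 agree_comp2)

lemma cdiv_add:
  assumes "v \<in> S1 (int n) z" "w \<in> S1 (int n) z"
  shows "cdiv z (\<lambda>x. v x + w x) = (\<lambda>x. cdiv z v x + cdiv z w x)"
  using cdiv_eq[OF assms(1)] cdiv_eq[OF assms(2)] divp_add[OF S1_VP[OF assms(1)] S1_VP[OF assms(2)]]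
  by (intro cdiv_eqI[OF fun_subspaceD(2)[OF fun_subspace_S1 assms]]) auto

lemma cdiv_scale:
  assumes "v \<in> S1 (int n) z"
  shows "cdiv z (\<lambda>x. c *\<^sub>R v x) = (\<lambda>x. c * cdiv z v x)"
  using cdiv_eq[OF assms(1)] divp_scale[OF S1_VP[OF assms(1)]]
  by (intro cdiv_eqI[OF fun_subspaceD(3)[OF fun_subspace_S1 assms]]) auto

text \<open>The space without boundary conditions: \<open>crot\<close> is linear on it, and this
  shows that the boundary conditions of \<open>S0_ring\<close> define a subspace.\<close>

definition C1 :: "nat \<Rightarrow> (R2 \<Rightarrow> real) set" where
  "C1 n = {q \<in> CP n. \<exists>d. cont_rep z (pw_rot q) d}"

lemma C1_iff:
  "q \<in> C1 n \<longleftrightarrow> q \<in> CP n \<and> agree (\<lambda>j. rotp j q)"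
proof -
  have "(\<exists>d. cont_rep z (pw_rot q) d) \<longleftrightarrow> agree (\<lambda>j. rotp j q)" if "q \<in> CP n"
    unfolding cont_rep_rot_iff[OF that] by (rule pieces_exist_iff)
  then show ?thesis by (auto simp: C1_def)
qed

lemma C1_CP: "q \<in> C1 n \<Longrightarrow> q \<in> CP n" by (simp add: C1_def)

lemma rotp_mod: "rotp (j mod 6) v = rotp j v"
  by (simp add: rotp_def pc_mod)

lemma crot_eq:
  assumes "q \<in> C1 n"
  shows "x \<in> tri_ps z j \<Longrightarrow> crot z q x = rotp j q x" "x \<notin> triangle z \<Longrightarrow> crot z q x = 0"
proof -
  obtain d where d: "cont_rep z (pw_rot q) d" using assms by (auto simp: C1_def)
  note iff = cont_rep_rot_iff[OF C1_CP[OF assms]]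
  have "crot z q = d" unfolding crot_def by (rule cont_rep_The[OF iff d])
  moreover have "j mod 6 < 6" by simp
  ultimately show "x \<in> tri_ps z j \<Longrightarrow> crot z q x = rotp j q x" "x \<notin> triangle z \<Longrightarrow> crot z q x = 0"
    using d unfolding iff by (metis rotp_mod tri_ps_mod, blast)
qed

lemma crot_eqI:
  assumes "v \<in> C1 n" "\<And>x j. j < 6 \<Longrightarrow> x \<in> tri_ps z j \<Longrightarrow> d x = rotp j v x" "\<And>x. x \<notin> triangle z \<Longrightarrow> d x = 0"
  shows "crot z v = d"
proof
  fix x show "crot z v x = d x"
    using crot_eq[OF assms(1), of x] in_some_tri[of x] assms(2,3) by metis
qed

lemma rotp_add:
  assumes "p \<in> CP m" "q \<in> CP n"
  shows "rotp j (\<lambda>x. p x + q x) = (\<lambda>x. rotp j p x + rotp j q x)"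
  using pc_add[OF assms] dirD_add[OF pc_bpoly[OF assms(1)] pc_bpoly[OF assms(2)]]
  unfolding rotp_def by simp

lemma rotp_cmul:
  assumes "p \<in> CP m"
  shows "rotp j (\<lambda>x. c * p x) = (\<lambda>x. c *\<^sub>R rotp j p x)"
  using pc_cmul[OF assms] dirD_cmul[OF pc_bpoly[OF assms(1)]]
  unfolding rotp_def by simp

lemma fun_subspace_C1: "fun_vs.subspace (C1 n)"
proof -
  have "rotp j (\<lambda>x. 0) = (\<lambda>x. 0)" for j using rotp_cmul[OF CP_zero, of j 0] by (simp add: zero_prod_def)
  then show ?thesis
    by (intro fun_subspaceI)
      (auto simp: C1_iff CP_zero CP_add CP_cmul rotp_add rotp_cmul intro: agree_const agree_comp1 agree_comp2)
qed

lemma crot_add: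
  assumes "p \<in> C1 n" "q \<in> C1 n"
  shows "crot z (\<lambda>x. p x + q x) = (\<lambda>x. crot z p x + crot z q x)"
  using crot_eq[OF assms(1)] crot_eq[OF assms(2)] rotp_add[OF C1_CP[OF assms(1)] C1_CP[OF assms(2)]]
  by (intro crot_eqI[OF fun_subspaceD(2)[OF fun_subspace_C1 assms]]) auto

lemma crot_scale:
  assumes "p \<in> C1 n"
  shows "crot z (\<lambda>x. c * p x) = (\<lambda>x. c *\<^sub>R crot z p x)"
  using crot_eq[OF assms] rotp_cmul[OF C1_CP[OF assms]] fun_subspaceD(3)[OF fun_subspace_C1 assms]
  by (intro crot_eqI[of _ n]) auto

lemma S0_ring_iff:
  "q \<in> S0_ring (int n) z \<longleftrightarrow> q \<in> C1 n \<and> (\<forall>x\<in>frontier (triangle z). q x = 0 \<and> crot z q x = 0)"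
  by (auto simp: S0_ring_def C1_def CP_def)

lemma fun_subspace_S0_ring: "fun_vs.subspace (S0_ring (int n) z)"
proof (rule fun_subspaceI)
  have "crot z (\<lambda>x. 0) = (\<lambda>x. 0)"
    using crot_scale[OF fun_subspaceD(1)[OF fun_subspace_C1[of n]], of 0] by simp
  then show "(\<lambda>x. 0) \<in> S0_ring (int n) z"
    using fun_subspaceD(1)[OF fun_subspace_C1[of n]] by (simp add: S0_ring_iff)
qed (use fun_subspaceD(2,3)[OF fun_subspace_C1[of n]] in \<open>auto simp: S0_ring_iff crot_add[where n = n]
    crot_scale[where n = n]\<close>)

lemma L2_ring_iff:
  "q \<in> L2_ring (int n) z \<longleftrightarrow> q \<in> CP n \<and> (\<forall>x\<in>frontier (triangle z). q x = 0) \<and> integral (triangle z) q = 0"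
  by (auto simp: L2_ring_def CP_def)

lemma integrable_on_triangle: "continuous_on (triangle z) f \<Longrightarrow> f integrable_on triangle z"
  for f :: "R2 \<Rightarrow> real"
  using borel_integrable_compact[OF compact_triangle]
  by (intro set_borel_integral_eq_integral(1)) (simp only: set_integrable_def)

lemma fun_subspace_L2_ring: "fun_vs.subspace (L2_ring (int n) z)"
proof (rule fun_subspaceI)
  show "(\<lambda>x. 0) \<in> L2_ring (int n) z" by (simp add: L2_ring_iff CP_zero)
qed (auto simp: L2_ring_iff CP_add CP_cmul integral_add integrable_on_triangle CP_continuous)

end

section \<open>Coefficients in local coordinates\<close>

text \<open>Twice the cardinality is given in order to avoid division of natural numbers.\<close>

lemma card_tri: "2 * card (tri n) = (n + 1) * (n + 2)"
proof -
  have "card (tri n) = (\<Sum>i\<le>n. Suc (n - i))"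
    using sum_tri[of "\<lambda>_. 1::nat" n] by simp
  also have "\<dots> = (\<Sum>i\<le>n. Suc i)"
    using sum.nat_diff_reindex[of "\<lambda>i. Suc i" "Suc n"] by (simp add: lessThan_Suc_atMost)
  also have "2 * \<dots> = (n + 1) * (n + 2)" by (induction n) auto
  finally show ?thesis .
qed

text \<open>Exponents of polynomials divisible by the monomial with exponents \<open>p\<close> and
  \<open>q\<close>. The basis of the continuous functions uses \<open>(1, 0)\<close>, the bound for
  the stream functions uses \<open>(2, 2)\<close>.\<close>

definition tri_from :: "nat \<Rightarrow> nat \<Rightarrow> nat \<Rightarrow> (nat \<times> nat) set" where
  "tri_from p q n = {(a, b). p \<le> a \<and> q \<le> b \<and> a + b \<le> n}"

lemma finite_tri_from: "finite (tri_from p q n)"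
  by (rule finite_subset[of _ "tri n"]) (auto simp: tri_from_def, simp add: tri_def)

lemma card_tri_from:
  "2 * card (tri_from p q n) = (if p + q \<le> n then (n - p - q + 1) * (n - p - q + 2) else 0)"
proof (cases "p + q \<le> n")
  case True
  have "tri_from p q n = (\<lambda>(a, b). (a + p, b + q)) ` tri (n - p - q)"
  proof (intro set_eqI iffI)
    fix y assume "y \<in> tri_from p q n"
    then show "y \<in> (\<lambda>(a, b). (a + p, b + q)) ` tri (n - p - q)"
      using True by (intro image_eqI[of _ _ "(fst y - p, snd y - q)"]) (auto simp: tri_from_def tri_def)
  qed (use True in \<open>auto simp: tri_from_def tri_def\<close>)
  moreover have "inj_on (\<lambda>(a, b). (a + p, b + q)) (tri (n - p - q))" by (auto simp: inj_on_def)
  ultimately show ?thesis using True card_tri[of "n - p - q"] by (simp add: card_image)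
next
  case False
  then have "tri_from p q n = {}" by (auto simp: tri_from_def)
  then show ?thesis using False by simp
qed

lemma bpoly_at_fst_0:
  assumes "p \<in> bpoly n" shows "p (0, t) = (\<Sum>b\<le>n. bcoeff p 0 b * t ^ b)"
proof -
  have "p (0, t) = (\<Sum>i\<le>n. \<Sum>j\<le>n-i. bcoeff p i j * 0 ^ i * t ^ j)"
    using bpoly_expand[OF assms, of "(0, t)"] by (simp add: sum_tri)
  also have "\<dots> = (\<Sum>i\<le>n. if i = 0 then \<Sum>j\<le>n. bcoeff p 0 j * t ^ j else 0)"
    by (intro sum.cong refl) (simp add: power_0_left)
  finally show ?thesis by simp
qed

lemma bpoly_at_snd_0:
  assumes "p \<in> bpoly n" shows "p (s, 0) = (\<Sum>a\<le>n. bcoeff p a 0 * s ^ a)"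
proof -
  have "p (s, 0) = (\<Sum>i\<le>n. \<Sum>j\<le>n-i. bcoeff p i j * s ^ i * 0 ^ j)"
    using bpoly_expand[OF assms, of "(s, 0)"] by (simp add: sum_tri)
  also have "\<dots> = (\<Sum>i\<le>n. \<Sum>j\<le>n-i. if j = 0 then bcoeff p i 0 * s ^ i else 0)"
    by (intro sum.cong refl) (simp add: power_0_left)
  finally show ?thesis by simp
qed

lemma bcoeff_const_0 [simp]: "bcoeff (\<lambda>x. 0) i j = 0"
  using bcoeff_eq_0[of "\<lambda>x. 0" 0 i j] bcoeff_cmul[of "\<lambda>x. 0" 0 0 i j] by simp

lemma bcoeff_dirD_fst:
  assumes "p \<in> bpoly n"
  shows "bcoeff (dirD (1, 0) p) a b = real (a + 1) * bcoeff p (a + 1) b"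
proof -
  \<comment> \<open>With the larger degree bound \<open>Suc n\<close> the index shift caused by the
    derivative works uniformly, including \<open>n = 0\<close>.\<close>
  have p: "p \<in> bpoly (Suc n)" using assms bpoly_mono le_SucI by blast
  have "bcoeff (dirD (1, 0) p) a b = (if a + b \<le> n then real (a + 1) * bcoeff p (a + 1) b else 0)"
  proof (rule bcoeff_unique[OF _ dirD_bpoly[OF assms]])
    fix s t :: real
    have "dirD (1, 0) p (s, t) = (\<Sum>i\<le>Suc n. \<Sum>j\<le>Suc n - i. bcoeff p i j * (real i * s ^ (i - 1) * t ^ j))"
      by (simp add: dirD_coeffs[OF p] sum_tri)
    also have "\<dots> = (\<Sum>i\<le>n. \<Sum>j\<le>n - i. bcoeff p (Suc i) j * (real (Suc i) * s ^ i * t ^ j))"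
      by (subst sum.atMost_Suc_shift) simp
    finally show "dirD (1, 0) p (s, t) = (\<Sum>(i, j)\<in>tri n. real (i + 1) * bcoeff p (i + 1) j * s ^ i * t ^ j)"
      by (simp add: sum_tri mult_ac)
  qed
  then show ?thesis using bcoeff_eq_0[OF assms, of "a + 1" b] by auto
qed

lemma bcoeff_dirD_snd:
  assumes "p \<in> bpoly n"
  shows "bcoeff (dirD (0, 1) p) a b = real (b + 1) * bcoeff p a (b + 1)"
proof -
  have p: "p \<in> bpoly (Suc n)" using assms bpoly_mono le_SucI by blast
  have "bcoeff (dirD (0, 1) p) a b = (if a + b \<le> n then real (b + 1) * bcoeff p a (b + 1) else 0)"
  proof (rule bcoeff_unique[OF _ dirD_bpoly[OF assms]])
    fix s t :: real
    have "dirD (0, 1) p (s, t) = (\<Sum>i\<le>Suc n. \<Sum>j\<le>Suc n - i. bcoeff p i j * (s ^ i * (real j * t ^ (j - 1))))"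
      by (simp add: dirD_coeffs[OF p] sum_tri)
    also have "\<dots> = (\<Sum>i\<le>n. \<Sum>j\<le>Suc n - i. bcoeff p i j * (s ^ i * (real j * t ^ (j - 1))))"
      by simp
    also have "\<dots> = (\<Sum>i\<le>n. \<Sum>j\<le>n - i. bcoeff p i (Suc j) * (s ^ i * (real (Suc j) * t ^ j)))"
    proof (rule sum.cong[OF refl])
      fix i assume "i \<in> {..n}"
      then have e: "Suc n - i = Suc (n - i)" by auto
      show "(\<Sum>j\<le>Suc n - i. bcoeff p i j * (s ^ i * (real j * t ^ (j - 1)))) = (\<Sum>j\<le>n - i. bcoeff p i (Suc j)
          * (s ^ i * (real (Suc j) * t ^ j)))"
        unfolding e by (subst sum.atMost_Suc_shift) simp
    qed
    finally show "dirD (0, 1) p (s, t) = (\<Sum>(i, j)\<in>tri n. real (j + 1) * bcoeff p i (j + 1) * s ^ i * t ^ j)"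
      by (simp add: sum_tri mult_ac)
  qed
  then show ?thesis using bcoeff_eq_0[OF assms, of a "b + 1"] by auto
qed

lemma poly_sums_eq:
  fixes c d :: "nat \<Rightarrow> real"
  assumes "\<And>x. 0 < x \<Longrightarrow> x < 1 \<Longrightarrow> (\<Sum>i\<le>n. c i * x ^ i) = (\<Sum>i\<le>n. d i * x ^ i)" "i \<le> n"
  shows "c i = d i"
proof -
  have "(\<Sum>i\<le>n. (c i - d i) * x ^ i) = 0" if "0 < x" "x < 1" for x
    using assms(1)[OF that] by (simp add: left_diff_distrib sum_subtractf)
  from poly_sum_eq_0[where a = 0 and b = 1 and n = n and c = "\<lambda>i. c i - d i", OF _ this assms(2)]
  have "c i - d i = 0" by simp
  then show ?thesis by simp
qed

text \<open>Dividing by \<open>m ^ l\<close> and letting \<open>m\<close> tend to 0 leaves the terms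
  of order exactly \<open>l\<close>, where every power of \<open>1 - m\<close> becomes 1. In the
  boundary frame introduced below, the line \<open>t = 1 - m\<close> is the spoke to an edge
  point.\<close>

lemma lowest_order_sum:
  fixes e :: "nat \<Rightarrow> nat \<Rightarrow> real"
  assumes "\<And>m. 0 < m \<Longrightarrow> m < 1 \<Longrightarrow> (\<Sum>(a, b)\<in>tri n. e a b * m ^ a * (1 - m) ^ b) = 0"
    and "\<And>a b. a < l \<Longrightarrow> e a b = 0" and "\<And>a b. n < a + b \<Longrightarrow> e a b = 0"
  shows "(\<Sum>b\<le>n. e l b) = 0"
proof -
  define g where "g = (\<lambda>m::real. \<Sum>(a, b)\<in>tri n. e a b * m ^ (a - l) * (1 - m) ^ b)"
  have eq: "e a b * m ^ a * (1 - m) ^ b = m ^ l * (e a b * m ^ (a - l) * (1 - m) ^ b)" for a b and m :: real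
  proof (cases "a < l")
    case True then show ?thesis by (simp add: assms(2))
  next
    case False
    then have "m ^ a = m ^ l * m ^ (a - l)" by (simp add: power_add[symmetric])
    then show ?thesis by simp
  qed
  have g0: "g m = 0" if "m \<in> {0<..<1}" for m
  proof -
    have "m ^ l * g m = (\<Sum>(a, b)\<in>tri n. e a b * m ^ a * (1 - m) ^ b)"
      unfolding g_def sum_distrib_left case_prod_beta by (intro sum.cong refl eq[symmetric])
    also have "\<dots> = 0" using assms(1) that by simp
    finally show ?thesis using that by simp
  qed
  have "continuous_on (closure {0<..<1}) g"
    unfolding g_def case_prod_beta by (intro continuous_intros)
  then have "g 0 = 0"
    by (rule continuous_constant_on_closure[OF _ g0]) simp_all
  moreover have "g 0 = (\<Sum>a\<le>n. \<Sum>b\<le>n-a. if a = l then e l b else 0)"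
    unfolding g_def sum_tri
  proof (intro sum.cong refl)
    fix a b show "(case (a, b) of (a, b) \<Rightarrow> e a b * 0 ^ (a - l) * (1 - 0) ^ b) = (if a = l then e l b else 0)"
      using assms(2)[of a b] by (cases a l rule: linorder_cases) auto
  qed
  moreover have "\<dots> = (\<Sum>a\<le>n. if a = l then \<Sum>b\<le>n-l. e l b else 0)"
    by (intro sum.cong) auto
  moreover have "\<dots> = (\<Sum>b\<le>n. e l b)"
  proof (cases "l \<le> n")
    case True
    then have "(\<Sum>a\<le>n. if a = l then \<Sum>b\<le>n-l. e l b else 0) = (\<Sum>b\<le>n-l. e l b)" by simp
    also have "\<dots> = (\<Sum>b\<le>n. e l b)"
      by (rule sum.mono_neutral_left) (auto intro: assms(3))
    finally show ?thesis .
  next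
    case False
    then show ?thesis using assms(3) by simp
  qed
  ultimately show ?thesis by simp
qed

lemma Suc_mod_6: "j < 6 \<Longrightarrow> Suc j mod 6 = (if j = 5 then 0 else Suc j)"
  by auto

context ps_config
begin

section \<open>Matching of coefficients across spokes\<close>

abbreviation lc :: "nat \<Rightarrow> R2 \<Rightarrow> R2" where "lc j \<equiv> acoord (z 0) (u j) (u (Suc j))"

lemma lc_E [simp]: "lc j (E j y) = y" and E_lc [simp]: "E j (lc j x) = x"
  using cross_u_Suc[of j] by (simp_all add: E_def)

lemma E_spoke: "E j (0, t) = z 0 + t *\<^sub>R u (Suc j)" "E (Suc j mod 6) (t, 0) = z 0 + t *\<^sub>R u (Suc j)"
  by (simp_all add: E_eq u_mod(1)[of "Suc j"])

lemma bpoly_comp_E: "p \<in> bpoly n \<Longrightarrow> (\<lambda>y. p (E j y)) \<in> bpoly n"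
  unfolding E_def by (rule bpoly_comp_aff)

text \<open>Coefficients in the spoke frame: exponents \<open>(a, 0)\<close> belong to the trace on
  spoke \<open>j\<close>, exponents \<open>(0, b)\<close> to the trace on spoke
  \<open>Suc j\<close>.\<close>

definition eC :: "nat \<Rightarrow> (R2 \<Rightarrow> real) \<Rightarrow> nat \<Rightarrow> nat \<Rightarrow> real" where
  "eC j p = bcoeff (\<lambda>y. p (E j y))"

lemma eC_add: "p \<in> bpoly m \<Longrightarrow> q \<in> bpoly n \<Longrightarrow> eC j (\<lambda>x. p x + q x) a b = eC j p a b + eC j q a b"
  unfolding eC_def by (rule bcoeff_add[OF bpoly_comp_E bpoly_comp_E])

lemma eC_cmul: "p \<in> bpoly m \<Longrightarrow> eC j (\<lambda>x. k * p x) a b = k * eC j p a b"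
  unfolding eC_def by (rule bcoeff_cmul[OF bpoly_comp_E])

lemma eC_eq_0: "p \<in> bpoly n \<Longrightarrow> n < a + b \<Longrightarrow> eC j p a b = 0"
  unfolding eC_def by (rule bcoeff_eq_0[OF bpoly_comp_E])

lemma eC_spoke_out: "p \<in> bpoly n \<Longrightarrow> p (z 0 + t *\<^sub>R u (Suc j)) = (\<Sum>b\<le>n. eC j p 0 b * t ^ b)"
  using bpoly_at_fst_0[OF bpoly_comp_E, of p n j t] by (simp add: eC_def E_spoke)

lemma eC_spoke_in: "p \<in> bpoly n \<Longrightarrow> p (z 0 + t *\<^sub>R u (Suc j)) = (\<Sum>a\<le>n. eC (Suc j mod 6) p a 0 * t ^ a)"
  using bpoly_at_snd_0[OF bpoly_comp_E, of p n "Suc j mod 6" t] by (simp add: eC_def E_spoke)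

lemma eC_center: "p \<in> bpoly n \<Longrightarrow> eC j p 0 0 = p (z 0)"
  using eC_spoke_out[of p n 0 j] by (simp add: zero_power power_0_left if_distrib sum.delta cong: if_cong)

lemma eC_all_0:
  assumes "p \<in> bpoly n" "\<And>a b. a + b \<le> n \<Longrightarrow> eC j p a b = 0"
  shows "p = (\<lambda>x. 0)"
proof
  fix x
  have "p (E j (lc j x)) = (\<Sum>(a, b)\<in>tri n. eC j p a b * fst (lc j x) ^ a * snd (lc j x) ^ b)"
    unfolding eC_def by (rule bpoly_expand[OF bpoly_comp_E[OF assms(1)]])
  also have "\<dots> = 0" by (intro sum.neutral) (use assms(2) in \<open>auto simp: tri_def\<close>)
  finally show "p x = 0" by simp
qed

lemma pc_spoke:
  assumes "f \<in> CP n" "j < 6" "0 \<le> t" "t \<le> 1"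
  shows "pc j f (z 0 + t *\<^sub>R u (Suc j)) = pc (Suc j mod 6) f (z 0 + t *\<^sub>R u (Suc j))"
proof -
  let ?x = "z 0 + t *\<^sub>R u (Suc j)"
  have "?x \<in> tri_ps z j" "?x \<in> tri_ps z (Suc j)" using spoke_in_tri_ps assms by auto
  then have "?x \<in> tri_ps z j" "?x \<in> tri_ps z (Suc j mod 6)" by (simp_all only: tri_ps_mod)
  then show ?thesis using pc_eq[OF assms(1)] by metis
qed

lemma eC_spoke_eq:
  assumes "p \<in> bpoly n" "q \<in> bpoly n"
    "\<And>t. 0 < t \<Longrightarrow> t < 1 \<Longrightarrow> p (z 0 + t *\<^sub>R u (Suc j)) = q (z 0 + t *\<^sub>R u (Suc j))"
  shows "eC j p 0 b = eC (Suc j mod 6) q b 0"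
proof (cases "b \<le> n")
  case True
  then show ?thesis
    by (intro poly_sums_eq[where n = n and c = "eC j p 0" and d = "\<lambda>b. eC (Suc j mod 6) q b 0"])
      (use assms eC_spoke_out eC_spoke_in in metis)+
next
  case False
  then show ?thesis using eC_eq_0[OF assms(1)] eC_eq_0[OF assms(2)] by simp
qed

section \<open>A basis of the continuous piecewise polynomials\<close>

lemma CP_glue_spokes:
  assumes "\<And>j. j < 6 \<Longrightarrow> Q j \<in> bpoly n"
    "\<And>j t. j < 6 \<Longrightarrow> 0 \<le> t \<Longrightarrow> t \<le> 1 \<Longrightarrow> Q j (z 0 + t *\<^sub>R u (Suc j)) = Q (Suc j mod 6) (z 0 + t *\<^sub>R u (Suc j))"
  obtains f where "f \<in> CP n" "\<And>j. j < 6 \<Longrightarrow> pc j f = Q j"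
  using CP_glue[of Q n] assms spokes_agree[of Q] by metis

text \<open>The nodal hat function of the hexagon point \<open>j\<close> as seen from triangle
  \<open>i\<close>: the coordinate along spoke \<open>j\<close> in the two triangles that contain
  this spoke, zero in the other four.\<close>

definition hat_loc :: "nat \<Rightarrow> nat \<Rightarrow> R2 \<Rightarrow> real" where
  "hat_loc j i y = (if i = j then fst y else if Suc i mod 6 = j then snd y else 0)"

lemma hat_exists:
  assumes "j < 6"
  shows "\<exists>f\<in>CP 1. \<forall>i<6. pc i f = (\<lambda>x. hat_loc j i (lc i x))"
proof -
  have "(\<lambda>x. hat_loc j i (lc i x)) \<in> bpoly 1" for i
    unfolding hat_loc_def
    by (cases "i = j"; cases "Suc i mod 6 = j") (simp_all del: One_nat_def add: bpoly_fst_acoord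
        bpoly_snd_acoord)
  moreover have "hat_loc j i (lc i (z 0 + t *\<^sub>R u (Suc i))) = hat_loc j (Suc i mod 6) (lc (Suc i mod 6) (z 0
      + t *\<^sub>R u (Suc i)))"
    if i: "i < 6" for i t
  proof -
    have "lc i (z 0 + t *\<^sub>R u (Suc i)) = (0, t)" by (simp only: E_spoke(1)[symmetric] lc_E)
    moreover have "lc (Suc i mod 6) (z 0 + t *\<^sub>R u (Suc i)) = (t, 0)" by (simp only: E_spoke(2)[symmetric] lc_E)
    moreover have "i = j \<Longrightarrow> Suc i mod 6 \<noteq> j" using i by (simp add: Suc_mod_6)
    ultimately show ?thesis by (auto simp: hat_loc_def)
  qed
  ultimately show ?thesis
    using CP_glue_spokes[of "\<lambda>i x. hat_loc j i (lc i x)" 1] by metis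
qed

definition hat :: "nat \<Rightarrow> R2 \<Rightarrow> real" where
  "hat j = (SOME f. f \<in> CP 1 \<and> (\<forall>i<6. pc i f = (\<lambda>x. hat_loc j i (lc i x))))"

lemma hat: "j < 6 \<Longrightarrow> hat j \<in> CP 1 \<and> (\<forall>i<6. pc i (hat j) = (\<lambda>x. hat_loc j i (lc i x)))"
  unfolding hat_def using hat_exists by (intro someI_ex[of "\<lambda>f. f \<in> CP 1 \<and> _ f"]) auto

text \<open>In triangle \<open>j\<close> the product reduces to the local monomial with exponents
  \<open>(a, b)\<close>. With \<open>1 \<le> a\<close> each spoke monomial is listed once, by the
  triangle in which the spoke is the first axis; the constant \<open>None\<close> completes the
  list.\<close>

definition CP_basis :: "(nat \<times> nat \<times> nat) option \<Rightarrow> R2 \<Rightarrow> real" where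
  "CP_basis i = (case i of None \<Rightarrow> (\<lambda>x. if x \<in> triangle z then 1 else 0)
     | Some (j, a, b) \<Rightarrow> (\<lambda>x. hat j x ^ a * hat (Suc j mod 6) x ^ b))"

definition CP_index :: "nat \<Rightarrow> (nat \<times> nat \<times> nat) option set" where
  "CP_index m = insert None (Some ` ({..<6} \<times> tri_from 1 0 m))"

definition CP_coeff :: "(nat \<times> nat \<times> nat) option \<Rightarrow> (R2 \<Rightarrow> real) \<Rightarrow> real" where
  "CP_coeff i f = (case i of None \<Rightarrow> eC 0 (pc 0 f) 0 0 | Some (j, a, b) \<Rightarrow> eC j (pc j f) a b)"

lemma CP_basis_Some:
  assumes "j < 6" "1 \<le> a" "a + b \<le> m"
  shows "CP_basis (Some (j, a, b)) \<in> CP m"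
    "i < 6 \<Longrightarrow> pc i (CP_basis (Some (j, a, b))) = (\<lambda>x. hat_loc j i (lc i x) ^ a * hat_loc (Suc j mod 6) i (lc
        i x) ^ b)"
proof -
  have j': "Suc j mod 6 < 6" by simp
  note h = hat[OF assms(1)] hat[OF j']
  let ?P = "\<lambda>i x. hat_loc j i (lc i x) ^ a * hat_loc (Suc j mod 6) i (lc i x) ^ b"
  have P: "?P i \<in> bpoly m" if i: "i < 6" for i
  proof (rule bpoly_mono[OF assms(3)])
    have "(\<lambda>x. hat_loc j i (lc i x) ^ a) \<in> bpoly a"
      using bpoly_power[OF pc_bpoly[of "hat j" 1 i], of a] h i by simp
    moreover have "(\<lambda>x. hat_loc (Suc j mod 6) i (lc i x) ^ b) \<in> bpoly b"
      using bpoly_power[OF pc_bpoly[of "hat (Suc j mod 6)" 1 i], of b] h i by simp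
    ultimately show "?P i \<in> bpoly (a + b)" by (rule bpoly_mult)
  qed
  have eq: "CP_basis (Some (j, a, b)) x = ?P i x" if "i < 6" "x \<in> tri_ps z i" for i x
    using pc_eq[of "hat j" 1 x i] pc_eq[of "hat (Suc j mod 6)" 1 x i] h that by (simp add: CP_basis_def)
  show "CP_basis (Some (j, a, b)) \<in> CP m"
    unfolding CP_iff
  proof (intro conjI allI impI)
    fix x assume "x \<notin> triangle z"
    then show "CP_basis (Some (j, a, b)) x = 0" using CP_outside[of "hat j" 1 x] h assms(2) by (simp add:
        CP_basis_def)
  next
    fix i :: nat assume "i < 6"
    then show "\<exists>p\<in>bpoly m. \<forall>x\<in>tri_ps z i. CP_basis (Some (j, a, b)) x = p x"
      using P[of i] eq[of i] by (intro bexI[of _ "?P i"]) auto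
  qed
  show "i < 6 \<Longrightarrow> pc i (CP_basis (Some (j, a, b))) = ?P i" using P eq by (intro pc_eqI) auto
qed

lemma CP_basis_None:
  shows "CP_basis None \<in> CP m" "pc i (CP_basis None) = (\<lambda>x. 1)"
proof -
  have "CP_basis None x = 1" if "x \<in> tri_ps z i" for x i using that tri_ps_subset by (auto simp: CP_basis_def)
  then show "CP_basis None \<in> CP m" "pc i (CP_basis None) = (\<lambda>x. 1)"
    by (auto simp: CP_iff CP_basis_def intro!: pc_eqI[of _ 0] bexI[of _ "\<lambda>x. 1"])
qed

lemma CP_coeff_basis_Some:
  assumes "j < 6" "1 \<le> a" "i < 6"
  shows "eC i (pc i (CP_basis (Some (j, a, b)))) a' b' =
    (if i = j then if a' = a \<and> b' = b then 1 else 0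
     else if Suc i mod 6 = j \<and> b = 0 \<and> a' = 0 \<and> b' = a then 1 else 0)"
proof -
  have 1: "eC i (pc i (CP_basis (Some (j, a, b)))) a' b' = bcoeff (\<lambda>y. hat_loc j i y ^ a * hat_loc (Suc j
      mod 6) i y ^ b) a' b'"
    unfolding eC_def CP_basis_Some(2)[OF assms(1,2) order_refl assms(3)] by simp
  consider "i = j" | "i \<noteq> j" "Suc i mod 6 = j" | "i \<noteq> j" "Suc i mod 6 \<noteq> j" by blast
  then show ?thesis
  proof cases
    case 1
    then have "Suc j mod 6 \<noteq> i" using assms by (simp add: Suc_mod_6)
    then show ?thesis using \<open>eC i _ a' b' = _\<close> 1 bcoeff_monom[of a b a' b'] by (simp add: hat_loc_def)
  next
    case 2
    then have "i \<noteq> Suc j mod 6" "Suc i mod 6 \<noteq> Suc j mod 6" using assms by (auto simp: Suc_mod_6 split: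
        if_splits)
    then show ?thesis using \<open>eC i _ a' b' = _\<close> 2 bcoeff_monom[of 0 a a' b'] assms(2) by (cases "b = 0")
        (auto simp: hat_loc_def power_0_left)
  next
    case 3
    then show ?thesis using \<open>eC i _ a' b' = _\<close> assms(2) by (simp add: hat_loc_def power_0_left)
  qed
qed

lemma linear_eC: "linear_functional_on (CP m) (\<lambda>f. eC j (pc j f) a b)"
proof (rule linear_functional_onI)
  fix f g assume "f \<in> CP m" "g \<in> CP m"
  then show "eC j (pc j (\<lambda>x. f x + g x)) a b = eC j (pc j f) a b + eC j (pc j g) a b"
    using pc_add[of f m g m j] eC_add[OF pc_bpoly pc_bpoly] by simp
next
  fix c f assume "f \<in> CP m"
  then show "eC j (pc j (\<lambda>x. c *\<^sub>R f x)) a b = c * eC j (pc j f) a b"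
    using pc_cmul[of f m j c] eC_cmul[OF pc_bpoly] by simp
qed

text \<open>Reading off the listed coefficients of the listed products gives the identity matrix.
  Besides the constant, each of the six triangles contributes \<open>m * (m + 1) div 2\<close>
  exponents.\<close>

lemma has_dim_CP: "has_dim (CP m) (3 * m * (m + 1) + 1)"
proof -
  have fin: "finite (CP_index m)" by (simp add: CP_index_def finite_tri_from)
  have "has_dim (CP m) (card (CP_index m))"
  proof (rule has_dim_biorthogonal[OF fin fun_subspace_CP, where F = CP_coeff and b = CP_basis])
    fix i assume "i \<in> CP_index m"
    show "linear_functional_on (CP m) (CP_coeff i)"
      using linear_eC by (cases i) (auto simp: CP_coeff_def[abs_def])
    show "CP_basis i \<in> CP m"
      using \<open>i \<in> CP_index m\<close> CP_basis_None CP_basis_Some(1) by (auto simp: CP_index_def tri_from_def)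
  next
    fix i j assume ij: "i \<in> CP_index m" "j \<in> CP_index m"
    show "CP_coeff i (CP_basis j) = (if i = j then 1 else 0)"
    proof (cases j)
      case None
      have "eC k (\<lambda>x. 1) a b = (if a = 0 \<and> b = 0 then 1 else 0)" for k a b
        using bcoeff_monom[of 0 0 a b] by (simp add: eC_def)
      then show ?thesis using None ij by (cases i) (auto simp: CP_coeff_def CP_basis_None CP_index_def
          tri_from_def)
    next
      case (Some y)
      obtain j' a b where y: "y = (j', a, b)" by (cases y)
      then have "j' < 6" "1 \<le> a" using ij Some by (auto simp: CP_index_def tri_from_def)
      note c = CP_coeff_basis_Some[OF this]
      show ?thesis using ij(1) Some y \<open>1 \<le> a\<close>
        by (cases i) (auto simp: CP_coeff_def c CP_index_def tri_from_def split: if_splits)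
    qed
  next
    fix f assume f: "f \<in> CP m" "\<And>i. i \<in> CP_index m \<Longrightarrow> CP_coeff i f = 0"
    have z: "f (z 0) = 0"
      using f(2)[of None] eC_center[OF pc_bpoly[OF f(1)], of 0 0] pc_eq[OF f(1) center_in_tri_ps, of 0]
      by (simp add: CP_index_def CP_coeff_def)
    have a: "eC j (pc j f) a b = 0" if "j < 6" "1 \<le> a" "a + b \<le> m" for j a b
      using f(2)[of "Some (j, a, b)"] that by (auto simp: CP_index_def CP_coeff_def tri_from_def)
    have "eC j (pc j f) a b = 0" if "j < 6" "a + b \<le> m" for j a b
    proof (cases "a = 0")
      case True
      show ?thesis
      proof (cases "b = 0")
        case True
        then show ?thesis using \<open>a = 0\<close> eC_center[OF pc_bpoly[OF f(1)], of j j] pc_eq[OF f(1)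
            center_in_tri_ps, of j] z by simp
      next
        case False
        \<comment> \<open>A coefficient on the second axis is a coefficient on the first axis of the
          next triangle, where it is already known to vanish.\<close>
        have "eC j (pc j f) 0 b = eC (Suc j mod 6) (pc (Suc j mod 6) f) b 0"
          by (rule eC_spoke_eq[OF pc_bpoly[OF f(1)] pc_bpoly[OF f(1)]]) (use pc_spoke[OF f(1) that(1)] in auto)
        then show ?thesis using a[of "Suc j mod 6" b 0] False True that by simp
      qed
    qed (use a that in auto)
    then have "pc j f = (\<lambda>x. 0)" if "j < 6" for j using eC_all_0[OF pc_bpoly[OF f(1)]] that by blast
    then show "f = (\<lambda>x. 0)" by (intro CP_eqI[OF f(1) CP_zero]) (simp add: pc_zero)
  qed
  moreover have "card (CP_index m) = 3 * m * (m + 1) + 1"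
  proof -
    have "card (CP_index m) = Suc (6 * card (tri_from 1 0 m))"
      unfolding CP_index_def by (subst card_insert_disjoint) (auto simp: finite_tri_from card_image
          card_cartesian_product)
    moreover have "2 * card (tri_from 1 0 m) = m * (m + 1)"
      using card_tri_from[of 1 0 m] by (cases m) auto
    then have "6 * card (tri_from 1 0 m) = 3 * (m * (m + 1))" by linarith
    ultimately show ?thesis by (simp add: mult.assoc)
  qed
  ultimately show ?thesis by simp
qed

end

section \<open>Dimension estimates\<close>

context ps_config
begin

section \<open>The boundary frame and bounds for the stream functions\<close>

definition corner :: "nat \<Rightarrow> nat" where "corner j = (if even j then j else Suc j)"
definition midpt :: "nat \<Rightarrow> nat" where "midpt j = (if even j then Suc j else j)"

text \<open>The frame of the triangle \<open>tri_ps z j\<close> in which the first coordinate is the hat function of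
  the centre and the second one measures the distance from the corner along the boundary.\<close>

definition Bo :: "nat \<Rightarrow> R2" where "Bo j = hex z (corner j)"
definition Bv :: "nat \<Rightarrow> R2" where "Bv j = z 0 - hex z (corner j)"
definition Bw :: "nat \<Rightarrow> R2" where "Bw j = hex z (midpt j) - hex z (corner j)"
definition B :: "nat \<Rightarrow> R2 \<Rightarrow> R2" where "B j = aff (Bo j) (Bv j) (Bw j)"

lemma B_eq: "B j y = Bo j + fst y *\<^sub>R Bv j + snd y *\<^sub>R Bw j"
  by (simp add: B_def aff_def)

lemma B_E: "B j (m, t) = E j (if even j then (1 - m - t, t) else (t, 1 - m - t))"
  by (simp add: B_eq E_eq Bo_def Bv_def Bw_def corner_def midpt_def u_def algebra_simps)

lemma cross_B: "cross (Bv j) (Bw j) \<noteq> 0"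
proof -
  have "Bv j = - u (corner j)" "Bw j = u (midpt j) - u (corner j)"
    by (simp_all add: Bv_def Bw_def u_def)
  then show ?thesis using cross_u_Suc[of j] cross_commute[of "u (Suc j)" "u j"]
    by (auto simp: corner_def midpt_def)
qed

abbreviation bc :: "nat \<Rightarrow> R2 \<Rightarrow> R2" where "bc j \<equiv> acoord (Bo j) (Bv j) (Bw j)"

lemma bc_B [simp]: "bc j (B j y) = y" and B_bc [simp]: "B j (bc j x) = x"
  using cross_B[of j] by (simp_all add: B_def)

lemma B_in_tri_ps: "0 \<le> m \<Longrightarrow> 0 \<le> t \<Longrightarrow> m + t \<le> 1 \<Longrightarrow> B j (m, t) \<in> tri_ps z j"
  unfolding B_E by (auto intro: E_in_tri_ps)

lemma bpoly_comp_B: "p \<in> bpoly n \<Longrightarrow> (\<lambda>y. p (B j y)) \<in> bpoly n"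
  unfolding B_def by (rule bpoly_comp_aff)

definition bC :: "nat \<Rightarrow> (R2 \<Rightarrow> real) \<Rightarrow> nat \<Rightarrow> nat \<Rightarrow> real" where
  "bC j p = bcoeff (\<lambda>y. p (B j y))"

lemma bC_add: "p \<in> bpoly m \<Longrightarrow> q \<in> bpoly n \<Longrightarrow> bC j (\<lambda>x. p x + q x) a b = bC j p a b + bC j q a b"
  unfolding bC_def by (rule bcoeff_add[OF bpoly_comp_B bpoly_comp_B])

lemma bC_cmul: "p \<in> bpoly m \<Longrightarrow> bC j (\<lambda>x. k * p x) a b = k * bC j p a b"
  unfolding bC_def by (rule bcoeff_cmul[OF bpoly_comp_B])

lemma bC_eq_0: "p \<in> bpoly n \<Longrightarrow> n < a + b \<Longrightarrow> bC j p a b = 0"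
  unfolding bC_def by (rule bcoeff_eq_0[OF bpoly_comp_B])

lemma bC_expand: "p \<in> bpoly n \<Longrightarrow> p (B j (m, t)) = (\<Sum>(a, b)\<in>tri n. bC j p a b * m ^ a * t ^ b)"
  unfolding bC_def using bpoly_expand[OF bpoly_comp_B, of p n j "(m, t)"] by simp

lemma bC_all_0:
  assumes "p \<in> bpoly n" "\<And>a b. bC j p a b = 0"
  shows "p = (\<lambda>x. 0)"
proof
  fix x
  have "p (B j (fst (bc j x), snd (bc j x))) = 0"
    unfolding bC_expand[OF assms(1)] by (intro sum.neutral) (simp add: assms(2) case_prod_beta)
  then show "p x = 0" by simp
qed

lemma dirD_B:
  assumes "p \<in> bpoly n"
  shows "dirD (Bv j) p (B j y) = dirD (1, 0) (\<lambda>y. p (B j y)) y" "dirD (Bw j) p (B j y) = dirD (0, 1) (\<lambda>y. p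
      (B j y)) y"
  unfolding B_def by (simp_all add: dirD_comp_aff[OF assms])

lemma bC_dirD:
  assumes "p \<in> bpoly n"
  shows "bC j (dirD (Bv j) p) a b = real (a + 1) * bC j p (a + 1) b" "bC j (dirD (Bw j) p) a b = real (b +
      1) * bC j p a (b + 1)"
  unfolding bC_def dirD_B[OF assms]
  using bcoeff_dirD_fst[OF bpoly_comp_B[OF assms]] bcoeff_dirD_snd[OF bpoly_comp_B[OF assms]] by simp_all

lemma B_outer: "0 \<le> t \<Longrightarrow> t \<le> 1 \<Longrightarrow> j < 6 \<Longrightarrow> B j (0, t) \<in> frontier (triangle z)"
proof -
  assume t: "0 \<le> t" "t \<le> 1" "j < 6"
  have "B j (0, t) \<in> closed_segment (hex z j) (hex z (Suc j))"
  proof (cases "even j")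
    case True
    then have "B j (0, t) = (1 - t) *\<^sub>R hex z j + t *\<^sub>R hex z (Suc j)"
      by (simp add: B_eq Bo_def Bw_def corner_def midpt_def algebra_simps)
    then show ?thesis using t unfolding in_segment by blast
  next
    case False
    then have "B j (0, t) = (1 - (1 - t)) *\<^sub>R hex z j + (1 - t) *\<^sub>R hex z (Suc j)"
      by (simp add: B_eq Bo_def Bw_def corner_def midpt_def algebra_simps)
    then show ?thesis using t unfolding in_segment by (metis diff_ge_0_iff_ge diff_le_eq le_add_same_cancel1)
  qed
  then show ?thesis using t(3) unfolding frontier_triangle by blast
qed

lemma bC_spoke_corner:
  "p \<in> bpoly n \<Longrightarrow> p (B j (m, 0)) = (\<Sum>a\<le>n. bC j p a 0 * m ^ a)"
  unfolding bC_def by (rule bpoly_at_snd_0[OF bpoly_comp_B])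

lemma bC_outer:
  "p \<in> bpoly n \<Longrightarrow> p (B j (0, t)) = (\<Sum>b\<le>n. bC j p 0 b * t ^ b)"
  unfolding bC_def by (rule bpoly_at_fst_0[OF bpoly_comp_B])

lemma bC_outer_0:
  assumes "p \<in> bpoly n" "\<And>t. 0 < t \<Longrightarrow> t < 1 \<Longrightarrow> p (B j (0, t)) = 0"
  shows "bC j p 0 b = 0"
proof (cases "b \<le> n")
  case True
  then show ?thesis
    using poly_sum_eq_0[where a = 0 and b = 1 and n = n and c = "bC j p 0"] assms(2) bC_outer[OF assms(1)]
        by simp
qed (use bC_eq_0[OF assms(1)] in auto)

lemma even_less_6: "even j \<Longrightarrow> j < 6 \<Longrightarrow> j = 0 \<or> j = 2 \<or> j = (4::nat)"
  by (drule less_6_cases) auto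

text \<open>\<open>(j + 5) mod 6\<close> is the predecessor in the cycle. The two small triangles at
  a corner share their spoke, and their outer edges lie on different sides of the triangle, which
  makes them linearly independent.\<close>

lemma corner_independent:
  assumes "even j" "j < 6"
  shows "cross (Bw j) (Bw ((j + 5) mod 6)) \<noteq> 0" "Bo ((j + 5) mod 6) = Bo j" "Bv ((j + 5) mod 6) = Bv j"
    "Suc ((j + 5) mod 6) mod 6 = j"
proof -
  obtain t1 t3 t5 where t: "0 < t1" "t1 < 1" "0 < t3" "t3 < 1" "0 < t5" "t5 < 1"
    "u 1 = (1 - t1) *\<^sub>R u 0 + t1 *\<^sub>R u 2"
    "u 3 = (1 - t3) *\<^sub>R u 2 + t3 *\<^sub>R u 4"
    "u 5 = (1 - t5) *\<^sub>R u 4 + t5 *\<^sub>R u 0" using mids by blast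
  have D: "cross (u 0) (u 2) + cross (u 2) (u 4) + cross (u 4) (u 0) > 0" using cross_macro by simp
  have Bw_u: "Bw j = u (midpt j) - u (corner j)" for j by (simp add: Bw_def u_def)
  have e: "u 1 - u 0 = t1 *\<^sub>R (u 2 - u 0)" "u 5 - u 0 = (1 - t5) *\<^sub>R (u 4 - u 0)"
    "u 3 - u 2 = t3 *\<^sub>R (u 4 - u 2)" "u 1 - u 2 = (1 - t1) *\<^sub>R (u 0 - u 2)"
    "u 5 - u 4 = t5 *\<^sub>R (u 0 - u 4)" "u 3 - u 4 = (1 - t3) *\<^sub>R (u 2 - u 4)"
    unfolding t(7,8,9) by (simp_all add: algebra_simps)
  have c: "cross (u 2 - u 0) (u 4 - u 0) = cross (u 0) (u 2) + cross (u 2) (u 4) + cross (u 4) (u 0)"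
    "cross (u 4 - u 2) (u 0 - u 2) = cross (u 0) (u 2) + cross (u 2) (u 4) + cross (u 4) (u 0)"
    "cross (u 0 - u 4) (u 2 - u 4) = cross (u 0) (u 2) + cross (u 2) (u 4) + cross (u 4) (u 0)"
    by (simp_all add: cross_def algebra_simps)
  have n: "cross (u 1 - u 0) (u 5 - u 0) \<noteq> 0" "cross (u 3 - u 2) (u 1 - u 2) \<noteq> 0" "cross (u 5 - u 4) (u 3 -
      u 4) \<noteq> 0"
    unfolding e cross_simps(3,4) c using t(1-6) D by simp_all
  consider "j = 0" | "j = 2" | "j = 4" using even_less_6[OF assms] by blast
  note cs = this
  show "cross (Bw j) (Bw ((j + 5) mod 6)) \<noteq> 0"
    by (rule cs) (use n u_6 in \<open>simp_all del: cross_simps add: Bw_u corner_def midpt_def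
        numeral_2_eq_2[symmetric]\<close>)
  show "Bo ((j + 5) mod 6) = Bo j" "Bv ((j + 5) mod 6) = Bv j" "Suc ((j + 5) mod 6) mod 6 = j"
    by (rule cs; simp add: Bo_def Bv_def corner_def hex_simps)+
qed

text \<open>Both outer edges lie on one side of the triangle, and their frame vectors run from its
  two ends to the edge point. The factor \<open>k\<close> is the ratio of the two lengths,
  \<open>(1 - t) / t\<close> for an edge point with parameter \<open>t\<close>.\<close>

lemma midpoint_opposite:
  assumes "even j" "j < 6"
  obtains k where "0 < k" "Bw (Suc j) = (- k) *\<^sub>R Bw j"
proof -
  obtain t1 t3 t5 where t: "0 < t1" "t1 < 1" "0 < t3" "t3 < 1" "0 < t5" "t5 < 1"
    "u 1 = (1 - t1) *\<^sub>R u 0 + t1 *\<^sub>R u 2"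
    "u 3 = (1 - t3) *\<^sub>R u 2 + t3 *\<^sub>R u 4"
    "u 5 = (1 - t5) *\<^sub>R u 4 + t5 *\<^sub>R u 0" using mids by blast
  have Bw_u: "Bw j = u (midpt j) - u (corner j)" for j by (simp add: Bw_def u_def)
  have e: "((1 - t) *\<^sub>R a + t *\<^sub>R b) - b = (- ((1 - t) / t)) *\<^sub>R (((1 - t) *\<^sub>R a + t *\<^sub>R b) - a)"
    if "0 < t" for t :: real and a b :: R2
  proof -
    have "((1 - t) *\<^sub>R a + t *\<^sub>R b) - a = t *\<^sub>R (b - a)" "((1 - t) *\<^sub>R a + t *\<^sub>R b) - b = (1 - t) *\<^sub>R (a - b)"
      by (simp_all add: algebra_simps)
    then show ?thesis using that by (simp add: scaleR_minus_right[symmetric])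
  qed
  consider "j = 0" | "j = 2" | "j = 4" using even_less_6[OF assms] by blast
  then show ?thesis
  proof cases
    case 1
    then show ?thesis using e[OF t(1), of "u 0" "u 2"] t(1,2) unfolding t(7)[symmetric]
      by (intro that[of "(1 - t1) / t1"]) (simp_all add: Bw_u corner_def midpt_def numeral_2_eq_2[symmetric])
  next
    case 2
    then show ?thesis using e[OF t(3), of "u 2" "u 4"] t(3,4) unfolding t(8)[symmetric]
      by (intro that[of "(1 - t3) / t3"]) (simp_all add: Bw_u corner_def midpt_def)
  next
    case 3
    then show ?thesis using e[OF t(5), of "u 4" "u 0"] t(5,6) unfolding t(9)[symmetric]
      by (intro that[of "(1 - t5) / t5"]) (simp_all add: Bw_u corner_def midpt_def u_6)
  qed
qed

text \<open>The rotation consists of both partial derivatives, so its continuity is continuity of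
  every directional derivative.\<close>

lemma C1_dirD_eq:
  assumes "q \<in> C1 n" "i < 6" "j < 6" "x \<in> tri_ps z i" "x \<in> tri_ps z j"
  shows "dirD w (pc i q) x = dirD w (pc j q) x"
proof -
  have "rotp i q x = rotp j q x"
    using assms C1_iff agreeD[of "\<lambda>j. rotp j q"] by blast
  then have "dirD (1, 0) (pc i q) x = dirD (1, 0) (pc j q) x" "dirD (0, 1) (pc i q) x = dirD (0, 1) (pc j q) x"
    by (auto simp: rotp_def)
  then show ?thesis
    using dirD_components[OF pc_bpoly[OF C1_CP[OF assms(1)]], of w] by simp
qed

lemma pc_agree:
  assumes "f \<in> CP n" "x \<in> tri_ps z i" "x \<in> tri_ps z j"
  shows "pc i f x = pc j f x"
  using pc_eq[OF assms(1,2)] pc_eq[OF assms(1,3)] by simp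

text \<open>Induction on the vanishing order \<open>l\<close> of \<open>q\<close> at the boundary. At a corner, differentiating
  in the direction of the spoke and comparing lowest order terms kills the coefficient of
  \<open>\<mu>\<^sup>l t\<^sup>0\<close>. On a spoke to an edge point, continuity of \<open>q\<close> and of its derivative in the direction
  of the edge give two independent equations for the remaining coefficients of \<open>\<mu>\<^sup>l t\<^sup>1\<close>.\<close>

lemma S0_ring_determined:
  assumes q: "q \<in> S0_ring (int k) z"
    and zero: "\<And>j a b. j < 6 \<Longrightarrow> (a, b) \<in> tri_from 2 2 k \<Longrightarrow> bC j (pc j q) a b = 0"
  shows "q = (\<lambda>x. 0)"
proof -
  have C1: "q \<in> C1 k" and bd: "\<And>x. x \<in> frontier (triangle z) \<Longrightarrow> q x = 0 \<and> crot z q x = 0"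
    using q by (auto simp: S0_ring_iff)
  note CP = C1_CP[OF C1]
  note P = pc_bpoly[OF CP]
  define G where "G j = bC j (pc j q)" for j
  have G_deg: "G j a b = 0" if "k < a + b" for j a b
    unfolding G_def by (rule bC_eq_0[OF P that])
  have G0: "G j 0 b = 0" if j: "j < 6" for j b
    unfolding G_def
  proof (rule bC_outer_0[OF P])
    fix t :: real assume "0 < t" "t < 1"
    then show "pc j q (B j (0, t)) = 0"
      using bd[OF B_outer[of t j]] pc_eq[OF CP B_in_tri_ps[of 0 t j]] j by simp
  qed
  \<comment> \<open>The rotation carries the whole gradient, so the derivative towards the centre
    vanishes on the boundary as well, which kills the terms of first order.\<close>
  have G1: "G j 1 b = 0" if j: "j < 6" for j b
  proof -
    have "bC j (dirD (Bv j) (pc j q)) 0 b = 0"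
    proof (rule bC_outer_0[OF dirD_bpoly[OF P]])
      fix t :: real assume t: "0 < t" "t < 1"
      then have "crot z q (B j (0, t)) = 0" using bd[OF B_outer[of t j]] j by simp
      then have "rotp j q (B j (0, t)) = 0"
        using crot_eq(1)[OF C1 B_in_tri_ps[of 0 t j]] t by simp
      then show "dirD (Bv j) (pc j q) (B j (0, t)) = 0"
        using dirD_components[OF P, of "Bv j"] by (auto simp: rotp_def zero_prod_def)
    qed
    then show ?thesis using bC_dirD(1)[OF P, of j j 0 b] by (simp add: G_def)
  qed
  have step: "\<forall>j<6. \<forall>b. G j l b = 0" if l: "2 \<le> l" and IH: "\<forall>j<6. \<forall>a<l. \<forall>b. G j a b = 0" for l
  proof -
    have even0: "G j l 0 = 0 \<and> G ((j + 5) mod 6) l 0 = 0" if j: "even j" "j < 6" for j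
    proof -
      define i where "i = (j + 5) mod 6"
      have i: "i < 6" by (simp add: i_def)
      note ci = corner_independent[OF j, folded i_def]
      have Bij: "B i (m, 0) = B j (m, 0)" for m using ci by (simp add: B_eq)
      have tri: "B j (m, 0) \<in> tri_ps z j" "B j (m, 0) \<in> tri_ps z i" if "0 < m" "m < 1" for m
        using B_in_tri_ps[of m 0 j] B_in_tri_ps[of m 0 i] that Bij by auto
      \<comment> \<open>The spoke direction is a combination of the two edge directions; each edge
        derivative is then evaluated in the triangle whose frame contains that direction.\<close>
      obtain A A' where AA: "Bv j = A *\<^sub>R Bw j + A' *\<^sub>R Bw i"
        using aff_acoord[OF ci(1), of 0 "Bv j"] by (auto simp: aff_def dest: sym)
      have "bC j (dirD (Bv j) (pc j q)) (l - 1) 0 = A * bC j (dirD (Bw j) (pc j q)) (l - 1) 0 + A' * bC i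
          (dirD (Bw i) (pc i q)) (l - 1) 0"
      proof (cases "l - 1 \<le> k - 1")
        case True
        let ?d = "\<lambda>a. A * bC j (dirD (Bw j) (pc j q)) a 0 + A' * bC i (dirD (Bw i) (pc i q)) a 0"
        show ?thesis
        proof (rule poly_sums_eq[where n = "k - 1" and c = "\<lambda>a. bC j (dirD (Bv j) (pc j q)) a 0" and d = ?d,
            OF _ True])
          fix m :: real assume m: "0 < m" "m < 1"
          have "dirD (Bv j) (pc j q) (B j (m, 0)) = A * dirD (Bw j) (pc j q) (B j (m, 0)) + A' * dirD (Bw i)
              (pc j q) (B j (m, 0))"
            using AA dirD_linear[OF P] by metis
          also have "dirD (Bw i) (pc j q) (B j (m, 0)) = dirD (Bw i) (pc i q) (B i (m, 0))"
            using C1_dirD_eq[OF C1 j(2) i tri[OF m]] Bij by simp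
          finally show "(\<Sum>a\<le>k - 1. bC j (dirD (Bv j) (pc j q)) a 0 * m ^ a) = (\<Sum>a\<le>k - 1. ?d a * m ^ a)"
            unfolding bC_spoke_corner[OF dirD_bpoly[OF P]]
            by (simp add: sum_distrib_left sum.distrib[symmetric] algebra_simps)
        qed
      next
        case False
        then show ?thesis using bC_eq_0[OF dirD_bpoly[OF P]] by simp
      qed
      \<comment> \<open>Differentiating towards the centre lowers the order, so the coefficient of
        order \<open>l\<close> is expressed by coefficients of order \<open>l - 1\<close>, which
        vanish by the induction hypothesis.\<close>
      then have "real l * G j l 0 = A * G j (l - 1) 1 + A' * G i (l - 1) 1"
        using l by (simp add: bC_dirD[OF P] G_def del: One_nat_def)
      also have "\<dots> = 0" using IH l j i by simp
      finally have 1: "G j l 0 = 0" using l by simp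
      have "G j l 0 = G i l 0"
      proof (cases "l \<le> k")
        case True
        show ?thesis unfolding G_def
        proof (rule poly_sums_eq[where n = k and c = "\<lambda>a. bC j (pc j q) a 0" and d = "\<lambda>a. bC i (pc i q) a
            0", OF _ True])
          fix m :: real assume m: "0 < m" "m < 1"
          show "(\<Sum>a\<le>k. bC j (pc j q) a 0 * m ^ a) = (\<Sum>a\<le>k. bC i (pc i q) a 0 * m ^ a)"
            unfolding bC_spoke_corner[OF P, symmetric] Bij by (rule pc_agree[OF CP tri[OF m]])
        qed
      qed (use G_deg in simp)
      then show ?thesis using 1 by (simp add: i_def)
    qed
    have all0: "G j l 0 = 0" if "j < 6" for j
    proof (cases "even j")
      case False
      then have "even (Suc j mod 6)" "(Suc j mod 6 + 5) mod 6 = j" using less_6_cases[OF that] by auto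
      then show ?thesis using even0[of "Suc j mod 6"] by simp
    qed (use even0 that in auto)
    have ge2: "G j l b = 0" if "j < 6" "2 \<le> b" for j b
    proof (cases "l + b \<le> k")
      case True
      then show ?thesis using zero[OF that(1), of l b] l that(2) by (simp add: G_def tri_from_def)
    qed (use G_deg in simp)
    have one: "G j l 1 = 0 \<and> G (Suc j) l 1 = 0" if j: "even j" "j < 6" for j
    proof -
      have i: "Suc j < 6" using even_less_6[OF j] by auto
      obtain K where K: "0 < K" "Bw (Suc j) = (- K) *\<^sub>R Bw j" using midpoint_opposite[OF j] by blast
      have Bij: "B (Suc j) (m, 1 - m) = B j (m, 1 - m)" for m
        using j by (simp add: B_E E_eq)
      have tri: "B j (m, 1 - m) \<in> tri_ps z j" "B j (m, 1 - m) \<in> tri_ps z (Suc j)" if "0 < m" "m < 1" for m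
        using B_in_tri_ps[of m "1 - m" j] B_in_tri_ps[of m "1 - m" "Suc j"] that Bij by auto
      \<comment> \<open>The common degree bound \<open>Suc k\<close> lets the coefficients of
        \<open>q\<close> and of its derivatives range over the same exponents.\<close>
      have P': "pc j q \<in> bpoly (Suc k)" for j using P bpoly_mono le_SucI by blast
      have DP': "dirD w (pc j q) \<in> bpoly (Suc k)" for w j using dirD_bpoly[OF P'] bpoly_mono[of k "Suc k"]
          by auto
      have "(\<Sum>b\<le>Suc k. G j l b - G (Suc j) l b) = 0"
      proof (rule lowest_order_sum)
        fix m :: real assume m: "0 < m" "m < 1"
        have "pc j q (B j (m, 1 - m)) = pc (Suc j) q (B (Suc j) (m, 1 - m))"
          unfolding Bij by (rule pc_agree[OF CP tri[OF m]])
        then show "(\<Sum>(a, b)\<in>tri (Suc k). (G j a b - G (Suc j) a b) * m ^ a * (1 - m) ^ b) = 0"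
          unfolding bC_expand[OF P'] G_def by (simp add: case_prod_beta left_diff_distrib sum_subtractf)
      qed (use IH i j G_deg in auto)
      moreover have "(\<Sum>b\<le>Suc k. G j l b - G (Suc j) l b) = (\<Sum>b\<in>{1}. G j l b - G (Suc j) l b)"
      proof (rule sum.mono_neutral_right)
        show "\<forall>b\<in>{..Suc k} - {1}. G j l b - G (Suc j) l b = 0"
        proof
          fix b assume "b \<in> {..Suc k} - {1}"
          then have "b = 0 \<or> 2 \<le> b" by auto
          then show "G j l b - G (Suc j) l b = 0" using all0 ge2 i j by auto
        qed
      qed auto
      ultimately have e1: "G j l 1 = G (Suc j) l 1" by simp
      \<comment> \<open>As the edge directions are opposite, continuity of the edge derivative
        yields a sum with positive weights 1 and \<open>K\<close>, whereas continuity of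
        \<open>q\<close> yields a difference; together they leave only zero.\<close>
      have "(\<Sum>b\<le>Suc k. real (b + 1) * G (Suc j) l (b + 1) + K * (real (b + 1) * G j l (b + 1))) = 0"
      proof (rule lowest_order_sum[where e = "\<lambda>a b. real (b + 1) * G (Suc j) a (b + 1) + K * (real (b + 1) *
          G j a (b + 1))"])
        fix m :: real assume m: "0 < m" "m < 1"
        have "dirD (Bw (Suc j)) (pc (Suc j) q) (B (Suc j) (m, 1 - m)) = dirD (Bw (Suc j)) (pc j q) (B j (m,
            1 - m))"
          unfolding Bij by (rule C1_dirD_eq[OF C1 i j(2) tri(2)[OF m] tri(1)[OF m]])
        also have "\<dots> = - K * dirD (Bw j) (pc j q) (B j (m, 1 - m))"
          using dirD_linear[OF P, of "- K" "Bw j" 0 0] K(2) by simp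
        finally have "dirD (Bw (Suc j)) (pc (Suc j) q) (B (Suc j) (m, 1 - m)) + K * dirD (Bw j) (pc j q) (B
            j (m, 1 - m)) = 0"
          by simp
        then show "(\<Sum>(a, b)\<in>tri (Suc k). (real (b + 1) * G (Suc j) a (b + 1) + K * (real (b + 1) * G j a (b
            + 1))) * m ^ a * (1 - m) ^ b) = 0"
          unfolding bC_expand[OF DP'] bC_dirD[OF P] G_def
          by (simp only: split_def distrib_right sum.distrib sum_distrib_left mult.assoc)
      qed (use IH i j G_deg in auto)
      moreover have "(\<Sum>b\<le>Suc k. real (b + 1) * G (Suc j) l (b + 1) + K * (real (b + 1) * G j l (b + 1)))
         = (\<Sum>b\<in>{0}. real (b + 1) * G (Suc j) l (b + 1) + K * (real (b + 1) * G j l (b + 1)))"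
        by (rule sum.mono_neutral_right) (use ge2 i j in auto)
      ultimately have "G (Suc j) l 1 + K * G j l 1 = 0" by simp
      then have "(1 + K) * G j l 1 = 0" using e1 by (simp add: algebra_simps)
      then show ?thesis using K(1) e1 by simp
    qed
    have "G j l 1 = 0" if "j < 6" for j
    proof (cases "even j")
      case False
      then have "even (j - 1)" "Suc (j - 1) = j" by (auto elim: oddE)
      then show ?thesis using one[of "j - 1"] that by simp
    qed (use one that in auto)
    moreover have "b = 0 \<or> b = 1 \<or> 2 \<le> b" for b :: nat by auto
    ultimately show ?thesis using all0 ge2 by metis
  qed
  have "\<forall>j<6. \<forall>b. G j l b = 0" for l
  proof (induction l rule: less_induct)
    case (less l)
    then show ?case using G0 G1 step[of l] by (cases "l = 0"; cases "l = 1") auto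
  qed
  then have "pc j q = (\<lambda>x. 0)" if "j < 6" for j
    using bC_all_0[OF P, of j j] that unfolding G_def by blast
  then show ?thesis by (intro CP_eqI[OF CP CP_zero]) (simp add: pc_zero)
qed

lemma linear_bC: "linear_functional_on (CP m) (\<lambda>f. bC j (pc j f) a b)"
proof (rule linear_functional_onI)
  fix f g assume "f \<in> CP m" "g \<in> CP m"
  then show "bC j (pc j (\<lambda>x. f x + g x)) a b = bC j (pc j f) a b + bC j (pc j g) a b"
    using pc_add[of f m g m j] bC_add[OF pc_bpoly pc_bpoly] by simp
next
  fix c f assume "f \<in> CP m"
  then show "bC j (pc j (\<lambda>x. c *\<^sub>R f x)) a b = c * bC j (pc j f) a b"
    using pc_cmul[of f m j c] bC_cmul[OF pc_bpoly] by simp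
qed

text \<open>The exponents with \<open>2 \<le> a\<close>, \<open>2 \<le> b\<close> and
  \<open>a + b \<le> r + 1\<close> number \<open>(r - 1) * (r - 2) div 2\<close> in each of the six
  triangles.\<close>

lemma has_dim_S0_ring_le: "\<exists>m\<le>3 * (r - 1) * (r - 2). has_dim (S0_ring (int (r + 1)) z) m"
proof -
  let ?I = "{..<6::nat} \<times> tri_from 2 2 (r + 1)"
  have "\<exists>m\<le>card ?I. has_dim (S0_ring (int (r + 1)) z) m"
  proof (rule has_dim_le_card[where F = "\<lambda>(j, a, b) f. bC j (pc j f) a b"])
    show "finite ?I" by (simp add: finite_tri_from)
    show "fun_vs.subspace (S0_ring (int (r + 1)) z)" by (rule fun_subspace_S0_ring)
    have sub: "S0_ring (int (r + 1)) z \<subseteq> CP (r + 1)" using S0_ring_iff C1_CP by blast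
    fix i assume "i \<in> ?I"
    show "linear_functional_on (S0_ring (int (r + 1)) z) ((\<lambda>(j, a, b) f. bC j (pc j f) a b) i)"
      using linear_functional_on_subset[OF linear_bC sub] by (simp add: case_prod_beta)
  next
    fix v assume v: "v \<in> S0_ring (int (r + 1)) z" "\<And>i. i \<in> ?I \<Longrightarrow> (\<lambda>(j, a, b) f. bC j (pc j f) a b) i v = 0"
    show "v = (\<lambda>x. 0)"
      by (rule S0_ring_determined[OF v(1)]) (use v(2) in force)
  qed
  moreover have "card ?I = 3 * (r - 1) * (r - 2)"
  proof -
    have "2 * card (tri_from 2 2 (r + 1)) = (r - 1) * (r - 2)"
    proof (cases "3 \<le> r")
      case True
      then obtain s where "r = s + 3" by (metis add.commute le_Suc_ex)
      then show ?thesis using card_tri_from[of 2 2 "r + 1"] by (simp add: algebra_simps)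
    next
      case False
      then have "r - 2 = 0" by simp
      then show ?thesis using False card_tri_from[of 2 2 "r + 1"] by simp
    qed
    then show ?thesis by (simp add: card_cartesian_product)
  qed
  ultimately show ?thesis by simp
qed

section \<open>Counting continuity conditions for the velocity\<close>

lemma has_dim_VP: "has_dim (VP r) (6 * r * (r + 1) + 2)"
  using has_dim_pair_funs[OF fun_subspace_CP has_dim_CP[of r] fun_subspace_CP has_dim_CP[of r]]
  by (simp add: VP_def algebra_simps)

lemma linear_eC_divp: "linear_functional_on (VP n) (\<lambda>v. eC j (divp i v) a b)"
proof (rule linear_functional_onI)
  fix f g assume "f \<in> VP n" "g \<in> VP n"
  then show "eC j (divp i (\<lambda>x. f x + g x)) a b = eC j (divp i f) a b + eC j (divp i g) a b"
    using divp_add[of f n g i] eC_add[OF divp_bpoly divp_bpoly] by simp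
next
  fix c f assume "f \<in> VP n"
  then show "eC j (divp i (\<lambda>x. c *\<^sub>R f x)) a b = c * eC j (divp i f) a b"
    using divp_scale[of f n i c] eC_cmul[OF divp_bpoly] by simp
qed

text \<open>The jumps of the divergence at the centre add up to zero around the cycle of spokes, so one
  of the \<open>6 * r\<close> continuity conditions is redundant.\<close>

lemma has_dim_S1_ge:
  assumes "1 \<le> r"
  shows "\<exists>n. has_dim (S1 (int r) z) n \<and> 6 * r * r + 3 \<le> n"
proof -
  \<comment> \<open>Along each of the six spokes the jump of the divergence is a univariate
    polynomial with \<open>r\<close> coefficients; \<open>(5, 0)\<close> is the jump at the centre
    across the last spoke.\<close>
  let ?I = "{..<6::nat} \<times> {..<r} - {(5, 0)}"
  define F where "F = (\<lambda>(j, b) v. eC j (divp j v) 0 b - eC (Suc j mod 6) (divp (Suc j mod 6) v) b 0)"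
  have linF: "linear_functional_on (VP r) (F i)" for i
  proof -
    obtain j b where i: "i = (j, b)" by (cases i)
    show ?thesis
    proof (rule linear_functional_onI)
      fix f g assume "f \<in> VP r" "g \<in> VP r"
      then show "F i (\<lambda>x. f x + g x) = F i f + F i g"
        by (simp add: F_def i linear_functional_onD(1)[OF linear_eC_divp])
    next
      fix c f assume "f \<in> VP r"
      then show "F i (\<lambda>x. c *\<^sub>R f x) = c * F i f"
        using linear_functional_onD(2)[OF linear_eC_divp, of f r] by (simp add: F_def i right_diff_distrib)
    qed
  qed
  let ?K = "{v \<in> VP r. \<forall>i\<in>?I. F i v = 0}"
  obtain k where k: "has_dim ?K k" "6 * r * (r + 1) + 2 \<le> k + card ?I"
    using has_dim_kernel_ge[where I = ?I and F = F, OF _ fun_subspace_VP linF has_dim_VP] by auto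
  have "?K \<subseteq> S1 (int r) z"
  proof
    fix v assume v: "v \<in> ?K"
    then have V: "v \<in> VP r" by simp
    note D = divp_bpoly[OF V]
    have c: "eC j (divp j v) 0 0 = divp j v (z 0)" for j by (rule eC_center[OF D])
    have eq0: "divp j v (z 0) = divp (Suc j) v (z 0)" if "j < 5" for j
      using v c[of j] c[of "Suc j mod 6"] that assms by (auto simp: F_def dest!: bspec[of _ _ "(j, 0)"])
    have eq: "eC j (divp j v) 0 b = eC (Suc j mod 6) (divp (Suc j mod 6) v) b 0" if "j < 6" "b < r" for j b
    proof (cases "(j, b) = (5, 0)")
      case True
      have "divp j v (z 0) = divp 0 v (z 0)" if "j < 6" for j
        using that
      proof (induction j)
        case (Suc j)
        then show ?case using eq0[of j] by simp
      qed simp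
      from this[of 5] have "divp 5 v (z 0) = divp 0 v (z 0)" by simp
      then show ?thesis using True c[of 5] c[of 0] by simp
    next
      case False
      then show ?thesis using v that by (auto simp: F_def dest!: bspec[of _ _ "(j, b)"])
    qed
    have "divp j v (z 0 + t *\<^sub>R u (Suc j)) = divp (Suc j mod 6) v (z 0 + t *\<^sub>R u (Suc j))" if "j < 6" for j t
    proof -
      have "divp j v (z 0 + t *\<^sub>R u (Suc j)) = (\<Sum>b\<le>r - 1. eC j (divp j v) 0 b * t ^ b)"
        by (rule eC_spoke_out[OF D])
      also have "\<dots> = (\<Sum>b\<le>r - 1. eC (Suc j mod 6) (divp (Suc j mod 6) v) b 0 * t ^ b)"
        using eq[OF that] assms by (intro sum.cong refl arg_cong2[of _ _ _ _ "(*)"]) auto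
      also have "\<dots> = divp (Suc j mod 6) v (z 0 + t *\<^sub>R u (Suc j))"
        by (rule eC_spoke_in[OF D, symmetric])
      finally show ?thesis .
    qed
    then have "agree (\<lambda>j. divp j v)"
      unfolding agree_def using spokes_agree[of "\<lambda>j. divp j v"] by blast
    then show "v \<in> S1 (int r) z" using V S1_iff by blast
  qed
  moreover obtain n where n: "has_dim (S1 (int r) z) n"
    using has_dim_subspace[OF has_dim_VP fun_subspace_S1, of r] S1_VP by blast
  moreover have "fun_vs.subspace ?K" by (rule fun_subspace_kernel[OF fun_subspace_VP linF])
  ultimately have "k \<le> n" using has_dim_subspace[OF n] has_dim_unique[OF k(1)] by blast
  moreover have "card ?I + 1 = 6 * r" using assms by (subst card_Diff_singleton) (auto simp:
      card_cartesian_product)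
  ultimately show ?thesis using k(2) n by (intro exI[of _ n]) (simp add: algebra_simps)
qed

end

section \<open>Polynomials on edges and test functions for the divergence\<close>

lemma poly_real_eqI:
  fixes p q :: "real poly"
  assumes "a < b" "\<And>t. a < t \<Longrightarrow> t < b \<Longrightarrow> poly p t = poly q t"
  shows "p = q"
proof (rule ccontr)
  assume "p \<noteq> q"
  then have "finite {t. poly (p - q) t = 0}" by (intro poly_roots_finite) simp
  moreover have "{a<..<b} \<subseteq> {t. poly (p - q) t = 0}" using assms(2) by auto
  ultimately show False using infinite_Ioo[OF assms(1)] finite_subset by blast
qed

text \<open>Integration by parts: the left-hand side is the boundary term of \<open>(p p')' = p'\<^sup>2 + p p''\<close>.\<close>

lemma poly_parts:
  fixes p :: "real poly"
  assumes "integral {0..1} (\<lambda>t. poly p t * poly (pderiv (pderiv p)) t) = 0"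
  shows "poly p 1 * poly (pderiv p) 1 - poly p 0 * poly (pderiv p) 0 = integral {0..1} (\<lambda>t. (poly (pderiv p)
      t)\<^sup>2)"
proof -
  have "((\<lambda>t. (poly (pderiv p) t)\<^sup>2 + poly p t * poly (pderiv (pderiv p)) t) has_integral
      poly p 1 * poly (pderiv p) 1 - poly p 0 * poly (pderiv p) 0) {0..1}"
    by (rule fundamental_theorem_of_calculus[where f = "\<lambda>t. poly p t * poly (pderiv p) t"])
      (auto intro!: derivative_eq_intros simp: has_real_derivative_iff_has_vector_derivative[symmetric]
          power2_eq_square)
  then have "poly p 1 * poly (pderiv p) 1 - poly p 0 * poly (pderiv p) 0
    = integral {0..1} (\<lambda>t. (poly (pderiv p) t)\<^sup>2 + poly p t * poly (pderiv (pderiv p)) t)"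
    by (simp add: integral_unique)
  also have "\<dots> = integral {0..1} (\<lambda>t. (poly (pderiv p) t)\<^sup>2) + integral {0..1} (\<lambda>t. poly p t * poly (pderiv
      (pderiv p)) t)"
    by (intro integral_add integrable_continuous_interval continuous_intros)
  finally show ?thesis using assms by simp
qed

lemma poly_square_integral_0:
  fixes p :: "real poly"
  assumes "integral {0..1} (\<lambda>t. (poly p t)\<^sup>2) = 0"
  shows "p = 0"
proof -
  have "(poly p t)\<^sup>2 = 0" if "t \<in> cbox 0 1" for t :: real
  proof (rule has_integral_0_cbox_imp_0[of 0 1 "\<lambda>t. (poly p t)\<^sup>2", OF _ _ _ _ that])
    show "((\<lambda>t. (poly p t)\<^sup>2) has_integral 0) (cbox 0 1)"
    proof -
      have "(\<lambda>t. (poly p t)\<^sup>2) integrable_on {0..1}" by (intro integrable_continuous_interval continuous_intros)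
      then show ?thesis using assms integrable_integral[of "\<lambda>t. (poly p t)\<^sup>2" "{0..1}"] by simp
    qed
  qed (auto intro!: continuous_intros)
  then show ?thesis by (intro poly_real_eqI[of 0 1]) auto
qed

lemma poly_square_integral_nonneg: "0 \<le> integral {0..1} (\<lambda>t. (poly p t)\<^sup>2)" for p :: "real poly"
  by (intro integral_nonneg integrable_continuous_interval continuous_intros) auto

text \<open>Orthogonal projection onto the line through \<open>a\<close> and \<open>b\<close>,
  expressed in the edge parameter. It extends a univariate polynomial in that parameter to a
  bivariate one without raising the degree, as \<open>poly_on\<close> demands.\<close>

definition seg_param :: "R2 \<Rightarrow> R2 \<Rightarrow> R2 \<Rightarrow> real" where
  "seg_param a b x = ((x - a) \<bullet> (b - a)) / ((b - a) \<bullet> (b - a))"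

lemma seg_param_linepath: "a \<noteq> b \<Longrightarrow> seg_param a b (linepath a b t) = t"
proof -
  assume "a \<noteq> b"
  moreover have "linepath a b t - a = t *\<^sub>R (b - a)" by (simp add: linepath_def algebra_simps)
  ultimately show ?thesis by (simp add: seg_param_def)
qed

lemma seg_param_bpoly: "seg_param a b \<in> bpoly 1"
proof -
  have "seg_param a b = (\<lambda>x. (- (a \<bullet> (b - a)) / ((b - a) \<bullet> (b - a))) + (fst (b - a) / ((b - a) \<bullet> (b - a))) *
      fst x + (snd (b - a) / ((b - a) \<bullet> (b - a))) * snd x)"
    by (rule ext) (simp add: seg_param_def inner_diff_left inner_prod_def[of _ "b - a"]
        add_divide_distrib[symmetric] del: fst_diff snd_diff, simp add: algebra_simps)
  also have "\<dots> \<in> bpoly 1" by (rule bpoly_affine)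
  finally show ?thesis .
qed

lemma bpoly_poly_seg_param: "degree G \<le> n \<Longrightarrow> (\<lambda>x. poly G (seg_param a b x)) \<in> bpoly n"
proof -
  assume d: "degree G \<le> n"
  have "(\<lambda>x. coeff G i * seg_param a b x ^ i) \<in> bpoly n" if "i \<le> degree G" for i
    by (rule bpoly_mono[OF _ bpoly_cmul[OF bpoly_power[OF seg_param_bpoly]]]) (use that d in simp)
  then show ?thesis unfolding poly_altdef by (intro bpoly_sum) auto
qed

lemma closed_segment_linepath: "x \<in> closed_segment a b \<longleftrightarrow> (\<exists>t. 0 \<le> t \<and> t \<le> 1 \<and> x = linepath a b t)"
  by (auto simp: in_segment linepath_def)

lemma bpoly_linepath:
  "p \<in> bpoly n \<Longrightarrow> \<exists>G. degree G \<le> n \<and> (\<forall>t. p (linepath a b t) = poly G t)"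
proof -
  have "linepath a b t = a + t *\<^sub>R (b - a)" for t by (simp add: linepath_def algebra_simps)
  then show "p \<in> bpoly n \<Longrightarrow> ?thesis" using bpoly_along_line[of p n a "b - a"] by simp
qed

lemma fun_subspace_poly_on: "fun_vs.subspace (poly_on k S)"
proof (cases "k < 0")
  case True
  show ?thesis unfolding poly_on_neg[OF True] by (intro fun_subspaceI) auto
next
  case False
  then obtain n where k: "k = int n" using nonneg_int_cases by (metis not_less)
  show ?thesis unfolding k
  proof (rule fun_subspaceI)
    show "(\<lambda>x. 0) \<in> poly_on (int n) S" unfolding poly_on_int_iff by (intro bexI[of _ "\<lambda>x. 0"]) auto
  next
    fix f g assume "f \<in> poly_on (int n) S" "g \<in> poly_on (int n) S"
    then obtain p q where "p \<in> bpoly n" "q \<in> bpoly n" "f = (\<lambda>x. if x \<in> S then p x else 0)" "g = (\<lambda>x. if x \<in>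
        S then q x else 0)"
      unfolding poly_on_int_iff by blast
    then show "(\<lambda>x. f x + g x) \<in> poly_on (int n) S" unfolding poly_on_int_iff
      by (intro bexI[of _ "\<lambda>x. p x + q x"] bpoly_add) auto
  next
    fix c f assume "f \<in> poly_on (int n) S"
    then obtain p where "p \<in> bpoly n" "f = (\<lambda>x. if x \<in> S then p x else 0)"
      unfolding poly_on_int_iff by blast
    then show "(\<lambda>x. c *\<^sub>R f x) \<in> poly_on (int n) S" unfolding poly_on_int_iff
      by (intro bexI[of _ "\<lambda>x. c * p x"] bpoly_cmul) auto
  qed
qed

text \<open>Different bivariate polynomials may have the same trace on the segment. Coordinates are
  therefore taken from the univariate trace \<open>G f\<close>, and the powers of the edge parameter
  form the dual basis.\<close>

lemma has_dim_poly_on_segment: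
  assumes "a \<noteq> b"
  shows "has_dim (poly_on (int n) (closed_segment a b)) (Suc n)"
proof -
  let ?S = "closed_segment a b" and ?V = "poly_on (int n) (closed_segment a b)"
  define G where "G f = (SOME G. degree G \<le> n \<and> (\<forall>t. 0 \<le> t \<and> t \<le> 1 \<longrightarrow> f (linepath a b t) = poly G t))" for f
      :: "R2 \<Rightarrow> real"
  have lin: "linepath a b t \<in> ?S" if "0 \<le> t" "t \<le> 1" for t using that closed_segment_linepath by blast
  have G: "degree (G f) \<le> n \<and> (\<forall>t. 0 \<le> t \<and> t \<le> 1 \<longrightarrow> f (linepath a b t) = poly (G f) t)" if f: "f \<in> ?V" for f
    unfolding G_def
  proof (rule someI_ex)
    obtain p where "p \<in> bpoly n" "f = (\<lambda>x. if x \<in> ?S then p x else 0)"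
      using f unfolding poly_on_int_iff by blast
    then show "\<exists>G. degree G \<le> n \<and> (\<forall>t. 0 \<le> t \<and> t \<le> 1 \<longrightarrow> f (linepath a b t) = poly G t)"
      using bpoly_linepath[of p n a b] lin by auto
  qed
  have Geq: "G f = H" if "f \<in> ?V" "\<And>t. 0 \<le> t \<Longrightarrow> t \<le> 1 \<Longrightarrow> f (linepath a b t) = poly H t" for f H
    using G[OF that(1)] that(2) by (intro poly_real_eqI[of 0 1]) auto
  note sub = fun_subspaceD[OF fun_subspace_poly_on[of "int n" ?S]]
  have "has_dim ?V (card {..n})"
  proof (rule has_dim_biorthogonal[where F = "\<lambda>i f. coeff (G f) i" and b = "\<lambda>i x. if x \<in> ?S then seg_param a
      b x ^ i else 0"])
    show "fun_vs.subspace ?V" by (rule fun_subspace_poly_on)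
    fix i
    show "linear_functional_on ?V (\<lambda>f. coeff (G f) i)"
    proof (rule linear_functional_onI)
      fix f g assume fg: "f \<in> ?V" "g \<in> ?V"
      have "G (\<lambda>x. f x + g x) = G f + G g"
        using G[OF fg(1)] G[OF fg(2)] by (intro Geq sub fg) simp
      then show "coeff (G (\<lambda>x. f x + g x)) i = coeff (G f) i + coeff (G g) i" by simp
    next
      fix c f assume f: "f \<in> ?V"
      have "G (\<lambda>x. c *\<^sub>R f x) = smult c (G f)"
        using G[OF f] by (intro Geq sub f) simp
      then show "coeff (G (\<lambda>x. c *\<^sub>R f x)) i = c * coeff (G f) i" by simp
    qed
    assume "i \<in> {..n}"
    then show b: "(\<lambda>x. if x \<in> ?S then seg_param a b x ^ i else 0) \<in> ?V"
      unfolding poly_on_int_iff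
      by (intro bexI[of _ "\<lambda>x. seg_param a b x ^ i"] refl bpoly_mono[OF _ bpoly_power[OF seg_param_bpoly]]) simp
    have "G (\<lambda>x. if x \<in> ?S then seg_param a b x ^ i else 0) = monom 1 i"
      by (rule Geq[OF b]) (simp add: lin seg_param_linepath[OF assms] poly_monom)
    then show "coeff (G (\<lambda>x. if x \<in> ?S then seg_param a b x ^ i else 0)) j = (if j = i then 1 else 0)" for j
      by simp
  next
    fix f assume f: "f \<in> ?V" "\<And>i. i \<in> {..n} \<Longrightarrow> coeff (G f) i = 0"
    have "coeff (G f) i = 0" for i
      using f(2)[of i] G[OF f(1)] by (cases "i \<le> n") (auto simp: coeff_eq_0)
    then have "G f = 0" by (intro poly_eqI) simp
    moreover obtain p where "f = (\<lambda>x. if x \<in> ?S then p x else 0)"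
      using f(1) unfolding poly_on_int_iff by blast
    ultimately have "f x = 0" for x
    proof (cases "x \<in> ?S")
      case True
      then obtain t where "0 \<le> t" "t \<le> 1" "x = linepath a b t" unfolding closed_segment_linepath by blast
      then show ?thesis using G[OF f(1)] \<open>G f = 0\<close> by simp
    qed (simp add: \<open>f = _\<close>)
    then show "f = (\<lambda>x. 0)" by auto
  qed simp
  then show ?thesis by simp
qed

text \<open>\<open>nat (k + 1)\<close> is 0 for every negative degree, in agreement with the trivial
  space.\<close>

lemma has_dim_poly_on_segment_int:
  assumes "a \<noteq> b"
  shows "has_dim (poly_on k (closed_segment a b)) (nat (k + 1))"
proof (cases "k < 0")
  case True
  then show ?thesis by (simp add: poly_on_neg has_dim_zero)
next
  case False
  then show ?thesis using has_dim_poly_on_segment[OF assms, of "nat k"] by (simp add: nat_add_distrib)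
qed

lemma vec_poly_on_pair: "vec_poly_on k S = pair_funs (poly_on k S) (poly_on k S)"
  by (simp add: vec_poly_on_def pair_funs_def)

lemma fun_subspace_vec_poly_on: "fun_vs.subspace (vec_poly_on k S)"
  unfolding vec_poly_on_pair by (intro fun_subspace_pair_funs fun_subspace_poly_on)

lemma has_dim_vec_poly_on_segment_int:
  assumes "a \<noteq> b"
  shows "has_dim (vec_poly_on k (closed_segment a b)) (2 * nat (k + 1))"
  unfolding vec_poly_on_pair mult_2
  by (intro has_dim_pair_funs fun_subspace_poly_on has_dim_poly_on_segment_int assms)

context ps_config
begin

lemma closure_interior_triangle: "closure (interior (triangle z)) = triangle z"
proof -
  have "z 0 \<in> interior (triangle z)" using ps by (simp add: powell_sabin_def)
  then have "interior (triangle z) \<noteq> {}" by blast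
  then show ?thesis using convex_closure_interior[OF convex_triangle] closed_triangle by simp
qed

text \<open>Around an interior point a box fits into the triangle, and by monotonicity the integral
  over it vanishes too. The boundary follows because the triangle is the closure of its
  interior.\<close>

lemma integral_triangle_eq_0:
  fixes f :: "R2 \<Rightarrow> real"
  assumes f: "continuous_on (triangle z) f" "\<And>x. x \<in> triangle z \<Longrightarrow> 0 \<le> f x" "integral (triangle z) f = 0"
    and x: "x \<in> triangle z"
  shows "f x = 0"
proof -
  have "f y = 0" if y: "y \<in> interior (triangle z)" for y
  proof -
    obtain a b where ab: "y \<in> box a b" "cbox a b \<subseteq> interior (triangle z)"
      using open_contains_cbox[OF open_interior y] by metis
    then have sub: "cbox a b \<subseteq> triangle z" using interior_subset by blast
    have cont: "continuous_on (cbox a b) f" using f(1) sub continuous_on_subset by blast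
    have int: "f integrable_on cbox a b" by (rule integrable_continuous[OF cont])
    have "integral (cbox a b) f \<le> integral (triangle z) f"
      by (rule integral_subset_le[OF sub int integrable_on_triangle[OF f(1)]]) (use f(2) in auto)
    moreover have "0 \<le> integral (cbox a b) f" using int f(2) sub by (intro integral_nonneg) auto
    ultimately have "(f has_integral 0) (cbox a b)" using int f(3) by (simp add:
        has_integral_integrable_integral)
    then show ?thesis
      using has_integral_0_cbox_imp_0[OF cont, of y] f(2) sub ab(1) box_subset_cbox by blast
  qed
  then show ?thesis
    using continuous_constant_on_closure[of "interior (triangle z)" f 0 x] f(1) x closure_interior_triangle
        by simp
qed

lemma CP_mono: "m \<le> n \<Longrightarrow> f \<in> CP m \<Longrightarrow> f \<in> CP n"
  unfolding CP_iff using bpoly_mono by blast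

lemma frontier_B: "x \<in> frontier (triangle z) \<longleftrightarrow> (\<exists>j<6. \<exists>t. 0 \<le> t \<and> t \<le> 1 \<and> x = B j (0, t))"
proof
  assume "x \<in> frontier (triangle z)"
  then obtain j s where s: "j < 6" "0 \<le> s" "s \<le> 1" "x = linepath (hex z j) (hex z (Suc j)) s"
    unfolding frontier_triangle using closed_segment_linepath by blast
  then have "x = B j (0, if even j then s else 1 - s)"
    by (simp add: B_eq Bo_def Bw_def corner_def midpt_def linepath_def algebra_simps)
  then show "\<exists>j<6. \<exists>t. 0 \<le> t \<and> t \<le> 1 \<and> x = B j (0, t)"
    using s(1-3) by (intro exI[of _ j] conjI exI[of _ "if even j then s else 1 - s"]) auto
qed (use B_outer in blast)

section \<open>Functions vanishing on the boundary\<close>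

definition mu_loc :: "nat \<Rightarrow> R2 \<Rightarrow> real" where "mu_loc j x = fst (bc j x)"

lemma mu_loc_bpoly: "mu_loc j \<in> bpoly 1"
  unfolding mu_loc_def by (rule bpoly_fst_acoord)

lemma mu_loc_B [simp]: "mu_loc j (B j (m, t)) = m" by (simp add: mu_loc_def)

lemma mu_loc_E: "mu_loc j (E j (s, t)) = 1 - s - t"
proof -
  have "E j (s, t) = B j (1 - s - t, if even j then t else s)" by (auto simp: B_E E_eq)
  then show ?thesis by simp
qed

lemma mu_loc_spoke: "mu_loc j (z 0 + t *\<^sub>R u (Suc j)) = 1 - t" "mu_loc (Suc j mod 6) (z 0 + t *\<^sub>R u (Suc j)) =
    1 - t"
  using mu_loc_E[of j 0 t] mu_loc_E[of "Suc j mod 6" t 0] unfolding E_spoke by simp_all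

text \<open>The hat function of the centre, glued from the first coordinates of the boundary
  frames.\<close>

definition mu :: "R2 \<Rightarrow> real" where "mu = (SOME f. f \<in> CP 1 \<and> (\<forall>j<6. pc j f = mu_loc j))"

lemma mu: "mu \<in> CP 1" "j < 6 \<Longrightarrow> pc j mu = mu_loc j"
proof -
  have "\<exists>f. f \<in> CP 1 \<and> (\<forall>j<6. pc j f = mu_loc j)"
  proof -
    obtain f where "f \<in> CP 1" "\<And>j. j < 6 \<Longrightarrow> pc j f = mu_loc j"
      by (rule CP_glue_spokes[of mu_loc 1]) (auto simp only: mu_loc_bpoly mu_loc_spoke)
    then show ?thesis by blast
  qed
  from someI_ex[OF this] show "mu \<in> CP 1" "j < 6 \<Longrightarrow> pc j mu = mu_loc j" unfolding mu_def by auto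
qed

lemma mu_eq: "j < 6 \<Longrightarrow> x \<in> tri_ps z j \<Longrightarrow> mu x = mu_loc j x"
  using pc_eq[OF mu(1), of x j] mu(2)[of j] by simp

lemma mu_frontier: "x \<in> frontier (triangle z) \<Longrightarrow> mu x = 0"
proof -
  assume "x \<in> frontier (triangle z)"
  then obtain j t where "j < 6" "0 \<le> t" "t \<le> 1" "x = B j (0, t)" unfolding frontier_B by blast
  then show ?thesis using mu_eq[of j x] B_in_tri_ps[of 0 t j] by simp
qed

lemma mu_nonneg: "x \<in> triangle z \<Longrightarrow> 0 \<le> mu x"
proof -
  assume "x \<in> triangle z"
  then obtain j where j: "j < 6" "x \<in> tri_ps z j" using in_some_tri by blast
  then obtain s t where "x = E j (s, t)" "0 \<le> s" "0 \<le> t" "s + t \<le> 1" unfolding tri_ps_eq by blast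
  then show ?thesis using mu_eq[OF j] by (simp add: mu_loc_E)
qed

lemma mu_center: "mu (z 0) = 1"
  using mu_eq[of 0 "z 0"] center_in_tri_ps[of 0] mu_loc_spoke(1)[of 0 0] by simp

definition CP0 :: "nat \<Rightarrow> (R2 \<Rightarrow> real) set" where
  "CP0 m = {q \<in> CP m. \<forall>x\<in>frontier (triangle z). q x = 0}"

lemma fun_subspace_CP0: "fun_vs.subspace (CP0 m)"
  by (rule fun_subspaceI) (auto simp: CP0_def CP_zero CP_add CP_cmul)

lemma CP0_bC:
  assumes "q \<in> CP0 m" "j < 6" shows "bC j (pc j q) 0 b = 0"
proof (rule bC_outer_0)
  have q: "q \<in> CP m" using assms by (simp add: CP0_def)
  show "pc j q \<in> bpoly m" by (rule pc_bpoly[OF q])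
  fix t :: real assume "0 < t" "t < 1"
  then show "pc j q (B j (0, t)) = 0"
    using B_outer[of t j] pc_eq[OF q B_in_tri_ps[of 0 t j]] assms by (simp add: CP0_def)
qed

lemma CP0_0: "CP0 0 = {\<lambda>x. 0}"
proof -
  have "q = (\<lambda>x. 0)" if q: "q \<in> CP0 0" for q
  proof (rule CP_eqI[OF _ CP_zero])
    show qC: "q \<in> CP 0" using q by (simp add: CP0_def)
    fix j :: nat assume j: "j < 6"
    have "bC j (pc j q) a b = 0" for a b
      using CP0_bC[OF q j] bC_eq_0[OF pc_bpoly[OF qC], of a b j j] by (cases "a = 0") auto
    then show "pc j q = pc j (\<lambda>x. 0)"
      using bC_all_0[OF pc_bpoly[OF qC], of j j] by (simp add: pc_zero)
  qed
  then show ?thesis using fun_subspaceD(1)[OF fun_subspace_CP0] by blast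
qed

text \<open>Each piece vanishes on its outer edge, so it is divisible by \<open>mu_loc j\<close>. On
  a spoke the quotients agree wherever the common factor \<open>1 - t\<close> is nonzero, and at the
  outer end by continuity, so they glue to one function.\<close>

lemma CP0_Suc: "CP0 (Suc n) = (\<lambda>p x. mu x * p x) ` CP n"
proof (intro set_eqI iffI)
  fix q assume "q \<in> (\<lambda>p x. mu x * p x) ` CP n"
  then show "q \<in> CP0 (Suc n)" using CP_mult[OF mu(1)] mu_frontier by (auto simp: CP0_def)
next
  fix q assume q: "q \<in> CP0 (Suc n)"
  then have qC: "q \<in> CP (Suc n)" by (simp add: CP0_def)
  \<comment> \<open>The terms without the first coordinate vanish, and dividing the others by it
    lowers the first exponent by one.\<close>
  define R where "R j x = (\<Sum>y\<in>tri n. bC j (pc j q) (Suc (fst y)) (snd y) * (fst (bc j x) ^ fst y * snd (bc j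
      x) ^ snd y))" for j x
  have RP: "R j \<in> bpoly n" for j
    unfolding R_def
  proof (intro bpoly_sum bpoly_cmul)
    fix y assume "y \<in> tri n"
    then show "(\<lambda>x. fst (bc j x) ^ fst y * snd (bc j x) ^ snd y) \<in> bpoly n"
      using bpoly_mono[OF _ bpoly_mult[OF bpoly_power[OF bpoly_fst_acoord, where k = "fst y"] bpoly_power[OF
          bpoly_snd_acoord, where k = "snd y"]], of n]
      by (simp add: tri_def case_prod_beta)
  qed
  have mult: "pc j q x = mu_loc j x * R j x" if j: "j < 6" for j x
  proof -
    let ?c = "bC j (pc j q)" and ?m = "fst (bc j x)" and ?t = "snd (bc j x)"
    have "pc j q (B j (?m, ?t)) = (\<Sum>a\<le>Suc n. \<Sum>b\<le>Suc n - a. ?c a b * ?m ^ a * ?t ^ b)"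
      using bC_expand[OF pc_bpoly[OF qC], of j j ?m ?t] by (simp add: sum_tri)
    also have "\<dots> = (\<Sum>b\<le>Suc n. ?c 0 b * ?m ^ 0 * ?t ^ b) + (\<Sum>a\<le>n. \<Sum>b\<le>n - a. ?c (Suc a) b * ?m ^ Suc a * ?t ^ b)"
      by (subst sum.atMost_Suc_shift) simp
    also have "(\<Sum>b\<le>Suc n. ?c 0 b * ?m ^ 0 * ?t ^ b) = 0"
      by (intro sum.neutral) (simp add: CP0_bC[OF q j])
    also have "0 + (\<Sum>a\<le>n. \<Sum>b\<le>n - a. ?c (Suc a) b * ?m ^ Suc a * ?t ^ b) = ?m * R j x"
      by (simp add: R_def sum_tri sum_distrib_left mult_ac)
    finally show ?thesis by (simp add: mu_loc_def)
  qed
  obtain f where f: "f \<in> CP n" "\<And>j. j < 6 \<Longrightarrow> pc j f = R j"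
  proof (rule CP_glue_spokes[of R n])
    fix j :: nat and t :: real assume j: "j < 6" and t: "0 \<le> t" "t \<le> 1"
    let ?x = "\<lambda>t. z 0 + t *\<^sub>R u (Suc j)"
    let ?d = "\<lambda>t. R j (?x t) - R (Suc j mod 6) (?x t)"
    have "continuous_on (closure {0<..<1}) ?d"
      by (intro continuous_intros continuous_on_compose2[OF bpoly_continuous[OF RP, of UNIV]]) auto
    moreover have "?d t = 0" if "t \<in> {0<..<1}" for t
    proof -
      have "pc j q (?x t) = pc (Suc j mod 6) q (?x t)" by (rule pc_spoke[OF qC j]) (use that in auto)
      then have "(1 - t) * R j (?x t) = (1 - t) * R (Suc j mod 6) (?x t)"
        unfolding mult[OF j] mult[of "Suc j mod 6", simplified] mu_loc_spoke .
      then show ?thesis using that by simp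
    qed
    moreover have "t \<in> closure {0<..<1}" using t by simp
    ultimately have "?d t = 0"
      using continuous_constant_on_closure[of "{0<..<1}" ?d 0 t] by blast
    then show "R j (?x t) = R (Suc j mod 6) (?x t)" by simp
  qed (use RP that in auto)
  have "q = (\<lambda>x. mu x * f x)"
  proof (rule CP_eqI[OF qC CP_mult[OF mu(1) f(1)]])
    fix j :: nat assume j: "j < 6"
    show "pc j q = pc j (\<lambda>x. mu x * f x)"
      unfolding pc_mult[OF mu(1) f(1)] using mult[OF j] f(2)[OF j] mu(2)[OF j] by auto
  qed
  then show "q \<in> (\<lambda>p x. mu x * p x) ` CP n" using f(1) by blast
qed

text \<open>Division by \<open>mu\<close> identifies the space with \<open>CP n\<close>; the factor
  is nonzero inside every small triangle, so nothing is lost.\<close>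

lemma has_dim_CP0: "has_dim (CP0 (Suc n)) (3 * n * (n + 1) + 1)"
  unfolding CP0_Suc
proof (rule has_dim_inj_image[OF fun_subspace_CP has_dim_CP])
  fix f assume f: "f \<in> CP n" "(\<lambda>x. mu x * f x) = (\<lambda>x. 0)"
  show "f = (\<lambda>x. 0)"
  proof (rule CP_eqI[OF f(1) CP_zero])
    fix j :: nat assume j: "j < 6"
    have 0: "mu_loc j x * pc j f x = 0" for x
      using pc_mult[OF mu(1) f(1), of j] f(2) mu(2)[OF j] pc_zero[of j] by (metis (no_types, lifting))
    have "(\<lambda>y. pc j f (E j y)) = (\<lambda>y. 0)"
    proof (rule bpoly_eqI[OF bpoly_comp_E[OF pc_bpoly[OF f(1)]] bpoly_const[of _ 0]])
      fix s t :: real assume "s + t < 1"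
      then show "pc j f (E j (s, t)) = 0" using 0[of "E j (s, t)"] by (auto simp: mu_loc_E)
    qed
    then show "pc j f = pc j (\<lambda>x. 0)" unfolding pc_zero by (metis E_lc ext)
  qed
qed (auto simp: algebra_simps)

text \<open>The mean value condition removes exactly one dimension from \<open>CP0 m\<close>,
  because for positive \<open>m\<close> that space contains \<open>mu\<close>, whose integral is
  nonzero.\<close>

lemma has_dim_L2_ring: "has_dim (L2_ring (int m) z) (3 * m * (m - 1))"
proof (cases m)
  case 0
  have "L2_ring (int 0) z = {\<lambda>x. 0}"
    using CP0_0 fun_subspaceD(1)[OF fun_subspace_L2_ring[of 0]] by (auto simp: L2_ring_iff[of _ 0,
        simplified] CP0_def)
  then show ?thesis using 0 has_dim_zero by simp
next
  case (Suc n)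
  have L: "L2_ring (int m) z = {q \<in> CP0 m. integral (triangle z) q = 0}"
    by (auto simp: L2_ring_iff CP0_def)
  obtain k where k: "has_dim (L2_ring (int m) z) k"
    using has_dim_subspace[OF has_dim_CP0[of n] fun_subspace_L2_ring, of m] L Suc by auto
  have "has_dim (CP0 m) (Suc k)"
  proof (rule has_dim_kernel_Suc[OF fun_subspace_CP0 _ _ _ k[unfolded L]])
    show "linear_functional_on (CP0 m) (integral (triangle z))"
      by (rule linear_functional_onI) (auto simp: CP0_def integral_add integrable_on_triangle CP_continuous)
    show "mu \<in> CP0 m" using mu mu_frontier CP_mono[of 1 m] Suc by (auto simp: CP0_def)
    show "integral (triangle z) mu \<noteq> 0"
      using integral_triangle_eq_0[OF CP_continuous[OF mu(1)] mu_nonneg _ center_in_triangle] mu_center by auto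
  qed
  then have "Suc k = 3 * n * (n + 1) + 1" using has_dim_unique has_dim_CP0 Suc by blast
  then show ?thesis using k Suc by (simp add: algebra_simps)
qed

end

section \<open>Integral of the divergence and stream functions\<close>

lemma bpoly_lipschitz_on:
  assumes p: "p \<in> bpoly n" and "compact S" "convex S"
  shows "\<exists>C\<ge>0. C-lipschitz_on S p"
proof -
  have "bounded (dirD w p ` S)" for w
    by (intro compact_imp_bounded compact_continuous_image bpoly_continuous[OF dirD_bpoly[OF p]] assms)
  then have "\<exists>a. \<forall>x\<in>S. \<bar>dirD w p x\<bar> \<le> a" for w unfolding bounded_iff by auto
  then obtain a where a: "\<And>w x. x \<in> S \<Longrightarrow> \<bar>dirD w p x\<bar> \<le> a w" by metis
  let ?C = "\<bar>a (1, 0)\<bar> + \<bar>a (0, 1)\<bar>"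
  have "?C-lipschitz_on S p"
  proof (rule bounded_derivative_imp_lipschitz[OF _ assms(3)])
    fix x assume x: "x \<in> S"
    show "(p has_derivative (\<lambda>w. dirD w p x)) (at x within S)"
      by (rule has_derivative_at_withinI[OF bpoly_has_derivative[OF p]])
    show "onorm (\<lambda>w. dirD w p x) \<le> ?C"
    proof (rule onorm_le)
      fix w :: R2
      have "\<bar>dirD w p x\<bar> \<le> \<bar>fst w\<bar> * \<bar>dirD (1, 0) p x\<bar> + \<bar>snd w\<bar> * \<bar>dirD (0, 1) p x\<bar>"
        unfolding dirD_components[OF p, of w] by (metis abs_mult abs_triangle_ineq)
      also have "\<dots> \<le> norm w * \<bar>a (1, 0)\<bar> + norm w * \<bar>a (0, 1)\<bar>"
        using a[OF x, of "(1, 0)"] a[OF x, of "(0, 1)"] norm_fst_le[of "fst w" "snd w"] norm_snd_le[of "snd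
            w" "fst w"]
        by (intro add_mono mult_mono) auto
      finally show "norm (dirD w p x) \<le> ?C * norm w" by (simp add: algebra_simps)
    qed
  qed simp
  then show ?thesis by (intro exI[of _ ?C]) simp
qed

lemma bpoly_eq_coeffsI:
  assumes "p \<in> bpoly m" "q \<in> bpoly n" "\<And>i j. bcoeff p i j = bcoeff q i j"
  shows "p = q"
proof -
  have "p \<in> bpoly (max m n)" "q \<in> bpoly (max m n)" using assms by (auto intro: bpoly_mono[rotated])
  then show ?thesis using bpoly_expand[of p "max m n"] bpoly_expand[of q "max m n"] assms(3) by (intro ext) simp
qed

text \<open>A Poincare lemma on the level of coefficients: \<open>Q\<close> integrates
  \<open>p\<close> in the second variable, and its part independent of that variable integrates
  \<open>- q\<close> in the first. The divergence condition makes the remaining coefficients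
  consistent.\<close>

lemma divergence_free_potential:
  assumes p: "p \<in> bpoly n" and q: "q \<in> bpoly n" and div: "\<And>x. dirD (1, 0) p x + dirD (0, 1) q x = 0"
  shows "\<exists>Q\<in>bpoly (Suc n). dirD (0, 1) Q = p \<and> dirD (1, 0) Q = (\<lambda>x. - q x)"
proof -
  define c where "c a b = (if b = 0 then (if a = 0 then 0 else - bcoeff q (a - 1) 0 / real a)
    else bcoeff p a (b - 1) / real b)" for a b
  define Q where "Q x = (\<Sum>(a, b)\<in>tri (Suc n). c a b * fst x ^ a * snd x ^ b)" for x
  have Q: "Q \<in> bpoly (Suc n)" by (rule bpolyI[OF Q_def])
  have "bcoeff Q a b = (if a + b \<le> Suc n then c a b else 0)" for a b
    by (rule bcoeff_unique[OF _ Q]) (simp add: Q_def)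
  moreover have "c a b = 0" if "Suc n < a + b" for a b
    using that bcoeff_eq_0[OF p, of a "b - 1"] bcoeff_eq_0[OF q, of "a - 1" 0] by (auto simp: c_def)
  ultimately have cQ: "bcoeff Q a b = c a b" for a b by (cases "a + b \<le> Suc n") (simp_all add: not_le)
  have "bcoeff (\<lambda>x. dirD (1, 0) p x + dirD (0, 1) q x) a b = 0" for a b by (simp add: div)
  then have d: "real (a + 1) * bcoeff p (a + 1) b + real (b + 1) * bcoeff q a (b + 1) = 0" for a b
    unfolding bcoeff_add[OF dirD_bpoly[OF p] dirD_bpoly[OF q]] bcoeff_dirD_fst[OF p] bcoeff_dirD_snd[OF q] .
  have "dirD (0, 1) Q = p"
    by (rule bpoly_eq_coeffsI[OF dirD_bpoly[OF Q] p]) (simp add: bcoeff_dirD_snd[OF Q] cQ c_def)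
  moreover have "dirD (1, 0) Q = (\<lambda>x. - 1 * q x)"
  proof (rule bpoly_eq_coeffsI[OF dirD_bpoly[OF Q] bpoly_cmul[OF q]])
    fix a b
    show "bcoeff (dirD (1, 0) Q) a b = bcoeff (\<lambda>x. - 1 * q x) a b"
    proof (cases b)
      case 0
      then show ?thesis unfolding bcoeff_dirD_fst[OF Q] bcoeff_cmul[OF q] cQ by (simp add: c_def)
    next
      case (Suc b')
      have "real (a + 1) * bcoeff p (a + 1) b' = - (real b * bcoeff q a b)" using d[of a b'] Suc by simp
      then show ?thesis using Suc unfolding bcoeff_dirD_fst[OF Q] bcoeff_cmul[OF q] cQ
        by (simp add: c_def field_simps)
    qed
  qed
  ultimately show ?thesis using Q by (intro bexI[of _ Q]) auto
qed

context ps_config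
begin

section \<open>The integral of the divergence\<close>

lemma CP0_outside_open:
  assumes "f \<in> CP0 n" "x \<in> - interior (triangle z)" shows "f x = 0"
proof (cases "x \<in> triangle z")
  case True
  then have "x \<in> frontier (triangle z)" using assms(2) closed_triangle by (simp add: frontier_def)
  then show ?thesis using assms(1) by (simp add: CP0_def)
next
  case False
  then show ?thesis using assms(1) CP_outside[of f n x] by (simp add: CP0_def)
qed

text \<open>The segment from \<open>x\<close> to \<open>y\<close> is covered by seven closed
  parameter sets: six from the small triangles and one, with index 6, from the complement of the
  open triangle, where the extension by zero vanishes. Lipschitz bounds on finitely many closed sets
  combine along the segment. The bound later dominates the difference quotients.\<close>

lemma CP0_lipschitz:
  assumes f: "f \<in> CP0 n"
  shows "\<exists>L\<ge>0. \<forall>x y. \<bar>f x - f y\<bar> \<le> L * dist x y"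
proof -
  have fC: "f \<in> CP n" using f by (simp add: CP0_def)
  have "\<exists>C\<ge>0. C-lipschitz_on (tri_ps z j) (pc j f)" for j
    by (rule bpoly_lipschitz_on[OF pc_bpoly[OF fC] compact_tri_ps convex_tri_ps])
  then obtain C where C: "\<And>j. 0 \<le> C j" "\<And>j. (C j)-lipschitz_on (tri_ps z j) (pc j f)" by metis
  define L where "L = (\<Sum>j<6. C j)"
  have L: "0 \<le> L" "j < 6 \<Longrightarrow> C j \<le> L" for j
    unfolding L_def using C(1) by (auto intro!: sum_nonneg member_le_sum)
  have "\<bar>f x - f y\<bar> \<le> L * dist x y" for x y
  proof -
    let ?g = "\<lambda>t::real. x + t *\<^sub>R (y - x)"
    have cont: "continuous_on UNIV ?g" by (intro continuous_intros)
    define U where "U i = (if i < 6 then ?g -` tri_ps z i else ?g -` (- interior (triangle z)))" for i :: nat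
    have "(L * dist x y)-lipschitz_on {0..1} (\<lambda>t. f (?g t))"
    proof (rule lipschitz_on_closed_Union[where I = "{..6}" and U = U])
      show "closed (U i)" for i
        unfolding U_def using closed_tri_ps
        by (auto intro!: closed_vimage cont simp: continuous_on_id)
      show "{0..1} \<subseteq> (\<Union>i\<in>{..6}. U i)"
      proof
        fix t :: real
        show "t \<in> (\<Union>i\<in>{..6}. U i)"
        proof (cases "?g t \<in> triangle z")
          case True
          then obtain j where "j < 6" "?g t \<in> tri_ps z j" using in_some_tri by blast
          then show ?thesis by (intro UN_I[of j]) (auto simp: U_def)
        next
          case False
          then have "?g t \<in> - interior (triangle z)" using interior_subset by blast
          then show ?thesis by (intro UN_I[of 6]) (auto simp: U_def)
        qed
      qed
      show "(L * dist x y)-lipschitz_on (U i) (\<lambda>t. f (?g t))" if "i \<in> {..6}" for i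
      proof (rule lipschitz_onI)
        fix s t assume st: "s \<in> U i" "t \<in> U i"
        have gd: "dist (?g s) (?g t) = dist x y * dist s t"
        proof -
          have "?g s - ?g t = (s - t) *\<^sub>R (y - x)" by (simp add: algebra_simps)
          then show ?thesis by (simp add: dist_norm norm_minus_commute)
        qed
        show "dist (f (?g s)) (f (?g t)) \<le> L * dist x y * dist s t"
        proof (cases "i < 6")
          case True
          then have "?g s \<in> tri_ps z i" "?g t \<in> tri_ps z i" using st by (auto simp: U_def)
          then have "dist (f (?g s)) (f (?g t)) \<le> C i * dist (?g s) (?g t)"
            using lipschitz_onD[OF C(2)] pc_eq[OF fC, of _ i] by metis
          also have "\<dots> \<le> L * dist (?g s) (?g t)" by (intro mult_right_mono L True) simp
          finally show ?thesis unfolding gd by (simp only: mult.assoc)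
        next
          case False
          then have "f (?g s) = 0" "f (?g t) = 0" using st CP0_outside_open[OF f] by (auto simp: U_def)
          then show ?thesis using L(1) by simp
        qed
      qed (use L(1) in simp)
    qed (use L(1) in auto)
    then have "dist (f (?g 0)) (f (?g 1)) \<le> L * dist x y * dist 0 (1::real)" by (rule lipschitz_onD) auto
    then show ?thesis by (simp add: dist_real_def)
  qed
  then show ?thesis using L(1) by blast
qed

lemma CP_integrable:
  assumes "f \<in> CP n" shows "integrable lborel f"
proof -
  have "integrable lborel (\<lambda>x. indicator (triangle z) x *\<^sub>R f x)"
    by (rule borel_integrable_compact[OF compact_triangle CP_continuous[OF assms]])
  moreover have "(\<lambda>x. indicator (triangle z) x *\<^sub>R f x) = f"
    by (rule ext) (auto simp: indicator_def CP_outside[OF assms])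
  ultimately show ?thesis by simp
qed

lemma integral_shift:
  fixes f :: "R2 \<Rightarrow> real"
  assumes "integrable lborel f"
  shows "integrable lborel (\<lambda>x. f (c + x))" "integral\<^sup>L lborel (\<lambda>x. f (c + x)) = integral\<^sup>L lborel f"
proof -
  have m: "(+) c \<in> measurable lborel borel" by simp
  have f: "f \<in> borel_measurable borel" using borel_measurable_integrable[OF assms] by simp
  show "integrable lborel (\<lambda>x. f (c + x))"
    using integrable_distr[OF m, of f] assms lborel_distr_plus[of c] by simp
  show "integral\<^sup>L lborel (\<lambda>x. f (c + x)) = integral\<^sup>L lborel f"
    using integral_distr[OF m f] lborel_distr_plus[of c] by simp
qed

text \<open>Frontiers of convex sets are null sets, so missing derivatives on spokes and on the
  boundary do not affect the limit of the integrals.\<close>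

lemma AE_interior_or_outside:
  "AE x in lborel. x \<notin> triangle z \<or> (\<exists>j<6. x \<in> interior (tri_ps z j))"
proof -
  have "frontier (tri_ps z j) \<in> null_sets lborel" for j
    using negligible_convex_frontier[OF convex_tri_ps[of j]] borel_closed[OF frontier_closed[of "tri_ps z j"]]
    by (simp add: null_sets_completion_iff negligible_iff_null_sets)
  then have "(\<Union>j<6. frontier (tri_ps z j)) \<in> null_sets lborel" by (intro null_sets_UN') auto
  then have "AE x in lborel. x \<notin> (\<Union>j<6. frontier (tri_ps z j))" by (rule AE_not_in)
  then show ?thesis
  proof eventually_elim
    case (elim x)
    show ?case
    proof (cases "x \<in> triangle z")
      case True
      then obtain j where "j < 6" "x \<in> tri_ps z j" using in_some_tri by blast
      then show ?thesis using elim closed_tri_ps[of j] by (auto simp: frontier_def)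
    qed simp
  qed
qed

text \<open>The increments \<open>1 / real (Suc n)\<close> give a sequence, as dominated convergence
  requires, and are never zero.\<close>

lemma difference_quotient_limit:
  assumes "(f has_derivative D) (at x)"
  shows "(\<lambda>n. real (Suc n) * (f ((1 / real (Suc n)) *\<^sub>R w + x) - f x)) \<longlonglongrightarrow> (D w :: real)"
proof -
  have "((\<lambda>t. x + t *\<^sub>R w) has_derivative (\<lambda>t. t *\<^sub>R w)) (at 0)" by (auto intro!: derivative_eq_intros)
  then have "((\<lambda>t. f (x + t *\<^sub>R w)) has_derivative (\<lambda>t. D (t *\<^sub>R w))) (at 0)"
    by (rule has_derivative_compose) (simp add: assms)
  moreover have "linear D" using assms has_derivative_linear by blast
  ultimately have "((\<lambda>t. f (x + t *\<^sub>R w)) has_real_derivative D w) (at 0)"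
    by (simp add: has_field_derivative_def linear_scale mult_commute_abs)
  then have "((\<lambda>h. (f (x + h *\<^sub>R w) - f x) / h) \<longlongrightarrow> D w) (at 0)"
    by (simp add: DERIV_def)
  moreover have "filterlim (\<lambda>n. 1 / real (Suc n)) (at 0) sequentially"
    unfolding filterlim_at using LIMSEQ_inverse_real_of_nat by (auto simp: inverse_eq_divide)
  ultimately have "(\<lambda>n. (f (x + (1 / real (Suc n)) *\<^sub>R w) - f x) / (1 / real (Suc n))) \<longlonglongrightarrow> D w"
    by (rule filterlim_compose)
  then show ?thesis by (simp add: add.commute mult.commute)
qed

text \<open>The integral of each difference quotient vanishes by translation invariance; they converge
  boundedly to the divergence.\<close>

lemma integral_cdiv_0:
  assumes v: "v \<in> S1 (int n) z" and bd: "\<And>x. x \<in> frontier (triangle z) \<Longrightarrow> v x = 0"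
  shows "integral (triangle z) (cdiv z v) = 0"
proof -
  let ?f = "fst \<circ> v" and ?g = "snd \<circ> v"
  note V = S1_VP[OF v]
  have f: "?f \<in> CP0 n" "?g \<in> CP0 n" using VP_D[OF V] bd by (auto simp: CP0_def)
  then have C: "?f \<in> CP n" "?g \<in> CP n" by (auto simp: CP0_def)
  define q where "q h w m x = real (Suc m) * (h ((1 / real (Suc m)) *\<^sub>R w + x) - h x)"
    for h :: "R2 \<Rightarrow> real" and w m x
  obtain L1 L2 where L: "0 \<le> L1" "\<And>x y. \<bar>?f x - ?f y\<bar> \<le> L1 * dist x y" "0 \<le> L2" "\<And>x y. \<bar>?g x - ?g y\<bar> \<le> L2 *
      dist x y"
    using CP0_lipschitz[OF f(1)] CP0_lipschitz[OF f(2)] by blast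
  obtain R where R: "\<And>x. x \<in> triangle z \<Longrightarrow> norm x \<le> R"
    using compact_imp_bounded[OF compact_triangle] unfolding bounded_iff by blast
  \<comment> \<open>The shifts have length at most 1, so all difference quotients vanish outside one
    ball, and the Lipschitz constant times its indicator is an integrable majorant.\<close>
  have qb: "\<bar>q h w m x\<bar> \<le> L * indicator (cball 0 (R + 1)) x"
    if h: "h \<in> CP n" "0 \<le> L" "\<And>x y. \<bar>h x - h y\<bar> \<le> L * dist x y" "norm w = 1" for h w m x L
  proof (cases "norm x \<le> R + 1")
    case True
    have "\<bar>h ((1 / real (Suc m)) *\<^sub>R w + x) - h x\<bar> \<le> L * (1 / real (Suc m))"
      using h(3)[of "(1 / real (Suc m)) *\<^sub>R w + x" x] h(4) by (simp add: dist_norm)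
    then have "real (Suc m) * \<bar>h ((1 / real (Suc m)) *\<^sub>R w + x) - h x\<bar> \<le> real (Suc m) * (L * (1 / real (Suc m)))"
      by (rule mult_left_mono) simp
    then show ?thesis using True by (simp add: q_def abs_mult)
  next
    case False
    define d where "d = (1 / real (Suc m)) *\<^sub>R w"
    have "norm x \<le> norm (d + x) + norm d" using norm_triangle_ineq4[of "d + x" d] by simp
    moreover have "norm d \<le> 1" using h(4) by (simp add: d_def)
    ultimately have "x \<notin> triangle z" "(1 / real (Suc m)) *\<^sub>R w + x \<notin> triangle z"
      using False R[of x] R[of "d + x"] unfolding d_def[symmetric] by linarith+
    then have "q h w m x = 0" unfolding q_def using CP_outside[OF h(1)] by simp
    then show ?thesis using h(2) by simp
  qed
  have qi: "integrable lborel (q h w m) \<and> integral\<^sup>L lborel (q h w m) = 0" if "h \<in> CP n" for h w m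
    unfolding q_def[abs_def] using integral_shift[OF CP_integrable[OF that], of "(1 / real (Suc m)) *\<^sub>R w"]
        CP_integrable[OF that]
    by simp
  let ?s = "\<lambda>m x. q ?f (1, 0) m x + q ?g (0, 1) m x"
  have "(\<lambda>m. integral\<^sup>L lborel (?s m)) \<longlonglongrightarrow> integral\<^sup>L lborel (cdiv z v)"
  proof (rule integral_dominated_convergence[where w = "\<lambda>x. (L1 + L2) * indicator (cball 0 (R + 1)) x"])
    show "cdiv z v \<in> borel_measurable lborel"
      using CP_integrable[OF cdiv_CP(1)[OF v]] by (rule borel_measurable_integrable)
    show "?s m \<in> borel_measurable lborel" for m
      using qi[OF C(1), of "(1, 0)" m] qi[OF C(2), of "(0, 1)" m] by (intro borel_measurable_add
          borel_measurable_integrable) auto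
    show "integrable lborel (\<lambda>x::R2. (L1 + L2) * indicator (cball 0 (R + 1)) x)"
      by (intro integrable_mult_right integrable_real_indicator) (use emeasure_bounded_finite[OF
          bounded_cball[of "0::R2" "R + 1"]] in auto)
    show "AE x in lborel. norm (?s m x) \<le> (L1 + L2) * indicator (cball 0 (R + 1)) x" for m
    proof (intro always_eventually allI)
      fix x
      have "norm (?s m x) \<le> \<bar>q ?f (1, 0) m x\<bar> + \<bar>q ?g (0, 1) m x\<bar>" by simp
      also have "\<dots> \<le> L1 * indicator (cball 0 (R + 1)) x + L2 * indicator (cball 0 (R + 1)) x"
        by (intro add_mono qb C L) (simp_all add: norm_prod_def)
      finally show "norm (?s m x) \<le> (L1 + L2) * indicator (cball 0 (R + 1)) x" by (simp add: distrib_right)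
    qed
    show "AE x in lborel. (\<lambda>m. ?s m x) \<longlonglongrightarrow> cdiv z v x"
      using AE_interior_or_outside
    proof eventually_elim
      case (elim x)
      have lim: "(\<lambda>m. q h w m x) \<longlonglongrightarrow> dirD w p x"
        if "p \<in> bpoly k" "open S" "x \<in> S" "\<And>y. y \<in> S \<Longrightarrow> h y = p y" for h p w k S
      proof -
        have "(h has_derivative (\<lambda>w. dirD w p x)) (at x)"
          using has_derivative_transform_within_open[OF bpoly_has_derivative[OF that(1)] that(2,3)] that(4)
              by simp
        then show ?thesis unfolding q_def by (rule difference_quotient_limit)
      qed
      show ?case
      proof (cases "x \<in> triangle z")
        case False
        have z0: "dirD w (\<lambda>x. 0) x = 0" for w by (rule dirD_eqI) simp
        have "(\<lambda>m. q h w m x) \<longlonglongrightarrow> 0" if "h \<in> CP n" for h w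
          using lim[OF bpoly_const, of "- triangle z" h 0 w] False closed_triangle CP_outside[OF that] z0 by
              auto
        from tendsto_add[OF this[OF C(1)] this[OF C(2)]] show ?thesis using cdiv_eq(2)[OF v False] by simp
      next
        case True
        then obtain j where j: "j < 6" "x \<in> interior (tri_ps z j)" using elim by blast
        have "(\<lambda>m. q h w m x) \<longlonglongrightarrow> dirD w (pc j h) x" if "h \<in> CP n" for h w
          by (rule lim[OF pc_bpoly[OF that] open_interior j(2)]) (use pc_eq[OF that] interior_subset in blast)
        from tendsto_add[OF this[OF C(1), of "(1, 0)"] this[OF C(2), of "(0, 1)"]]
        have "(\<lambda>m. ?s m x) \<longlonglongrightarrow> divp j v x" unfolding divp_def .
        moreover have "x \<in> tri_ps z j" using j(2) interior_subset by blast
        ultimately show ?thesis using cdiv_eq(1)[OF v, of x j] by simp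
      qed
    qed
  qed
  moreover have "integral\<^sup>L lborel (?s m) = 0" for m
    using qi[OF C(1), of "(1, 0)" m] qi[OF C(2), of "(0, 1)" m] by simp
  ultimately have "integral\<^sup>L lborel (cdiv z v) = 0" by (simp add: LIMSEQ_const_iff)
  then have "(cdiv z v has_integral 0) UNIV"
    using has_integral_integral_lborel[OF CP_integrable[OF cdiv_CP(1)[OF v]]] by simp
  moreover have "cdiv z v = (\<lambda>x. if x \<in> triangle z then cdiv z v x else 0)"
    using cdiv_eq(2)[OF v] by auto
  ultimately have "(cdiv z v has_integral 0) (triangle z)"
    using has_integral_restrict_UNIV[of "triangle z" "cdiv z v" 0] by simp
  then show ?thesis by (rule integral_unique)
qed

text \<open>Each small triangle has its own potential. Normalised to 0 at the centre these agree on
  overlaps: along the segment from the centre to a common point their derivatives coincide. The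
  rotation is \<open>v\<close>, so the glued potential is constant along the boundary, and
  subtracting that constant gives the boundary values.\<close>

lemma stream_function:
  assumes v: "v \<in> VP r" and div: "\<And>j. j < 6 \<Longrightarrow> divp j v = (\<lambda>x. 0)"
    and bd: "\<And>x. x \<in> frontier (triangle z) \<Longrightarrow> v x = 0"
  shows "\<exists>q\<in>S0_ring (int (r + 1)) z. crot z q = v"
proof -
  let ?p = "\<lambda>j. pc j (fst \<circ> v)" and ?q = "\<lambda>j. pc j (snd \<circ> v)"
  note C = VP_D[OF v]
  have "\<exists>Q\<in>bpoly (Suc r). dirD (0, 1) Q = ?p j \<and> dirD (1, 0) Q = (\<lambda>x. - ?q j x)" if "j < 6" for j
    using divergence_free_potential[OF pc_bpoly[OF C(1)] pc_bpoly[OF C(2)], of j j] div[OF that]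
    by (metis divp_def)
  then obtain Q where Q: "\<And>j. j < 6 \<Longrightarrow> Q j \<in> bpoly (Suc r)" "\<And>j. j < 6 \<Longrightarrow> dirD (0, 1) (Q j) = ?p j"
    "\<And>j. j < 6 \<Longrightarrow> dirD (1, 0) (Q j) = (\<lambda>x. - ?q j x)" by metis
  have dQ: "dirD w (Q j) x = snd w * ?p j x - fst w * ?q j x" if "j < 6" for w j x
    using dirD_components[OF Q(1)[OF that], of w x] Q(2,3)[OF that] by simp
  have const: "Q i (a + w) - Q j (a + w) = Q i a - Q j a"
    if "i < 6" "j < 6" "\<And>t. 0 < t \<Longrightarrow> t < 1 \<Longrightarrow> dirD w (Q i) (a + t *\<^sub>R w) = dirD w (Q j) (a + t *\<^sub>R w)" for i j a w
  proof -
    have "Q i (a + 1 *\<^sub>R w) - Q j (a + 1 *\<^sub>R w) = Q i (a + 0 *\<^sub>R w) - Q j (a + 0 *\<^sub>R w)"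
    proof (rule DERIV_isconst_end[of 0 1 "\<lambda>t. Q i (a + t *\<^sub>R w) - Q j (a + t *\<^sub>R w)"])
      show "continuous_on {0..1} (\<lambda>t. Q i (a + t *\<^sub>R w) - Q j (a + t *\<^sub>R w))"
        by (intro continuous_intros continuous_on_compose2[OF bpoly_continuous[OF Q(1), of _ UNIV]]
            that(1,2)) auto
      fix t :: real assume "0 < t" "t < 1"
      then show "((\<lambda>t. Q i (a + t *\<^sub>R w) - Q j (a + t *\<^sub>R w)) has_real_derivative 0) (at t)"
        using DERIV_diff[OF has_derivative_along_line[OF Q(1)[OF that(1)], of a w t]
            has_derivative_along_line[OF Q(1)[OF that(2)], of a w t]] that(3)
        by simp
    qed simp
    then show ?thesis by simp
  qed
  define R where "R j x = Q j x - Q j (z 0)" for j x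
  have RP: "R j \<in> bpoly (Suc r)" if "j < 6" for j
    unfolding R_def by (intro bpoly_diff Q that bpoly_const)
  have dR: "dirD w (R j) x = dirD w (Q j) x" if "j < 6" for w j x
  proof -
    have "dirD w (\<lambda>x. Q j (z 0)) x = 0" by (rule dirD_eqI) simp
    then show ?thesis unfolding R_def[abs_def] by (simp add: dirD_diff[OF Q(1)[OF that] bpoly_const])
  qed
  obtain f where f: "f \<in> CP (Suc r)" "\<And>j. j < 6 \<Longrightarrow> pc j f = R j"
  proof (rule CP_glue[of R "Suc r"])
    fix i j :: nat and x assume ij: "i < 6" "j < 6" "x \<in> tri_ps z i" "x \<in> tri_ps z j"
    have "Q i (z 0 + (x - z 0)) - Q j (z 0 + (x - z 0)) = Q i (z 0) - Q j (z 0)"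
    proof (rule const[OF ij(1,2)])
      fix t :: real assume t: "0 < t" "t < 1"
      have eq: "z 0 + t *\<^sub>R (x - z 0) = (1 - t) *\<^sub>R z 0 + t *\<^sub>R x" by (simp add: algebra_simps)
      have "z 0 + t *\<^sub>R (x - z 0) \<in> tri_ps z i" "z 0 + t *\<^sub>R (x - z 0) \<in> tri_ps z j"
        unfolding eq using t ij center_in_tri_ps convexD_alt[OF convex_tri_ps] by auto
      then show "dirD (x - z 0) (Q i) (z 0 + t *\<^sub>R (x - z 0)) = dirD (x - z 0) (Q j) (z 0 + t *\<^sub>R (x - z 0))"
        unfolding dQ[OF ij(1)] dQ[OF ij(2)] using pc_agree[OF C(1)] pc_agree[OF C(2)] by metis
    qed
    then show "R i x = R j x" by (simp add: R_def)
  qed (use RP that in auto)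
  have fB: "f (B j (0, t)) = f (Bo j)" if j: "j < 6" and t: "0 \<le> t" "t \<le> 1" for j t
  proof -
    have "R j (Bo j + 1 *\<^sub>R (t *\<^sub>R Bw j)) = R j (Bo j + 0 *\<^sub>R (t *\<^sub>R Bw j))"
    proof (rule DERIV_isconst_end[of 0 1 "\<lambda>s. R j (Bo j + s *\<^sub>R (t *\<^sub>R Bw j))"])
      show "continuous_on {0..1} (\<lambda>s. R j (Bo j + s *\<^sub>R (t *\<^sub>R Bw j)))"
        by (intro continuous_intros continuous_on_compose2[OF bpoly_continuous[OF RP[OF j], of UNIV]]) auto
      fix s :: real assume s: "0 < s" "s < 1"
      let ?x = "Bo j + s *\<^sub>R (t *\<^sub>R Bw j)"
      have x: "?x = B j (0, s * t)" by (simp add: B_eq)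
      have st: "0 \<le> s * t" "s * t \<le> 1" using s t by (auto intro: mult_le_one)
      have "v ?x = 0" unfolding x by (rule bd[OF B_outer[OF st j]])
      moreover have "?x \<in> tri_ps z j" unfolding x using B_in_tri_ps[of 0 "s * t" j] st by simp
      ultimately have "?p j ?x = 0" "?q j ?x = 0" using pc_eq[OF C(1), of ?x j] pc_eq[OF C(2), of ?x j] by auto
      then have "dirD (t *\<^sub>R Bw j) (R j) ?x = 0" unfolding dR[OF j] dQ[OF j] by simp
      then show "((\<lambda>s. R j (Bo j + s *\<^sub>R (t *\<^sub>R Bw j))) has_real_derivative 0) (at s)"
        using has_derivative_along_line[OF RP[OF j], of "Bo j" "t *\<^sub>R Bw j" s] by simp
    qed simp
    then have "R j (B j (0, t)) = R j (B j (0, 0))" by (simp add: B_eq)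
    moreover have "B j (0, 0) = Bo j" by (simp add: B_eq)
    ultimately show ?thesis
      using pc_eq[OF f(1) B_in_tri_ps[of 0 t j]] pc_eq[OF f(1) B_in_tri_ps[of 0 0 j]] f(2)[OF j] t by simp
  qed
  define c where "c = f (hex z 0)"
  have Bo_eq: "f (Bo j) = f (hex z j) \<and> f (Bo j) = f (hex z (Suc j))" if "j < 6" for j
    using fB[OF that, of 1] by (auto simp: B_eq Bo_def Bw_def corner_def midpt_def)
  \<comment> \<open>Consecutive outer edges share an end point, so the constants on all six edges
    are equal.\<close>
  have hexc: "f (hex z j) = c" if "j < 6" for j
    using that
  proof (induction j)
    case (Suc j)
    then show ?case using Bo_eq[of j] by simp
  qed (simp add: c_def)
  have fc: "f x = c" if "x \<in> frontier (triangle z)" for x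
    using that fB hexc Bo_eq unfolding frontier_B by metis
  \<comment> \<open>\<open>CP_basis None\<close> is 1 on the triangle and 0 outside, so the
    subtraction preserves the extension by zero.\<close>
  let ?g = "\<lambda>x. f x + (- c) * CP_basis None x"
  have b: "(\<lambda>x. (- c) * CP_basis None x) \<in> CP (Suc r)" by (rule CP_cmul[OF CP_basis_None(1)])
  have g: "?g \<in> CP (Suc r)" by (rule CP_add[OF f(1) b])
  have pg: "pc j ?g = (\<lambda>x. R j x - c)" if "j < 6" for j
    using pc_add[OF f(1) b, of j] pc_cmul[OF CP_basis_None(1)[of "Suc r"], of j "- c"] CP_basis_None(2)[of
        j] f(2)[OF that] by simp
  have rot: "rotp j ?g x = v x" if "j < 6" "x \<in> tri_ps z j" for j x
  proof -
    have "dirD w (\<lambda>x. c) x = 0" for w by (rule dirD_eqI) simp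
    then have "dirD w (\<lambda>x. R j x - c) x = snd w * ?p j x - fst w * ?q j x" for w
      using dirD_diff[OF RP[OF that(1)] bpoly_const, of w c x] dR[OF that(1)] dQ[OF that(1)] by simp
    then show ?thesis unfolding rotp_def pg[OF that(1)]
      using pc_eq[OF C(1) that(2)] pc_eq[OF C(2) that(2)] by (simp add: prod_eq_iff)
  qed
  have C1: "?g \<in> C1 (Suc r)" unfolding C1_iff agree_def using g rot by auto
  have cr: "crot z ?g = v"
  proof (rule crot_eqI[OF C1])
    show "v x = 0" if "x \<notin> triangle z" for x
      using CP_outside[OF C(1) that] CP_outside[OF C(2) that] by (simp add: prod_eq_iff)
  qed (use rot in simp)
  have "CP_basis None x = 1" if "x \<in> frontier (triangle z)" for x
    using that closed_triangle unfolding frontier_def by (auto simp: CP_basis_def)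
  then have "?g \<in> S0_ring (int (r + 1)) z"
    using S0_ring_iff[of ?g "Suc r"] C1 cr bd fc by simp
  then show ?thesis using cr by blast
qed

end

section \<open>Unisolvence\<close>

lemma pderiv_0_const:
  fixes p :: "real poly"
  assumes "pderiv p = 0" shows "poly p s = poly p t"
proof -
  have "degree p = 0" using assms by (simp add: pderiv_eq_0_iff)
  then obtain c where "p = [:c:]" by (rule degree_eq_zeroE)
  then show ?thesis by simp
qed

lemma poly_square_integral_0_const:
  fixes p :: "real poly"
  assumes "integral {0..1} (\<lambda>t. (poly (pderiv p) t)\<^sup>2) = 0"
  shows "poly p s = poly p t"
  using poly_square_integral_0[OF assms] by (rule pderiv_0_const)

text \<open>The second derivative of \<open>G\<close>, lifted to the segment by
  \<open>seg_param\<close>, is an admissible test function. For affine \<open>G\<close> it is zero;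
  this case includes all \<open>n < 2\<close>, where the test space is trivial.\<close>

lemma edge_moments_orthogonal:
  assumes "a \<noteq> b" and G: "degree G \<le> n" "\<And>t. 0 \<le> t \<Longrightarrow> t \<le> 1 \<Longrightarrow> f (linepath a b t) = poly G t"
    and mom: "\<And>q. q \<in> poly_on (int n - 2) (closed_segment a b) \<Longrightarrow>
      integral {0..1} (\<lambda>t. f (linepath a b t) * q (linepath a b t)) = 0"
  shows "integral {0..1} (\<lambda>t. poly G t * poly (pderiv (pderiv G)) t) = 0"
proof (cases "degree G \<le> 1")
  case True
  then have "pderiv (pderiv G) = 0" by (simp add: pderiv_eq_0_iff degree_pderiv)
  then show ?thesis by simp
next
  case False
  then have n: "int n - 2 = int (n - 2)" using G(1) by simp
  let ?H = "pderiv (pderiv G)"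
  let ?q = "\<lambda>x. if x \<in> closed_segment a b then poly ?H (seg_param a b x) else 0"
  have "degree ?H \<le> n - 2" using G(1) by (simp add: degree_pderiv)
  then have "?q \<in> poly_on (int n - 2) (closed_segment a b)"
    unfolding n poly_on_int_iff by (intro bexI[OF refl bpoly_poly_seg_param])
  then have "integral {0..1} (\<lambda>t. f (linepath a b t) * ?q (linepath a b t)) = 0" by (rule mom)
  moreover have "integral {0..1} (\<lambda>t. f (linepath a b t) * ?q (linepath a b t)) = integral {0..1} (\<lambda>t. poly
      G t * poly ?H t)"
    using closed_segment_linepath G(2) seg_param_linepath[OF assms(1)] by (intro integral_cong) auto
  ultimately show ?thesis by simp
qed

text \<open>A matrix that kills \<open>s\<close> and maps the independent vector \<open>d\<close> to
  a multiple of \<open>d\<close> has that multiple as its trace; trace 0 gives the claim. The matrix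
  in question is the jump of the gradient at an edge point.\<close>

lemma trace_free_2x2:
  fixes m11 m12 m21 m22 s1 s2 d1 d2 :: real
  assumes "m11 * s1 + m12 * s2 = 0" "m21 * s1 + m22 * s2 = 0" "m11 + m22 = 0"
    "(m11 * d1 + m12 * d2) * d2 = (m21 * d1 + m22 * d2) * d1" "s1 * d2 - s2 * d1 \<noteq> 0"
  shows "m11 * d1 + m12 * d2 = 0" "m21 * d1 + m22 * d2 = 0"
proof -
  let ?X = "m11 * d1 + m12 * d2" and ?Y = "m21 * d1 + m22 * d2"
  have "s1 * ?Y - s2 * ?X = (m11 + m22) * (s1 * d2 - s2 * d1) - ((m11 * s1 + m12 * s2) * d2 - (m21 * s1 +
      m22 * s2) * d1)"
    by (simp add: algebra_simps)
  then have XY: "s1 * ?Y = s2 * ?X" using assms(1-3) by simp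
  have "?X * (s1 * d2 - s2 * d1) = s1 * (?X * d2) - (s2 * ?X) * d1" by (simp only: algebra_simps)
  also have "\<dots> = s1 * (?Y * d1) - (s1 * ?Y) * d1" using XY assms(4) by simp
  also have "\<dots> = 0" by (simp only: mult.assoc diff_self)
  finally show X: "?X = 0" using assms(5) by simp
  have "s1 * ?Y = 0" "?Y * d1 = 0" using XY assms(4) X by simp_all
  then show "?Y = 0" using assms(5) by auto
qed

lemma inner_normal: "y \<bullet> normal (a, b) = cross y (b - a) / norm (b - a)"
proof -
  have "y \<bullet> normal (a, b) = 1 / norm (b - a) * (y \<bullet> (snd (b - a), - fst (b - a)))"
    by (simp only: normal_def Let_def fst_conv snd_conv inner_scaleR_right)
  also have "y \<bullet> (snd (b - a), - fst (b - a)) = cross y (b - a)"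
    by (simp add: inner_prod_def cross_def algebra_simps del: cross_simps)
  finally show ?thesis by simp
qed

lemma orthogonal_both_0:
  fixes y d :: R2
  assumes "d \<bullet> y = 0" "cross y d = 0" "d \<noteq> 0" shows "y = 0"
proof -
  have e: "fst d * fst y + snd d * snd y = 0" "fst y * snd d - snd y * fst d = 0"
    using assms by (simp_all add: inner_prod_def cross_def)
  have "(fst d * fst d + snd d * snd d) * fst y = fst d * (fst d * fst y + snd d * snd y) + snd d * (fst y *
      snd d - snd y * fst d)"
    "(fst d * fst d + snd d * snd d) * snd y = snd d * (fst d * fst y + snd d * snd y) - fst d * (fst y *
        snd d - snd y * fst d)"
    by (simp_all add: algebra_simps)
  then have "(fst d * fst d + snd d * snd d) * fst y = 0" "(fst d * fst d + snd d * snd d) * snd y = 0"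
      using e by simp_all
  moreover have "fst d * fst d + snd d * snd d \<noteq> 0" using assms(3) by (simp add: prod_eq_iff
      sum_squares_eq_zero_iff)
  ultimately have "fst y = 0" "snd y = 0" using mult_eq_0_iff by blast+
  then show ?thesis by (simp add: prod_eq_iff)
qed

context ps_config
begin

section \<open>Traces on the boundary edges\<close>

definition dv :: "nat \<Rightarrow> R2" where "dv j = hex z (Suc j) - hex z j"

lemma linepath_hex: "linepath (hex z j) (hex z (Suc j)) t = hex z j + t *\<^sub>R dv j"
  by (simp add: linepath_def dv_def algebra_simps)

lemma dv_u: "dv j = u (Suc j) - u j" by (simp add: dv_def u_def)

lemma cross_spoke_dv: "cross (u (Suc j)) (dv j) > 0"
  using cross_u_Suc[of j] cross_commute[of "u j" "u (Suc j)"] by (simp add: dv_u)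

lemma dv_nz: "dv j \<noteq> 0" using cross_spoke_dv[of j] by auto

lemma hex_neq: "hex z j \<noteq> hex z (Suc j)" using dv_nz[of j] by (auto simp: dv_def)

lemma linepath_in_tri_ps: "0 \<le> t \<Longrightarrow> t \<le> 1 \<Longrightarrow> linepath (hex z j) (hex z (Suc j)) t \<in> tri_ps z j"
  using E_in_tri_ps[of "1 - t" t j] by (simp add: E_eq u_def linepath_def algebra_simps)

lemma edge_poly:
  assumes "f \<in> CP n"
  obtains G where "degree G \<le> n" "\<And>t. 0 \<le> t \<Longrightarrow> t \<le> 1 \<Longrightarrow> f (linepath (hex z j) (hex z (Suc j)) t) = poly G t"
    "\<And>t. dirD (dv j) (pc j f) (hex z j + t *\<^sub>R dv j) = poly (pderiv G) t"
proof -
  obtain G where G: "degree G \<le> n" "\<And>t. pc j f (hex z j + t *\<^sub>R dv j) = poly G t"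
    using bpoly_along_line[OF pc_bpoly[OF assms]] by metis
  show thesis
  proof (rule that[OF G(1)])
    show "f (linepath (hex z j) (hex z (Suc j)) t) = poly G t" if "0 \<le> t" "t \<le> 1" for t
      using pc_eq[OF assms linepath_in_tri_ps[OF that]] G(2) by (simp add: linepath_hex)
  qed (rule dirD_along_line[OF pc_bpoly[OF assms] G(2)])
qed

lemma dv_even:
  assumes "even j" "j < 6"
  obtains K where "0 < K" "dv (Suc j) = K *\<^sub>R dv j"
proof -
  obtain K where K: "0 < K" "Bw (Suc j) = (- K) *\<^sub>R Bw j" using midpoint_opposite[OF assms] .
  moreover have "Bw j = dv j" "Bw (Suc j) = - dv (Suc j)" using assms(1) by (simp_all add: Bw_def dv_def
      corner_def midpt_def)
  ultimately show ?thesis using that[of K] by simp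
qed

lemma macro_edge:
  assumes "even j" "j < 6"
  shows "\<exists>i\<in>{1,2,3}. opp_edge z i = (hex z j, hex z (Suc (Suc j))) \<and> z (3 + i) = hex z (Suc j)"
proof -
  have n: "nxt 1 = 2" "nxt 2 = 3" "nxt 3 = 1" by (simp_all add: nxt_def)
  have o: "opp_edge z 3 = (z 1, z 2)" "opp_edge z 1 = (z 2, z 3)" "opp_edge z 2 = (z 3, z 1)"
    by (simp_all only: opp_edge_def n)
  have h: "hex z 0 = z 1" "hex z (Suc 0) = z 6" "hex z (Suc (Suc 0)) = z 2" "hex z 2 = z 2" "hex z (Suc 2) =
      z 4"
    "hex z (Suc (Suc 2)) = z 3" "hex z 4 = z 3" "hex z (Suc 4) = z 5" "hex z (Suc (Suc 4)) = z 1"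
    by (simp_all add: hex_def)
  from even_less_6[OF assms] show ?thesis
  proof (elim disjE)
    assume "j = 0" then show ?thesis using o h by (intro bexI[of _ 3]) simp_all
  next
    assume "j = 2" then show ?thesis using o h by (intro bexI[of _ 1]) simp_all
  next
    assume "j = 4" then show ?thesis using o h by (intro bexI[of _ 2]) simp_all
  qed
qed

lemma hex_even_vertex: "even j \<Longrightarrow> \<exists>i\<in>{1,2,3}. hex z j = z i"
proof -
  assume "even j"
  then have "even (j mod 6)" "j mod 6 < 6" by (simp_all add: dvd_mod_iff)
  from even_less_6[OF this] have "\<exists>i\<in>{1,2,3}. hex z (j mod 6) = z i" by (auto simp: hex_simps)
  then show ?thesis by (simp add: hex_mod)
qed

text \<open>A fixed linear functional of the velocity. For an edge vector \<open>d\<close> the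
  choice \<open>m = d\<close> gives the tangential component and \<open>(snd d, - fst d)\<close> the
  normal one, both scaled by the length of \<open>d\<close>.\<close>

definition comb :: "R2 \<Rightarrow> (R2 \<Rightarrow> R2) \<Rightarrow> R2 \<Rightarrow> real" where
  "comb m v = (\<lambda>x. fst m * (fst \<circ> v) x + snd m * (snd \<circ> v) x)"

lemma comb_inner: "comb m v x = m \<bullet> v x" by (simp add: comb_def inner_prod_def)

lemma comb_cross: "comb (snd d, - fst d) v x = cross (v x) d" by (simp add: comb_def cross_def)

lemma comb_CP: "v \<in> VP n \<Longrightarrow> comb m v \<in> CP n"
  unfolding comb_def by (intro CP_add CP_cmul VP_D)

lemma dirD_comb:
  assumes "v \<in> VP n"
  shows "dirD w (pc j (comb m v)) x = fst m * dirD w (pc j (fst \<circ> v)) x + snd m * dirD w (pc j (snd \<circ> v)) x"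
proof -
  note C = VP_D[OF assms]
  have "pc j (comb m v) = (\<lambda>x. fst m * pc j (fst \<circ> v) x + snd m * pc j (snd \<circ> v) x)"
    unfolding comb_def pc_add[OF CP_cmul[OF C(1)] CP_cmul[OF C(2)]] pc_cmul[OF C(1)] pc_cmul[OF C(2)] ..
  then show ?thesis
    using dirD_add[OF bpoly_cmul[OF pc_bpoly[OF C(1)]] bpoly_cmul[OF pc_bpoly[OF C(2)]]] dirD_cmul[OF
        pc_bpoly[OF C(1)]] dirD_cmul[OF pc_bpoly[OF C(2)]]
    by simp
qed

lemma edge_integral_0_iff: "edge_integral (hex z j, hex z (Suc j)) f = 0 \<longleftrightarrow> integral {0..1} (\<lambda>t. f (linepath
    (hex z j) (hex z (Suc j)) t)) = 0"
  using hex_neq[of j] by (simp add: edge_integral_def)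

text \<open>At an edge point both one-sided gradients agree in the direction of the spoke. As the
  divergence is continuous and \<open>v \<cdot> n\<close> vanishes on the edge, the jump of the gradient is zero.\<close>

lemma tangential_derivative_continuous:
  assumes v: "v \<in> S1 (int r) z" and j: "even j" "j < 6"
    and N: "\<And>k. k = j \<or> k = Suc j \<Longrightarrow> dirD (dv j) (pc k (comb (snd (dv j), - fst (dv j)) v)) (hex z (Suc j)) = 0"
  shows "dirD (dv j) (pc j (comb m v)) (hex z (Suc j)) = dirD (dv j) (pc (Suc j) (comb m v)) (hex z (Suc j))"
proof -
  note V = S1_VP[OF v]
  note C = VP_D[OF V]
  note P = pc_bpoly[OF C(1)] pc_bpoly[OF C(2)]
  let ?M = "hex z (Suc j)" and ?s = "u (Suc j)" and ?d = "dv j"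
  have j': "Suc j < 6" using even_less_6[OF j] by auto
  have M: "?M = z 0 + 1 *\<^sub>R ?s" by (simp add: u_def)
  have Mt: "?M \<in> tri_ps z j" "?M \<in> tri_ps z (Suc j)" using spoke_in_tri_ps[of 1] unfolding M by auto
  \<comment> \<open>Both pieces have the same trace on the whole spoke, so their derivatives along
    it agree up to its end point.\<close>
  have sp: "dirD ?s (pc j f) ?M = dirD ?s (pc (Suc j) f) ?M" if f: "f \<in> CP r" for f
  proof -
    obtain G H where GH: "\<And>t. pc j f (z 0 + t *\<^sub>R ?s) = poly G t" "\<And>t. pc (Suc j) f (z 0 + t *\<^sub>R ?s) = poly H t"
      using bpoly_along_line[OF pc_bpoly[OF f]] by metis
    have "G = H"
    proof (rule poly_real_eqI[of 0 1])
      fix t :: real assume "0 < t" "t < 1"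
      then show "poly G t = poly H t" using pc_spoke[OF f j(2), of t] j' GH by simp
    qed simp
    then show ?thesis
      using dirD_along_line[OF pc_bpoly[OF f] GH(1), of 1] dirD_along_line[OF pc_bpoly[OF f] GH(2), of 1]
          unfolding M by simp
  qed
  have dv: "divp j v ?M = divp (Suc j) v ?M"
    using v agreeD[of "\<lambda>j. divp j v" j "Suc j" ?M] j(2) j' Mt unfolding S1_iff by blast
  \<comment> \<open>Entries of the jump of the Jacobian. Continuity along the spoke makes it kill
    \<open>u (Suc j)\<close>, continuity of the divergence makes its trace 0, and the vanishing
    normal derivatives make it map \<open>dv j\<close> to a tangential vector.\<close>
  define m11 where "m11 = dirD (1, 0) (pc j (fst \<circ> v)) ?M - dirD (1, 0) (pc (Suc j) (fst \<circ> v)) ?M"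
  define m12 where "m12 = dirD (0, 1) (pc j (fst \<circ> v)) ?M - dirD (0, 1) (pc (Suc j) (fst \<circ> v)) ?M"
  define m21 where "m21 = dirD (1, 0) (pc j (snd \<circ> v)) ?M - dirD (1, 0) (pc (Suc j) (snd \<circ> v)) ?M"
  define m22 where "m22 = dirD (0, 1) (pc j (snd \<circ> v)) ?M - dirD (0, 1) (pc (Suc j) (snd \<circ> v)) ?M"
  have X: "dirD w (pc j (fst \<circ> v)) ?M - dirD w (pc (Suc j) (fst \<circ> v)) ?M = m11 * fst w + m12 * snd w" for w
    unfolding dirD_components[OF P(1), of w] m11_def m12_def by (simp add: algebra_simps)
  have Y: "dirD w (pc j (snd \<circ> v)) ?M - dirD w (pc (Suc j) (snd \<circ> v)) ?M = m21 * fst w + m22 * snd w" for w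
    unfolding dirD_components[OF P(2), of w] m21_def m22_def by (simp add: algebra_simps)
  have "m11 * fst ?d + m12 * snd ?d = 0" "m21 * fst ?d + m22 * snd ?d = 0"
  proof -
    have 1: "m11 * fst ?s + m12 * snd ?s = 0" "m21 * fst ?s + m22 * snd ?s = 0"
      using sp[OF C(1)] sp[OF C(2)] unfolding X[symmetric] Y[symmetric] by simp_all
    have 2: "m11 + m22 = 0" using dv unfolding divp_def m11_def m22_def by simp
    have 3: "(m11 * fst ?d + m12 * snd ?d) * snd ?d = (m21 * fst ?d + m22 * snd ?d) * fst ?d"
      using N[of j] N[of "Suc j"] unfolding X[symmetric] Y[symmetric] dirD_comb[OF V] by (simp add:
          algebra_simps)
    have 4: "fst ?s * snd ?d - snd ?s * fst ?d \<noteq> 0" using cross_spoke_dv[of j] by (simp add: cross_def)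
    show "m11 * fst ?d + m12 * snd ?d = 0" "m21 * fst ?d + m22 * snd ?d = 0"
      by (rule trace_free_2x2[OF 1 2 3 4])+
  qed
  then have "dirD ?d (pc j (fst \<circ> v)) ?M = dirD ?d (pc (Suc j) (fst \<circ> v)) ?M"
    "dirD ?d (pc j (snd \<circ> v)) ?M = dirD ?d (pc (Suc j) (snd \<circ> v)) ?M"
    using X[of ?d] Y[of ?d] by simp_all
  then show ?thesis unfolding dirD_comb[OF V] by simp
qed

text \<open>At the edge point only the normal component is known to vanish. The tangential value
  \<open>c\<close> is unknown, so the two halves are treated together: they share \<open>c\<close>
  and the tangential derivative \<open>\<delta>\<close>. The integrals of the squared tangential
  derivatives are \<open>c * \<delta>\<close> and \<open>- (c * (K * \<delta>))\<close> with
  \<open>0 < K\<close>; both are nonnegative, hence zero.\<close>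

lemma vanishes_on_edge:
  assumes v: "v \<in> S1 (int r) z" and j: "even j" "j < 6"
    and ends: "v (hex z j) = 0" "v (hex z (Suc (Suc j))) = 0" and mid: "cross (v (hex z (Suc j))) (dv j) = 0"
    and mom: "\<And>k m q. k = j \<or> k = Suc j \<Longrightarrow> q \<in> poly_on (int r - 2) (closed_segment (hex z k) (hex z (Suc k))) \<Longrightarrow>
      integral {0..1} (\<lambda>t. comb m v (linepath (hex z k) (hex z (Suc k)) t) * q (linepath (hex z k) (hex z
          (Suc k)) t)) = 0"
    and k: "k = j \<or> k = Suc j" and t: "0 \<le> t" "t \<le> 1"
  shows "v (linepath (hex z k) (hex z (Suc k)) t) = 0"
proof -
  note V = S1_VP[OF v]
  let ?d = "dv j" and ?M = "hex z (Suc j)"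
  let ?n = "(snd ?d, - fst ?d)"
  obtain K where K: "0 < K" "dv (Suc j) = K *\<^sub>R ?d" using dv_even[OF j] .
  have parts: "poly G 1 * poly (pderiv G) 1 - poly G 0 * poly (pderiv G) 0 = integral {0..1} (\<lambda>t. (poly
      (pderiv G) t)\<^sup>2)"
    if "k = j \<or> k = Suc j" "degree G \<le> r" "\<And>t. 0 \<le> t \<Longrightarrow> t \<le> 1 \<Longrightarrow> comb m v (linepath (hex z k) (hex z (Suc k))
        t) = poly G t"
    for k m G
    by (rule poly_parts[OF edge_moments_orthogonal[OF hex_neq that(2,3) mom[OF that(1)]]])
  obtain N0 where N0: "degree N0 \<le> r" "\<And>t. 0 \<le> t \<Longrightarrow> t \<le> 1 \<Longrightarrow> comb ?n v (linepath (hex z j) (hex z (Suc j)) t)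
      = poly N0 t"
    "\<And>t. dirD (dv j) (pc j (comb ?n v)) (hex z j + t *\<^sub>R dv j) = poly (pderiv N0) t"
    using edge_poly[OF comb_CP[OF V, of "?n"], where j = "j"] by blast
  obtain N1 where N1: "degree N1 \<le> r" "\<And>t. 0 \<le> t \<Longrightarrow> t \<le> 1 \<Longrightarrow> comb ?n v (linepath (hex z (Suc j)) (hex z (Suc
      (Suc j))) t) = poly N1 t"
    "\<And>t. dirD (dv (Suc j)) (pc (Suc j) (comb ?n v)) (hex z (Suc j) + t *\<^sub>R dv (Suc j)) = poly (pderiv N1) t"
    using edge_poly[OF comb_CP[OF V, of "?n"], where j = "Suc j"] by blast
  obtain A0 where A0: "degree A0 \<le> r" "\<And>t. 0 \<le> t \<Longrightarrow> t \<le> 1 \<Longrightarrow> comb ?d v (linepath (hex z j) (hex z (Suc j)) t)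
      = poly A0 t"
    "\<And>t. dirD (dv j) (pc j (comb ?d v)) (hex z j + t *\<^sub>R dv j) = poly (pderiv A0) t"
    using edge_poly[OF comb_CP[OF V, of "?d"], where j = "j"] by blast
  obtain A1 where A1: "degree A1 \<le> r" "\<And>t. 0 \<le> t \<Longrightarrow> t \<le> 1 \<Longrightarrow> comb ?d v (linepath (hex z (Suc j)) (hex z (Suc
      (Suc j))) t) = poly A1 t"
    "\<And>t. dirD (dv (Suc j)) (pc (Suc j) (comb ?d v)) (hex z (Suc j) + t *\<^sub>R dv (Suc j)) = poly (pderiv A1) t"
    using edge_poly[OF comb_CP[OF V, of "?d"], where j = "Suc j"] by blast
  have N_ends: "poly N0 0 = 0" "poly N0 1 = 0" "poly N1 0 = 0" "poly N1 1 = 0"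
    using N0(2)[of 0] N0(2)[of 1] N1(2)[of 0] N1(2)[of 1] ends mid unfolding comb_cross
    by (simp_all add: linepath_0' linepath_1')
  have N0': "pderiv N0 = 0" using poly_square_integral_0 parts[OF _ N0(1,2)] N_ends by simp
  have N1': "pderiv N1 = 0" using poly_square_integral_0 parts[OF _ N1(1,2)] N_ends by simp
  have M: "hex z j + 1 *\<^sub>R dv j = ?M" "hex z (Suc j) + 0 *\<^sub>R dv (Suc j) = ?M" by (simp_all add: dv_def)
  have scale: "dirD (dv (Suc j)) (pc (Suc j) (comb m v)) x = K * dirD (dv j) (pc (Suc j) (comb m v)) x" for m x
    unfolding K(2) using dirD_linear[OF pc_bpoly[OF comb_CP[OF V]], of K "dv j" 0 0] by simp
  have "dirD (dv j) (pc k (comb ?n v)) ?M = 0" if "k = j \<or> k = Suc j" for k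
    using that N0(3)[of 1] N1(3)[of 0] K(1) unfolding M scale N0' N1' by auto
  note tang = tangential_derivative_continuous[OF v j this]
  define \<delta> where "\<delta> = dirD (dv j) (pc j (comb ?d v)) ?M"
  define c where "c = comb ?d v ?M"
  \<comment> \<open>The factor \<open>K\<close> converts the derivative along \<open>dv j\<close>
    into the derivative along \<open>dv (Suc j)\<close>, the parameter direction of the second
    half.\<close>
  have \<delta>: "poly (pderiv A0) 1 = \<delta>" "poly (pderiv A1) 0 = K * \<delta>"
    using A0(3)[of 1] A1(3)[of 0] tang[of ?d] unfolding M scale \<delta>_def by simp_all
  have A_ends: "poly A0 0 = 0" "poly A0 1 = c" "poly A1 0 = c" "poly A1 1 = 0"
    using A0(2)[of 0] A0(2)[of 1] A1(2)[of 0] A1(2)[of 1] ends unfolding c_def comb_inner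
    by (simp_all add: linepath_0' linepath_1')
  have I: "integral {0..1} (\<lambda>t. (poly (pderiv A0) t)\<^sup>2) = c * \<delta>" "integral {0..1} (\<lambda>t. (poly (pderiv A1) t)\<^sup>2)
      = - (c * (K * \<delta>))"
    using parts[OF _ A0(1,2)] parts[OF _ A1(1,2)] A_ends \<delta> by simp_all
  have "0 \<le> c * \<delta>" using I(1) poly_square_integral_nonneg[of "pderiv A0"] by simp
  moreover have "0 \<le> - (K * (c * \<delta>))" using I(2) poly_square_integral_nonneg[of "pderiv A1"] by (simp add:
      mult_ac)
  then have "c * \<delta> \<le> 0" using K(1) by (simp add: mult_le_0_iff)
  ultimately have "c * \<delta> = 0" by simp
  then have "integral {0..1} (\<lambda>t. (poly (pderiv A0) t)\<^sup>2) = 0" "integral {0..1} (\<lambda>t. (poly (pderiv A1) t)\<^sup>2) = 0"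
    using I by auto
  then have "poly A0 t = 0" "poly A1 t = 0"
    using poly_square_integral_0_const[of A0 t 0] poly_square_integral_0_const[of A1 t 1] A_ends by simp_all
  moreover have "poly N0 t = 0" "poly N1 t = 0"
    using pderiv_0_const[OF N0', of t 0] pderiv_0_const[OF N1', of t 0] N_ends by simp_all
  ultimately have "?d \<bullet> v (linepath (hex z k) (hex z (Suc k)) t) = 0" "cross (v (linepath (hex z k) (hex z
      (Suc k)) t)) ?d = 0"
    using k A0(2)[OF t] A1(2)[OF t] N0(2)[OF t] N1(2)[OF t] unfolding comb_inner[symmetric]
        comb_cross[symmetric] by auto
  then show ?thesis by (rule orthogonal_both_0) (rule dv_nz)
qed

text \<open>For \<open>r = 1\<close> the flux replaces the normal value at the edge point. The
  normal component is affine on both halves and zero at the ends, so after division by its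
  supposedly nonzero value at the edge point it is nonnegative; a zero integral then makes it
  vanish, also where the quotient equals 1.\<close>

lemma flux_determines_normal:
  assumes v: "v \<in> VP 1" and j: "even j" "j < 6"
    and ends: "v (hex z j) = 0" "v (hex z (Suc (Suc j))) = 0"
    and flux: "edge_integral (hex z j, hex z (Suc (Suc j))) (\<lambda>x. v x \<bullet> normal (hex z j, hex z (Suc (Suc
        j)))) = 0"
  shows "cross (v (hex z (Suc j))) (dv j) = 0"
proof (rule ccontr)
  let ?a = "hex z j" and ?b = "hex z (Suc (Suc j))" and ?M = "hex z (Suc j)"
  let ?d = "dv j"
  assume nz: "cross (v ?M) ?d \<noteq> 0"
  obtain K where K: "0 < K" "dv (Suc j) = K *\<^sub>R ?d" using dv_even[OF j] .
  have ba: "?b - ?a = (1 + K) *\<^sub>R ?d" using K(2) by (simp add: dv_def algebra_simps)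
  have nba: "norm (?b - ?a) > 0" unfolding ba using K(1) dv_nz[of j] by simp
  define h where "h x = cross (v x) ?d / cross (v ?M) ?d" for x
  have hx: "v x \<bullet> normal (?a, ?b) = (cross (v ?M) ?d * (1 + K) / norm (?b - ?a)) * h x" for x
    unfolding inner_normal using nz by (simp add: ba h_def)
  have scaled: "\<exists>s\<ge>0. cross (v x) ?d = s * cross (v ?M) ?d"
    if "x = linepath (hex z k) (hex z (Suc k)) t" "0 \<le> t" "t \<le> 1" "k = j \<or> k = Suc j" for x k t
  proof -
    obtain G where G: "degree G \<le> 1" "\<And>t. 0 \<le> t \<Longrightarrow> t \<le> 1 \<Longrightarrow> comb (snd ?d, - fst ?d) v (linepath (hex z k) (hex
        z (Suc k)) t) = poly G t"
      using edge_poly[OF comb_CP[OF v], of "(snd ?d, - fst ?d)" k] by metis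
    obtain g0 g1 where "G = [:g0, g1:]"
    proof (cases G)
      case (pCons g0 H)
      then have "degree H = 0" using G(1) by (cases "H = 0") auto
      then obtain g1 where "H = [:g1:]" by (rule degree_eq_zeroE)
      then show thesis using pCons that[of g0 g1] by simp
    qed
    then have lin: "poly G t = (1 - t) * poly G 0 + t * poly G 1" by (simp add: algebra_simps)
    have e: "poly G 0 = cross (v (hex z k)) ?d" "poly G 1 = cross (v (hex z (Suc k))) ?d" "poly G t = cross
        (v x) ?d"
      using G(2)[of 0] G(2)[of 1] G(2)[OF that(2,3)] that(1) unfolding comb_cross
      by (simp_all add: linepath_0' linepath_1')
    show ?thesis
    proof (cases "k = j")
      case True
      then show ?thesis using lin that(2) unfolding e by (intro exI[of _ t]) (simp add: ends)
    next
      case False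
      then show ?thesis using lin that(3,4) unfolding e by (intro exI[of _ "1 - t"]) (auto simp: ends)
    qed
  qed
  have mid_seg: "?M \<in> closed_segment ?a ?b"
  proof -
    have "?M = (1 - 1 / (1 + K)) *\<^sub>R ?a + (1 / (1 + K)) *\<^sub>R ?b"
    proof -
      have "(1 / (1 + K)) *\<^sub>R (?b - ?a) = ?d" unfolding ba using K(1) by simp
      then show ?thesis by (simp add: dv_def algebra_simps)
    qed
    then show ?thesis using K(1) unfolding in_segment by (intro exI[of _ "1 / (1 + K)"]) auto
  qed
  have pos: "0 \<le> h x" if "x \<in> closed_segment ?a ?b" for x
  proof -
    have "x \<in> closed_segment ?a ?M \<or> x \<in> closed_segment ?M ?b"
      using that Un_closed_segment[OF mid_seg] by auto
    then obtain k t where "k = j \<or> k = Suc j" "0 \<le> t" "t \<le> 1" "x = linepath (hex z k) (hex z (Suc k)) t"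
      unfolding closed_segment_linepath by blast
    then obtain s where "s \<ge> 0" "cross (v x) ?d = s * cross (v ?M) ?d" using scaled by blast
    then show ?thesis using nz by (simp add: h_def)
  qed
  have seg_sub: "closed_segment ?a ?b \<subseteq> triangle z"
    using hex_in_triangle convex_triangle by (intro closed_segment_subset)
  have "continuous_on (triangle z) (\<lambda>x. comb (snd ?d, - fst ?d) v x / cross (v ?M) ?d)"
    using CP_continuous[OF comb_CP[OF v]] nz by (intro continuous_intros) auto
  then have "continuous_on (triangle z) h" unfolding h_def comb_cross by simp
  moreover have "linepath ?a ?b ` cbox 0 1 \<subseteq> triangle z"
    using seg_sub by (simp add: linepath_image_01)
  ultimately have cont: "continuous_on (cbox 0 1) (\<lambda>t. h (linepath ?a ?b t))"
    by (intro continuous_on_compose2[of "triangle z" h _ "linepath ?a ?b"] continuous_on_linepath)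
  have "integral {0..1} (\<lambda>t. (cross (v ?M) ?d * (1 + K) / norm (?b - ?a)) * h (linepath ?a ?b t)) = 0"
    using flux nba unfolding edge_integral_def hx by (auto simp: dist_norm norm_minus_commute)
  then have "integral (cbox 0 1) (\<lambda>t. h (linepath ?a ?b t)) = 0"
    using nz nba K(1) by simp
  then have i0: "((\<lambda>t. h (linepath ?a ?b t)) has_integral 0) (cbox 0 1)"
    using integrable_integral[OF integrable_continuous[OF cont]] by simp
  obtain t where t: "0 \<le> t" "t \<le> 1" "?M = linepath ?a ?b t" using mid_seg unfolding closed_segment_linepath
      by blast
  have "0 \<le> h (linepath ?a ?b s)" if "0 \<le> s" "s \<le> 1" for s
    by (rule pos) (use that closed_segment_linepath in blast)
  then have "h (linepath ?a ?b t) = 0"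
    by (intro has_integral_0_cbox_imp_0[OF cont _ i0]) (use t in auto)
  then show False using t(3) nz by (simp add: h_def)
qed

lemma frontier_linepath: "x \<in> frontier (triangle z) \<longleftrightarrow> (\<exists>k<6. \<exists>t. 0 \<le> t \<and> t \<le> 1 \<and> x = linepath (hex z k) (hex
    z (Suc k)) t)"
  unfolding frontier_triangle by (auto simp: closed_segment_linepath)

lemma even_split_6: "k < 6 \<Longrightarrow> \<exists>j<6. even j \<and> (k = j \<or> k = Suc j)" for k :: nat
  by (cases "even k") (auto intro: exI[of _ k] exI[of _ "k - 1"] elim!: oddE)

lemma VP_continuous:
  assumes "v \<in> VP n" shows "continuous_on (triangle z) v"
proof -
  have "continuous_on (triangle z) (\<lambda>x. ((fst \<circ> v) x, (snd \<circ> v) x))"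
    by (intro continuous_on_Pair CP_continuous[OF VP_D(1)[OF assms]] CP_continuous[OF VP_D(2)[OF assms]])
  then show ?thesis by simp
qed

lemma S1_unisolvent:
  assumes v: "v \<in> S1 (int r) z" and r: "1 \<le> r"
    and dofs: "has_dofs r z v (\<lambda>_. 0) (\<lambda>_. 0) (\<lambda>_. 0) (\<lambda>_. 0) (\<lambda>_. 0) (\<lambda>_ _. 0) (\<lambda>_ _. 0) (\<lambda>_. 0) (\<lambda>_. 0)"
  shows "v = (\<lambda>x. 0)"
proof -
  note V = S1_VP[OF v]
  have vertex: "v (z i) = 0" "cdiv z v (z i) = 0" if "i \<in> {1,2,3}" for i
    using dofs that unfolding has_dofs_def by blast+
  have flux: "edge_integral (opp_edge z i) (\<lambda>x. v x \<bullet> normal (opp_edge z i)) = 0" if "r = 1" "i \<in> {1,2,3}" for i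
    using dofs that unfolding has_dofs_def by blast
  have mid: "v (z (3 + i)) \<bullet> normal (opp_edge z i) = 0" "cdiv z v (z (3 + i)) = 0" if "2 \<le> r" "i \<in> {1,2,3}"
      for i
    using dofs that unfolding has_dofs_def by blast+
  have edge: "e \<in> bdry_edges z \<Longrightarrow> w \<in> vec_poly_on (int r - 2) (edge_set e) \<Longrightarrow> edge_integral e (\<lambda>x. v x \<bullet> w x)
      = 0" for e w
    using dofs unfolding has_dofs_def by blast
  have edge_div: "e \<in> bdry_edges z \<Longrightarrow> q \<in> poly_on (int r - 3) (edge_set e) \<Longrightarrow> edge_integral e (\<lambda>x. cdiv z v x
      * q x) = 0" for e q
    using dofs unfolding has_dofs_def by blast
  have rot: "q \<in> S0_ring (int r + 1) z \<Longrightarrow> integral (triangle z) (\<lambda>x. v x \<bullet> crot z q x) = 0" for q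
    using dofs unfolding has_dofs_def by blast
  have div: "q \<in> L2_ring (int r - 1) z \<Longrightarrow> integral (triangle z) (\<lambda>x. cdiv z v x * q x) = 0" for q
    using dofs unfolding has_dofs_def by blast
  have e: "(hex z k, hex z (Suc k)) \<in> bdry_edges z" if "k < 6" for k using that unfolding bdry_edges_hex by
      blast
  have corner: "v (hex z k) = 0" "cdiv z v (hex z k) = 0" if "even k" for k
    using hex_even_vertex[OF that] vertex by auto
  have mom: "integral {0..1} (\<lambda>t. comb m v (linepath (hex z k) (hex z (Suc k)) t) * q (linepath (hex z k)
      (hex z (Suc k)) t)) = 0"
    if k: "k < 6" and q: "q \<in> poly_on (int r - 2) (closed_segment (hex z k) (hex z (Suc k)))" for k m q
  proof -
    \<comment> \<open>Scalar moments of the component along \<open>m\<close> come from vector test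
      functions that are multiples of \<open>m\<close>.\<close>
    let ?w = "\<lambda>x. (fst m * q x, snd m * q x)"
    have "?w \<in> vec_poly_on (int r - 2) (edge_set (hex z k, hex z (Suc k)))"
      using fun_subspaceD(3)[OF fun_subspace_poly_on q] by (auto simp: vec_poly_on_def o_def edge_set_def)
    from edge[OF e[OF k] this] show ?thesis
      unfolding edge_integral_0_iff by (simp add: comb_def inner_prod_def algebra_simps)
  qed
  have normal0: "cross (v (hex z (Suc j))) (dv j) = 0" if j: "even j" "j < 6" for j
  proof -
    obtain i where i: "i \<in> {1,2,3}" "opp_edge z i = (hex z j, hex z (Suc (Suc j)))" "z (3 + i) = hex z (Suc j)"
      using macro_edge[OF j] by blast
    show ?thesis
    proof (cases "r = 1")
      case True
      then show ?thesis using flux_determines_normal[OF _ j] V corner j flux[OF True i(1)] i(2) by simp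
    next
      case False
      obtain K where K: "0 < K" "dv (Suc j) = K *\<^sub>R dv j" using dv_even[OF j] .
      have ba: "hex z (Suc (Suc j)) - hex z j = (1 + K) *\<^sub>R dv j" using K(2) by (simp add: dv_def algebra_simps)
      have "cross (v (hex z (Suc j))) ((1 + K) *\<^sub>R dv j) / norm ((1 + K) *\<^sub>R dv j) = 0"
        using mid(1)[OF _ i(1)] False r unfolding i(2,3) inner_normal ba by simp
      then show ?thesis using K(1) dv_nz[of j] by simp
    qed
  qed
  have v_bd: "v x = 0" if x: "x \<in> frontier (triangle z)" for x
  proof -
    obtain k t where k: "k < 6" "0 \<le> t" "t \<le> 1" "x = linepath (hex z k) (hex z (Suc k)) t"
      using x unfolding frontier_linepath by blast
    obtain j where j: "j < 6" "even j" "k = j \<or> k = Suc j" using even_split_6[OF k(1)] by blast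
    have j': "Suc j < 6" using even_less_6[OF j(2,1)] by auto
    show ?thesis unfolding k(4)
      by (rule vanishes_on_edge[OF v j(2,1) _ _ normal0[OF j(2,1)] mom j(3) k(2,3)]) (use corner j j' in auto)
  qed
  let ?c = "cdiv z v"
  have c: "?c \<in> CP (r - 1)" by (rule cdiv_CP(1)[OF v])
  have c_bd: "?c x = 0" if x: "x \<in> frontier (triangle z)" for x
  proof -
    obtain k t where k: "k < 6" "0 \<le> t" "t \<le> 1" "x = linepath (hex z k) (hex z (Suc k)) t"
      using x unfolding frontier_linepath by blast
    obtain G where G: "degree G \<le> r - 1" "\<And>t. 0 \<le> t \<Longrightarrow> t \<le> 1 \<Longrightarrow> ?c (linepath (hex z k) (hex z (Suc k)) t) =
        poly G t"
      using edge_poly[OF c, of k] by metis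
    have Ge: "poly G 0 = ?c (hex z k)" "poly G 1 = ?c (hex z (Suc k))" using G(2)[of 0] G(2)[of 1] by
        (simp_all add: linepath_0' linepath_1')
    \<comment> \<open>For \<open>r = 1\<close> the divergence is constant on each piece. Otherwise
      it vanishes at both ends of the edge, so the boundary term of the integration by parts drops
      out.\<close>
    have "pderiv G = 0"
    proof (cases "r = 1")
      case True
      then show ?thesis using G(1) by (simp add: pderiv_eq_0_iff)
    next
      case False
      have odd0: "?c (hex z i) = 0" if i: "odd i" "i < 6" for i
      proof -
        have "even (i - 1)" "i - 1 < 6" "Suc (i - 1) = i" using i by (auto elim!: oddE)
        then show ?thesis using macro_edge[of "i - 1"] mid(2) False r by force
      qed
      have "?c (hex z i) = 0" if "i \<le> 6" for i
        using corner(2)[of i] odd0[of i] that by (cases "even i") (auto simp: le_less)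
      then have "poly G 0 = 0" "poly G 1 = 0" using Ge k(1) by auto
      moreover have "integral {0..1} (\<lambda>t. poly G t * poly (pderiv (pderiv G)) t) = 0"
      proof (rule edge_moments_orthogonal[OF hex_neq G])
        fix q assume "q \<in> poly_on (int (r - 1) - 2) (closed_segment (hex z k) (hex z (Suc k)))"
        moreover have "int (r - 1) - 2 = int r - 3" using r by simp
        ultimately show "integral {0..1} (\<lambda>t. ?c (linepath (hex z k) (hex z (Suc k)) t) * q (linepath (hex z
            k) (hex z (Suc k)) t)) = 0"
          using edge_div[OF e[OF k(1)], of q] unfolding edge_integral_0_iff by (simp add: edge_set_def)
      qed
      ultimately show ?thesis using poly_parts[of G] by (intro poly_square_integral_0) simp
    qed
    then have "poly G t = poly G 0" "poly G t = poly G 1" by (rule pderiv_0_const)+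
    \<comment> \<open>Each half-edge has a corner at one of its ends, and the divergence vanishes at
      corners.\<close>
    then show ?thesis using Ge corner(2)[of k] corner(2)[of "Suc k"] G(2)[OF k(2,3)] k(4) by (cases "even
        k") auto
  qed
  have c0: "?c x = 0" if "x \<in> triangle z" for x
  proof -
    have "?c \<in> L2_ring (int r - 1) z"
      using L2_ring_iff[of ?c "r - 1"] c c_bd integral_cdiv_0[OF v v_bd] r by (simp add: of_nat_diff)
    from div[OF this] have "integral (triangle z) (\<lambda>x. ?c x * ?c x) = 0" .
    then have "?c x * ?c x = 0"
      using CP_continuous[OF c] that by (intro integral_triangle_eq_0[of "\<lambda>x. ?c x * ?c x"]
          continuous_intros) auto
    then show ?thesis by simp
  qed
  have "?c = (\<lambda>x. 0)"
    using c0 cdiv_eq(2)[OF v] by blast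
  then have "divp j v = (\<lambda>x. 0)" for j using cdiv_CP(2)[OF v, of j] pc_zero[of j] by simp
  then obtain q where q: "q \<in> S0_ring (int (r + 1)) z" "crot z q = v"
    using stream_function[OF V _ v_bd] by blast
  then have "integral (triangle z) (\<lambda>x. v x \<bullet> v x) = 0" using rot[of q] by (simp add: add.commute)
  then have "v x \<bullet> v x = 0" if "x \<in> triangle z" for x
    using VP_continuous[OF V] that by (intro integral_triangle_eq_0[of "\<lambda>x. v x \<bullet> v x"] continuous_intros) auto
  moreover have "v x = 0" if "x \<notin> triangle z" for x
    using CP_outside[OF VP_D(1)[OF V] that] CP_outside[OF VP_D(2)[OF V] that] by (simp add: prod_eq_iff)
  ultimately show ?thesis by (metis inner_eq_zero_iff)
qed

end

section \<open>Degrees of freedom as functionals\<close>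

text \<open>Values on a spanning set determine a functional, so moment conditions against a whole
  test space shrink to finitely many.\<close>

lemma linear_functionals_eqI:
  assumes V: "fun_vs.subspace V" and F: "linear_functional_on V F" and G: "linear_functional_on V G"
    and span: "spanning V n B"
    and eq: "\<And>b. b \<in> B \<Longrightarrow> F b = G b" and v: "v \<in> V"
  shows "F v = G v"
proof -
  have B: "finite B" "B \<subseteq> V" using span by (auto simp: spanning_def)
  obtain c where c: "v = (\<lambda>x. \<Sum>b\<in>B. c b *\<^sub>R b x)" using span v by (auto simp: spanning_def)
  have "F v = (\<Sum>b\<in>B. c b * F b)" unfolding c
    using B(2) by (intro linear_functional_on_sum[OF F V B(1)]) auto
  also have "\<dots> = (\<Sum>b\<in>B. c b * G b)" using eq by simp
  also have "\<dots> = G v" unfolding c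
    using B(2) by (intro linear_functional_on_sum[OF G V B(1), symmetric]) auto
  finally show ?thesis .
qed

lemma linear_functional_on_integral:
  assumes int: "\<And>v. v \<in> V \<Longrightarrow> h v integrable_on S"
    and add: "\<And>v w t. v \<in> V \<Longrightarrow> w \<in> V \<Longrightarrow> t \<in> S \<Longrightarrow> h (\<lambda>x. v x + w x) t = h v t + h w t"
    and scale: "\<And>c v t. v \<in> V \<Longrightarrow> t \<in> S \<Longrightarrow> h (\<lambda>x. c *\<^sub>R v x) t = c * (h v t :: real)"
  shows "linear_functional_on V (\<lambda>v. integral S (h v))"
proof (rule linear_functional_onI)
  fix v w assume vw: "v \<in> V" "w \<in> V"
  have "integral S (h (\<lambda>x. v x + w x)) = integral S (\<lambda>t. h v t + h w t)"
    by (rule integral_cong) (rule add[OF vw])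
  then show "integral S (h (\<lambda>x. v x + w x)) = integral S (h v) + integral S (h w)"
    using integral_add[OF int[OF vw(1)] int[OF vw(2)]] by simp
next
  fix c v assume v: "v \<in> V"
  have "integral S (h (\<lambda>x. c *\<^sub>R v x)) = integral S (\<lambda>t. c * h v t)"
    by (rule integral_cong) (rule scale[OF v])
  then show "integral S (h (\<lambda>x. c *\<^sub>R v x)) = c * integral S (h v)" by simp
qed

lemma linear_functional_on_cmult:
  "linear_functional_on V F \<Longrightarrow> linear_functional_on V (\<lambda>v. k * F v)"
  by (auto simp: linear_functional_on_def algebra_simps)

lemma poly_on_linepath_continuous:
  assumes "q \<in> poly_on k (closed_segment a b)"
  shows "continuous_on {0..1} (\<lambda>t. q (linepath a b t))"
proof (cases "k < 0")
  case True
  then show ?thesis using assms by (simp add: poly_on_neg)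
next
  case False
  then obtain p where p: "p \<in> bpoly (nat k)" "q = (\<lambda>x. if x \<in> closed_segment a b then p x else 0)"
    using assms poly_on_int_iff[of q "nat k"] by auto
  have "continuous_on {0..1} (\<lambda>t. p (linepath a b t))"
    by (intro continuous_on_compose2[OF bpoly_continuous[OF p(1), of UNIV] continuous_on_linepath]) auto
  moreover have "p (linepath a b t) = q (linepath a b t)" if "t \<in> {0..1}" for t
    using that closed_segment_linepath unfolding p(2) by auto
  ultimately show ?thesis using continuous_on_cong by (metis (no_types, lifting))
qed

lemma vec_poly_on_linepath_continuous:
  assumes "w \<in> vec_poly_on k (closed_segment a b)"
  shows "continuous_on {0..1} (\<lambda>t. w (linepath a b t))"
proof -
  have "continuous_on {0..1} (\<lambda>t. ((fst \<circ> w) (linepath a b t), (snd \<circ> w) (linepath a b t)))"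
    using assms poly_on_linepath_continuous[of "fst \<circ> w" k a b] poly_on_linepath_continuous[of "snd \<circ> w" k a b]
    by (intro continuous_on_Pair) (simp_all add: vec_poly_on_def)
  then show ?thesis by simp
qed

text \<open>One index type for all functionals, so that they can be collected in a finite set and
  counted. \<open>Point_Val k m\<close> is the component along \<open>m\<close>, which covers both
  the vertex values and the normal values at edge points.\<close>

datatype dof = Point_Val nat R2 | Point_Div nat | Flux nat | Edge_Val edge "R2 \<Rightarrow> R2"
  | Edge_Div edge "R2 \<Rightarrow> real" | Rot_Moment "R2 \<Rightarrow> real" | Div_Moment "R2 \<Rightarrow> real"

definition dof_val :: "(nat \<Rightarrow> R2) \<Rightarrow> dof \<Rightarrow> (R2 \<Rightarrow> R2) \<Rightarrow> real" where
  "dof_val z d v = (case d of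
     Point_Val k m \<Rightarrow> v (z k) \<bullet> m
   | Point_Div k \<Rightarrow> cdiv z v (z k)
   | Flux i \<Rightarrow> edge_integral (opp_edge z i) (\<lambda>x. v x \<bullet> normal (opp_edge z i))
   | Edge_Val e w \<Rightarrow> edge_integral e (\<lambda>x. v x \<bullet> w x)
   | Edge_Div e q \<Rightarrow> edge_integral e (\<lambda>x. cdiv z v x * q x)
   | Rot_Moment q \<Rightarrow> integral (triangle z) (\<lambda>x. v x \<bullet> crot z q x)
   | Div_Moment q \<Rightarrow> integral (triangle z) (\<lambda>x. cdiv z v x * q x))"

lemma dof_val_simps [simp]:
  "dof_val z (Point_Val k m) v = v (z k) \<bullet> m"
  "dof_val z (Point_Div k) v = cdiv z v (z k)"
  "dof_val z (Flux i) v = edge_integral (opp_edge z i) (\<lambda>x. v x \<bullet> normal (opp_edge z i))"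
  "dof_val z (Edge_Val e w) v = edge_integral e (\<lambda>x. v x \<bullet> w x)"
  "dof_val z (Edge_Div e q) v = edge_integral e (\<lambda>x. cdiv z v x * q x)"
  "dof_val z (Rot_Moment q) v = integral (triangle z) (\<lambda>x. v x \<bullet> crot z q x)"
  "dof_val z (Div_Moment q) v = integral (triangle z) (\<lambda>x. cdiv z v x * q x)"
  by (simp_all add: dof_val_def)

text \<open>Membership of the test function in its space secures integrability, and with it
  linearity of the functional in \<open>v\<close>.\<close>

definition is_dof :: "nat \<Rightarrow> (nat \<Rightarrow> R2) \<Rightarrow> dof \<Rightarrow> bool" where
  "is_dof r z d = (case d of
     Point_Val k m \<Rightarrow> True
   | Point_Div k \<Rightarrow> True
   | Flux i \<Rightarrow> i \<in> {1,2,3}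
   | Edge_Val e w \<Rightarrow> e \<in> bdry_edges z \<and> w \<in> vec_poly_on (int r - 2) (edge_set e)
   | Edge_Div e q \<Rightarrow> e \<in> bdry_edges z \<and> q \<in> poly_on (int r - 3) (edge_set e)
   | Rot_Moment q \<Rightarrow> q \<in> S0_ring (int r + 1) z
   | Div_Moment q \<Rightarrow> q \<in> L2_ring (int r - 1) z)"

lemma vec_eq_iff_inner: "x = y \<longleftrightarrow> x \<bullet> (1, 0) = fst y \<and> x \<bullet> (0, 1) = snd y" for x y :: R2
  by (auto simp: prod_eq_iff inner_prod_def)

lemma has_dofs_iff:
  "has_dofs r z v a a' b c c' D E F G \<longleftrightarrow>
     (\<forall>i\<in>{1,2,3}. (dof_val z (Point_Val i (1, 0)) v = fst (a i) \<and> dof_val z (Point_Val i (0, 1)) v = snd (a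
         i)) \<and>
        dof_val z (Point_Div i) v = a' i) \<and>
     (r = 1 \<longrightarrow> (\<forall>i\<in>{1,2,3}. dof_val z (Flux i) v = b i)) \<and>
     (2 \<le> r \<longrightarrow> (\<forall>i\<in>{1,2,3}. dof_val z (Point_Val (3 + i) (normal (opp_edge z i))) v = c i \<and> dof_val z
         (Point_Div (3 + i)) v = c' i)) \<and>
     (\<forall>e\<in>bdry_edges z. \<forall>w\<in>vec_poly_on (int r - 2) (edge_set e). dof_val z (Edge_Val e w) v = D e w) \<and>
     (\<forall>e\<in>bdry_edges z. \<forall>q\<in>poly_on (int r - 3) (edge_set e). dof_val z (Edge_Div e q) v = E e q) \<and>
     (\<forall>q\<in>S0_ring (int r + 1) z. dof_val z (Rot_Moment q) v = F q) \<and>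
     (\<forall>q\<in>L2_ring (int r - 1) z. dof_val z (Div_Moment q) v = G q)"
  unfolding has_dofs_def dof_val_simps vec_eq_iff_inner[symmetric] ..

lemma card_Union_image_le:
  assumes "finite A" "\<And>x. x \<in> A \<Longrightarrow> finite (B x) \<and> card (B x) \<le> n"
  shows "finite (\<Union>x\<in>A. f x ` B x)" "card (\<Union>x\<in>A. f x ` B x) \<le> card A * n"
proof -
  show "finite (\<Union>x\<in>A. f x ` B x)" using assms by auto
  have "card (\<Union>x\<in>A. f x ` B x) \<le> (\<Sum>x\<in>A. card (f x ` B x))" by (rule card_UN_le[OF assms(1)])
  also have "\<dots> \<le> (\<Sum>x\<in>A. n)"
    using assms(2) by (intro sum_mono order_trans[OF card_image_le]) auto
  finally show "card (\<Union>x\<in>A. f x ` B x) \<le> card A * n" by simp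
qed

context ps_config
begin

section \<open>Linearity and counting of the degrees of freedom\<close>

lemma bdry_edge_subset: "e \<in> bdry_edges z \<Longrightarrow> closed_segment (fst e) (snd e) \<subseteq> triangle z"
proof -
  assume "e \<in> bdry_edges z"
  then obtain j where "e = (hex z j, hex z (Suc j))" unfolding bdry_edges_hex by blast
  then show ?thesis
    using closed_segment_subset[OF hex_in_triangle hex_in_triangle convex_triangle] by simp
qed

lemma bdry_edge_neq: "e \<in> bdry_edges z \<Longrightarrow> fst e \<noteq> snd e"
  unfolding bdry_edges_hex using hex_neq by auto

text \<open>Equal outer edges would give equal small triangles. A common point of two different ones
  lies on a spoke, but the centroid \<open>E i (1/3, 1/3)\<close> lies on neither spoke of its
  triangle.\<close>

lemma card_bdry_edges: "card (bdry_edges z) = 6"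
proof -
  have "inj_on (\<lambda>j. (hex z j, hex z (Suc j))) {..<6}"
  proof (rule inj_onI)
    fix i j assume ij: "i \<in> {..<6}" "j \<in> {..<6}" "(hex z i, hex z (Suc i)) = (hex z j, hex z (Suc j))"
    show "i = j"
    proof (rule ccontr)
      assume ne: "i \<noteq> j"
      have "E i (1/3, 1/3) \<in> tri_ps z i" "E i (1/3, 1/3) \<in> tri_ps z j"
        using E_in_tri_ps[of "1/3" "1/3" i] ij by (auto simp: tri_ps_def)
      moreover have c: "cross (u i) (u (Suc i)) > 0" by (rule cross_u_Suc)
      have False if "E i (1/3, 1/3) = z 0 + t *\<^sub>R w" "cross (u i) w = 0 \<or> cross w (u (Suc i)) = 0" for t w
      proof -
        have "cross (u i) (E i (1/3, 1/3) - z 0) = 1/3 * cross (u i) (u (Suc i))"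
          "cross (E i (1/3, 1/3) - z 0) (u (Suc i)) = 1/3 * cross (u i) (u (Suc i))" by (simp_all add: E_eq)
        then show False using that c by auto
      qed
      note no = this
      have uij: "u i = u j" "u (Suc i) = u (Suc j)" using ij(3) by (simp_all add: u_def)
      have ends: "cross (u i) (u k) = 0 \<or> cross (u k) (u (Suc i)) = 0" if "k = i \<or> k = j \<or> k = Suc i \<or> k =
          Suc j" for k
        using that uij by auto
      have "E i (1/3, 1/3) \<noteq> z 0" using no[of 0 0] by auto
      ultimately show False
        using tri_ps_Int_less[of i j "E i (1/3, 1/3)"] tri_ps_Int_less[of j i "E i (1/3, 1/3)"] ij(1,2) ne
            no ends
        by (metis lessThan_iff linorder_neqE_nat)
    qed
  qed
  then show ?thesis unfolding bdry_edges_hex by (simp add: card_image)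
qed

lemma opp_edge_subset: "i \<in> {1,2,3} \<Longrightarrow> closed_segment (fst (opp_edge z i)) (snd (opp_edge z i)) \<subseteq> triangle z"
proof -
  assume i: "i \<in> {1,2,3}"
  have "z 1 \<in> triangle z" "z 2 \<in> triangle z" "z 3 \<in> triangle z"
    using hex_in_triangle[of 0] hex_in_triangle[of 2] hex_in_triangle[of 4] by (simp_all add: hex_simps)
  then show ?thesis using i convex_triangle by (intro closed_segment_subset) (auto simp: opp_edge_def
      nxt_def numeral_2_eq_2[symmetric] numeral_3_eq_3[symmetric])
qed

lemma compose_linepath_continuous:
  assumes "continuous_on (triangle z) f" "closed_segment a b \<subseteq> triangle z"
  shows "continuous_on {0..1} (\<lambda>t. f (linepath a b t))"
  using assms by (intro continuous_on_compose2[OF assms(1) continuous_on_linepath]) (auto simp: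
      linepath_image_01)

lemma cont_cdiv: "v \<in> S1 (int r) z \<Longrightarrow> continuous_on (triangle z) (cdiv z v)"
  using CP_continuous[OF cdiv_CP(1)] .

lemma crot_continuous:
  assumes "q \<in> C1 n" shows "continuous_on (triangle z) (crot z q)"
proof -
  have "cont_rep z (pw_rot q) (crot z q)"
    unfolding cont_rep_rot_iff[OF C1_CP[OF assms]] using crot_eq[OF assms] by blast
  then show ?thesis by (simp add: cont_rep_def)
qed

lemma S0_ring_C1: "q \<in> S0_ring (int r + 1) z \<Longrightarrow> q \<in> C1 (Suc r)"
  using S0_ring_iff[of q "Suc r"] by (simp add: add.commute)

lemma L2_ring_CP: "1 \<le> r \<Longrightarrow> q \<in> L2_ring (int r - 1) z \<Longrightarrow> q \<in> CP (r - 1)"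
  using L2_ring_iff[of q "r - 1"] by (simp add: of_nat_diff)

lemma linear_dof_val:
  assumes "is_dof r z d" "1 \<le> r"
  shows "linear_functional_on (S1 (int r) z) (dof_val z d)"
proof -
  have cv: "continuous_on (triangle z) v" if "v \<in> S1 (int r) z" for v using VP_continuous[OF S1_VP[OF that]] .
  show ?thesis
  proof (cases d)
    case (Point_Val k m)
    then show ?thesis by (intro linear_functional_onI) (auto simp: inner_add_left)
  next
    case (Point_Div k)
    then show ?thesis by (intro linear_functional_onI) (auto simp: cdiv_add cdiv_scale)
  next
    case (Flux i)
    then have "closed_segment (fst (opp_edge z i)) (snd (opp_edge z i)) \<subseteq> triangle z"
      using assms opp_edge_subset by (simp add: is_dof_def)
    then have "continuous_on {0..1} (\<lambda>t. v (linepath (fst (opp_edge z i)) (snd (opp_edge z i)) t) \<bullet> normal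
        (opp_edge z i))"
      if "v \<in> S1 (int r) z" for v
      by (intro continuous_intros compose_linepath_continuous[OF cv[OF that]])
    then show ?thesis unfolding Flux dof_val_simps[abs_def] edge_integral_def
      by (intro linear_functional_on_cmult linear_functional_on_integral integrable_continuous_interval)
          (auto simp: inner_add_left)
  next
    case (Edge_Val e w)
    then have e: "e \<in> bdry_edges z" "w \<in> vec_poly_on (int r - 2) (closed_segment (fst e) (snd e))"
      using assms by (simp_all add: is_dof_def edge_set_def)
    then have "continuous_on {0..1} (\<lambda>t. v (linepath (fst e) (snd e) t) \<bullet> w (linepath (fst e) (snd e) t))"
      if "v \<in> S1 (int r) z" for v
      using compose_linepath_continuous[OF cv[OF that] bdry_edge_subset] vec_poly_on_linepath_continuous
      by (intro continuous_on_inner) auto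
    then show ?thesis unfolding Edge_Val dof_val_simps[abs_def] edge_integral_def
      by (intro linear_functional_on_cmult linear_functional_on_integral integrable_continuous_interval)
          (auto simp: inner_add_left)
  next
    case (Edge_Div e q)
    then have e: "e \<in> bdry_edges z" "q \<in> poly_on (int r - 3) (closed_segment (fst e) (snd e))"
      using assms by (simp_all add: is_dof_def edge_set_def)
    then have "continuous_on {0..1} (\<lambda>t. cdiv z v (linepath (fst e) (snd e) t) * q (linepath (fst e) (snd e)
        t))"
      if "v \<in> S1 (int r) z" for v
      using compose_linepath_continuous[OF cont_cdiv[OF that] bdry_edge_subset] poly_on_linepath_continuous
      by (intro continuous_on_mult) auto
    then show ?thesis unfolding Edge_Div dof_val_simps[abs_def] edge_integral_def
      by (intro linear_functional_on_cmult linear_functional_on_integral integrable_continuous_interval)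
        (auto simp: cdiv_add cdiv_scale algebra_simps)
  next
    case (Rot_Moment q)
    then have q: "continuous_on (triangle z) (crot z q)"
      using assms crot_continuous[OF S0_ring_C1] by (simp add: is_dof_def)
    have "continuous_on (triangle z) (\<lambda>x. v x \<bullet> crot z q x)" if "v \<in> S1 (int r) z" for v
      by (rule continuous_on_inner[OF cv[OF that] q])
    then show ?thesis unfolding Rot_Moment dof_val_simps[abs_def]
      by (intro linear_functional_on_integral integrable_on_triangle) (auto simp: inner_add_left)
  next
    case (Div_Moment q)
    then have q: "continuous_on (triangle z) q"
      using assms CP_continuous[OF L2_ring_CP] by (simp add: is_dof_def)
    have "continuous_on (triangle z) (\<lambda>x. cdiv z v x * q x)" if "v \<in> S1 (int r) z" for v
      by (rule continuous_on_mult[OF cont_cdiv[OF that] q])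
    then show ?thesis unfolding Div_Moment dof_val_simps[abs_def]
      by (intro linear_functional_on_integral integrable_on_triangle)
        (auto simp: cdiv_add cdiv_scale algebra_simps)
  qed
qed

text \<open>Linearity in the other argument: for fixed \<open>v\<close> the moments are linear in
  the test function, so agreement with prescribed functionals on a spanning set extends to the whole
  test space.\<close>

lemma linear_test_functions:
  assumes v: "v \<in> S1 (int r) z" and r: "1 \<le> r"
  shows "e \<in> bdry_edges z \<Longrightarrow> linear_functional_on (vec_poly_on (int r - 2) (edge_set e)) (\<lambda>w. dof_val z
      (Edge_Val e w) v)"
    "e \<in> bdry_edges z \<Longrightarrow> linear_functional_on (poly_on (int r - 3) (edge_set e)) (\<lambda>q. dof_val z (Edge_Div e
        q) v)"
    "linear_functional_on (S0_ring (int r + 1) z) (\<lambda>q. dof_val z (Rot_Moment q) v)"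
    "linear_functional_on (L2_ring (int r - 1) z) (\<lambda>q. dof_val z (Div_Moment q) v)"
proof -
  have cv: "continuous_on (triangle z) v" using VP_continuous[OF S1_VP[OF v]] .
  show "linear_functional_on (vec_poly_on (int r - 2) (edge_set e)) (\<lambda>w. dof_val z (Edge_Val e w) v)" if e:
      "e \<in> bdry_edges z"
  proof -
    have "continuous_on {0..1} (\<lambda>t. v (linepath (fst e) (snd e) t) \<bullet> w (linepath (fst e) (snd e) t))"
      if "w \<in> vec_poly_on (int r - 2) (edge_set e)" for w
      using compose_linepath_continuous[OF cv bdry_edge_subset[OF e]] vec_poly_on_linepath_continuous that
      by (intro continuous_on_inner) (auto simp: edge_set_def)
    then show ?thesis unfolding dof_val_simps edge_integral_def
      by (intro linear_functional_on_cmult linear_functional_on_integral integrable_continuous_interval)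
          (auto simp: inner_add_right)
  qed
  show "linear_functional_on (poly_on (int r - 3) (edge_set e)) (\<lambda>q. dof_val z (Edge_Div e q) v)" if e: "e \<in>
      bdry_edges z"
  proof -
    have "continuous_on {0..1} (\<lambda>t. cdiv z v (linepath (fst e) (snd e) t) * q (linepath (fst e) (snd e) t))"
      if "q \<in> poly_on (int r - 3) (edge_set e)" for q
      using compose_linepath_continuous[OF cont_cdiv[OF v] bdry_edge_subset[OF e]]
          poly_on_linepath_continuous that
      by (intro continuous_on_mult) (auto simp: edge_set_def)
    then show ?thesis unfolding dof_val_simps edge_integral_def
      by (intro linear_functional_on_cmult linear_functional_on_integral integrable_continuous_interval)
          (auto simp: algebra_simps)
  qed
  show "linear_functional_on (S0_ring (int r + 1) z) (\<lambda>q. dof_val z (Rot_Moment q) v)"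
    unfolding dof_val_simps
    by (intro linear_functional_on_integral integrable_on_triangle continuous_on_inner cv crot_continuous[OF
        S0_ring_C1])
      (auto simp: inner_add_right crot_add[OF S0_ring_C1 S0_ring_C1] crot_scale[OF S0_ring_C1])
  show "linear_functional_on (L2_ring (int r - 1) z) (\<lambda>q. dof_val z (Div_Moment q) v)"
    unfolding dof_val_simps
    by (intro linear_functional_on_integral integrable_on_triangle continuous_on_mult cont_cdiv[OF v]
        CP_continuous[OF L2_ring_CP[OF r]])
      (auto simp: algebra_simps)
qed

lemma has_dofs_unique:
  assumes r: "1 \<le> r" and v: "v \<in> S1 (int r) z" and w: "w \<in> S1 (int r) z"
    and "has_dofs r z v a a' b c c' D E' F G" "has_dofs r z w a a' b c c' D E' F G"
  shows "v = w"
proof -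
  let ?d = "\<lambda>x. v x - w x"
  have diff: "dof_val z d ?d = dof_val z d v - dof_val z d w" if "is_dof r z d" for d
    by (rule linear_functional_on_diff[OF linear_dof_val[OF that r] fun_subspace_S1 v w])
  have "has_dofs r z ?d (\<lambda>_. 0) (\<lambda>_. 0) (\<lambda>_. 0) (\<lambda>_. 0) (\<lambda>_. 0) (\<lambda>_ _. 0) (\<lambda>_ _. 0) (\<lambda>_. 0) (\<lambda>_. 0)"
    using assms(4,5) unfolding has_dofs_iff by (simp add: diff is_dof_def del: dof_val_simps)
  from S1_unisolvent[OF fun_subspace_diff[OF fun_subspace_S1 v w] r this] show ?thesis
    by (auto simp: fun_eq_iff)
qed

text \<open>For the two edge spaces truncated subtraction gives dimension 0 precisely when the
  degree is negative: \<open>r \<le> 1\<close> for the velocity moments, \<open>r \<le> 2\<close>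
  for the divergence moments.\<close>

lemma dims:
  "e \<in> bdry_edges z \<Longrightarrow> has_dim (vec_poly_on (int r - 2) (edge_set e)) (2 * (r - 1))"
  "e \<in> bdry_edges z \<Longrightarrow> has_dim (poly_on (int r - 3) (edge_set e)) (r - 2)"
  "1 \<le> r \<Longrightarrow> has_dim (L2_ring (int r - 1) z) (3 * (r - 1) * (r - 2))"
proof -
  have n: "nat (int r - 2 + 1) = r - 1" "nat (int r - 3 + 1) = r - 2" by linarith+
  show "e \<in> bdry_edges z \<Longrightarrow> has_dim (vec_poly_on (int r - 2) (edge_set e)) (2 * (r - 1))"
    using has_dim_vec_poly_on_segment_int[OF bdry_edge_neq, of e "int r - 2"] unfolding n edge_set_def .
  show "e \<in> bdry_edges z \<Longrightarrow> has_dim (poly_on (int r - 3) (edge_set e)) (r - 2)"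
    using has_dim_poly_on_segment_int[OF bdry_edge_neq, of e "int r - 3"] unfolding n edge_set_def .
  assume "1 \<le> r"
  then have "int (r - 1) = int r - 1" "r - 1 - 1 = r - 2" by simp_all
  then show "has_dim (L2_ring (int r - 1) z) (3 * (r - 1) * (r - 2))"
    using has_dim_L2_ring[of "r - 1"] by (simp only:)
qed

text \<open>Unisolvence bounds the dimension of the velocity space by the number of degrees of freedom;
  as the lower bound obtained by counting constraints is the same number, all inequalities are
  equalities. This also determines the dimension of the space of stream functions.\<close>

lemma S1_dofs_onto:
  assumes r: "2 \<le> r"
  shows "has_dim (S0_ring (int r + 1) z) (3 * (r - 1) * (r - 2))"
    "\<And>a a' b c c' D E' F G.
        (\<forall>e\<in>bdry_edges z. linear_functional_on (vec_poly_on (int r - 2) (edge_set e)) (D e)) \<Longrightarrow>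
        (\<forall>e\<in>bdry_edges z. linear_functional_on (poly_on (int r - 3) (edge_set e)) (E' e)) \<Longrightarrow>
        linear_functional_on (S0_ring (int r + 1) z) F \<Longrightarrow>
        linear_functional_on (L2_ring (int r - 1) z) G \<Longrightarrow>
        (\<exists>v\<in>S1 (int r) z. has_dofs r z v a a' b c c' D E' F G)"
proof -
  have r1: "1 \<le> r" using r by simp
  have "\<exists>B. spanning (vec_poly_on (int r - 2) (edge_set e)) (2 * (r - 1)) B" if "e \<in> bdry_edges z" for e
    by (rule has_dim_ex_spanning[OF dims(1)[OF that]])
  then obtain BV where BV: "\<And>e. e \<in> bdry_edges z \<Longrightarrow> spanning (vec_poly_on (int r - 2) (edge_set e)) (2 * (r -
      1)) (BV e)" by metis
  have "\<exists>B. spanning (poly_on (int r - 3) (edge_set e)) (r - 2) B" if "e \<in> bdry_edges z" for e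
    by (rule has_dim_ex_spanning[OF dims(2)[OF that]])
  then obtain BD where BD: "\<And>e. e \<in> bdry_edges z \<Longrightarrow> spanning (poly_on (int r - 3) (edge_set e)) (r - 2) (BD
      e)" by metis
  have S0eq: "int (r + 1) = int r + 1" by simp
  obtain nF where nF: "nF \<le> 3 * (r - 1) * (r - 2)" "has_dim (S0_ring (int r + 1) z) nF"
    using has_dim_S0_ring_le[of r] unfolding S0eq by blast
  obtain BF where BF: "spanning (S0_ring (int r + 1) z) nF BF" using has_dim_ex_spanning[OF nF(2)] by blast
  obtain BG where BG: "spanning (L2_ring (int r - 1) z) (3 * (r - 1) * (r - 2)) BG"
    using has_dim_ex_spanning[OF dims(3)[OF r1]] by blast
  let ?V = "{1,2,3::nat}"
  \<comment> \<open>Five kinds of point values at three indices each give at most 15 functionals;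
    fluxes belong to \<open>r = 1\<close> and are absent here.\<close>
  define I1 where "I1 = (\<lambda>i. Point_Val i (1, 0)) ` ?V \<union> (\<lambda>i. Point_Val i (0, 1)) ` ?V \<union> Point_Div ` ?V
     \<union> (\<lambda>i. Point_Val (3 + i) (normal (opp_edge z i))) ` ?V \<union> (\<lambda>i. Point_Div (3 + i)) ` ?V"
  define I2 where "I2 = (\<Union>e\<in>bdry_edges z. Edge_Val e ` BV e)"
  define I3 where "I3 = (\<Union>e\<in>bdry_edges z. Edge_Div e ` BD e)"
  define I4 where "I4 = Rot_Moment ` BF"
  define I5 where "I5 = Div_Moment ` BG"
  define I where "I = I1 \<union> I2 \<union> I3 \<union> I4 \<union> I5"
  have mem: "i \<in> ?V \<Longrightarrow> Point_Val i (1, 0) \<in> I" "i \<in> ?V \<Longrightarrow> Point_Val i (0, 1) \<in> I" "i \<in> ?V \<Longrightarrow> Point_Div i \<in> I"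
      "i \<in> ?V \<Longrightarrow> Point_Val (3 + i) (normal (opp_edge z i)) \<in> I" "i \<in> ?V \<Longrightarrow> Point_Div (3 + i) \<in> I" for i
    unfolding I_def I1_def by blast+
  have mem': "e \<in> bdry_edges z \<Longrightarrow> w \<in> BV e \<Longrightarrow> Edge_Val e w \<in> I" "e \<in> bdry_edges z \<Longrightarrow> q \<in> BD e \<Longrightarrow> Edge_Div e q \<in> I"
      "q \<in> BF \<Longrightarrow> Rot_Moment q \<in> I" "q \<in> BG \<Longrightarrow> Div_Moment q \<in> I" for e w q
    unfolding I_def I2_def I3_def I4_def I5_def by blast+
  have fb: "finite (bdry_edges z)" unfolding bdry_edges_hex by simp
  have c1: "finite I1" "card I1 \<le> 15"
  proof -
    have le: "card (f ` ?V) \<le> 3" for f :: "nat \<Rightarrow> dof" using card_image_le[of ?V f] by simp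
    show "finite I1" by (simp add: I1_def)
    show "card I1 \<le> 15" unfolding I1_def
      by (intro order_trans[OF card_Un_le] order_trans[OF add_mono[OF order_trans[OF card_Un_le] le]]
          order_trans[OF add_mono[OF order_trans[OF card_Un_le add_mono[OF le le]] le]]) (use le in \<open>auto\<close>)
  qed
  have c2: "finite I2" "card I2 \<le> 6 * (2 * (r - 1))"
    using card_Union_image_le[OF fb, of BV "2 * (r - 1)" Edge_Val] spanningD[OF BV] unfolding I2_def
        card_bdry_edges by simp_all
  have c3: "finite I3" "card I3 \<le> 6 * (r - 2)"
    using card_Union_image_le[OF fb, of BD "r - 2" Edge_Div] spanningD[OF BD] unfolding I3_def
        card_bdry_edges by simp_all
  have c4: "finite I4" "card I4 \<le> nF" using spanningD[OF BF] card_image_le[of BF Rot_Moment] by (auto simp: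
      I4_def)
  have c5: "finite I5" "card I5 \<le> 3 * (r - 1) * (r - 2)" using spanningD[OF BG] card_image_le[of BG
      Div_Moment] by (auto simp: I5_def)
  have fI: "finite I" using c1 c2 c3 c4 c5 by (simp add: I_def)
  have cI: "card I \<le> 15 + 6 * (2 * (r - 1)) + 6 * (r - 2) + nF + 3 * (r - 1) * (r - 2)"
    unfolding I_def using c1 c2 c3 c4 c5
    by (intro order_trans[OF card_Un_le] add_mono) auto
  have dofI: "is_dof r z d" if "d \<in> I" for d
  proof -
    have "w \<in> vec_poly_on (int r - 2) (edge_set e)" if "e \<in> bdry_edges z" "w \<in> BV e" for e w
      using spanningD[OF BV[OF that(1)]] that(2) by blast
    moreover have "q \<in> poly_on (int r - 3) (edge_set e)" if "e \<in> bdry_edges z" "q \<in> BD e" for e q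
      using spanningD[OF BD[OF that(1)]] that(2) by blast
    moreover have "BF \<subseteq> S0_ring (int r + 1) z" "BG \<subseteq> L2_ring (int r - 1) z"
      using spanningD[OF BF] spanningD[OF BG] by blast+
    ultimately show ?thesis
      using that unfolding I_def I1_def I2_def I3_def I4_def I5_def by (auto simp: is_dof_def)
  qed
  have lin: "linear_functional_on (S1 (int r) z) (dof_val z d)" if "d \<in> I" for d
    by (rule linear_dof_val[OF dofI[OF that] r1])
  \<comment> \<open>Values on the chosen spanning sets extend to all test functions because both
    sides are linear in them.\<close>
  have ext: "has_dofs r z v a a' b c c' D E' F G"
    if v: "v \<in> S1 (int r) z"
    and val: "\<And>i. i \<in> ?V \<Longrightarrow> dof_val z (Point_Val i (1, 0)) v = fst (a i)" "\<And>i. i \<in> ?V \<Longrightarrow> dof_val z (Point_Val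
        i (0, 1)) v = snd (a i)"
      "\<And>i. i \<in> ?V \<Longrightarrow> dof_val z (Point_Div i) v = a' i"
      "\<And>i. i \<in> ?V \<Longrightarrow> dof_val z (Point_Val (3 + i) (normal (opp_edge z i))) v = c i" "\<And>i. i \<in> ?V \<Longrightarrow> dof_val z
          (Point_Div (3 + i)) v = c' i"
      "\<And>e w. e \<in> bdry_edges z \<Longrightarrow> w \<in> BV e \<Longrightarrow> dof_val z (Edge_Val e w) v = D e w"
      "\<And>e q. e \<in> bdry_edges z \<Longrightarrow> q \<in> BD e \<Longrightarrow> dof_val z (Edge_Div e q) v = E' e q"
      "\<And>q. q \<in> BF \<Longrightarrow> dof_val z (Rot_Moment q) v = F q"
      "\<And>q. q \<in> BG \<Longrightarrow> dof_val z (Div_Moment q) v = G q"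
    and D: "\<forall>e\<in>bdry_edges z. linear_functional_on (vec_poly_on (int r - 2) (edge_set e)) (D e)"
    and E': "\<forall>e\<in>bdry_edges z. linear_functional_on (poly_on (int r - 3) (edge_set e)) (E' e)"
    and F: "linear_functional_on (S0_ring (int r + 1) z) F"
    and G: "linear_functional_on (L2_ring (int r - 1) z) G"
    for v a a' b c c' D E' F G
  proof -
    note T = linear_test_functions[OF v r1]
    have 1: "dof_val z (Edge_Val e w) v = D e w" if e: "e \<in> bdry_edges z" "w \<in> vec_poly_on (int r - 2)
        (edge_set e)" for e w
      using linear_functionals_eqI[OF fun_subspace_vec_poly_on T(1)[OF e(1)] _ BV[OF e(1)] val(6)[OF e(1)]
          e(2)] D e(1) by blast
    have 2: "dof_val z (Edge_Div e q) v = E' e q" if e: "e \<in> bdry_edges z" "q \<in> poly_on (int r - 3)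
        (edge_set e)" for e q
      using linear_functionals_eqI[OF fun_subspace_poly_on T(2)[OF e(1)] _ BD[OF e(1)] val(7)[OF e(1)] e(2)]
          E' e(1) by blast
    have S0: "fun_vs.subspace (S0_ring (int r + 1) z)" using fun_subspace_S0_ring[of "r + 1"] by (simp add:
        add.commute)
    have L2: "fun_vs.subspace (L2_ring (int r - 1) z)" using fun_subspace_L2_ring[of "r - 1"] r1 by (simp
        add: of_nat_diff)
    have 3: "dof_val z (Rot_Moment q) v = F q" if "q \<in> S0_ring (int r + 1) z" for q
      by (rule linear_functionals_eqI[OF S0 T(3) F BF val(8) that])
    have 4: "dof_val z (Div_Moment q) v = G q" if "q \<in> L2_ring (int r - 1) z" for q
      by (rule linear_functionals_eqI[OF L2 T(4) G BG val(9) that])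
    show ?thesis unfolding has_dofs_iff using val(1-5) 1 2 3 4 r by (simp del: dof_val_simps)
  qed
  \<comment> \<open>Zero data are linear in the test functions, so vanishing on the finite set
    \<open>I\<close> makes all degrees of freedom vanish and uniqueness applies.\<close>
  have inj: "v = (\<lambda>x. 0)" if v: "v \<in> S1 (int r) z" and 0: "\<And>d. d \<in> I \<Longrightarrow> dof_val z d v = 0" for v
  proof (rule S1_unisolvent[OF v r1], rule ext[OF v])
    show "\<forall>e\<in>bdry_edges z. linear_functional_on (vec_poly_on (int r - 2) (edge_set e)) (\<lambda>_. 0)"
      "\<forall>e\<in>bdry_edges z. linear_functional_on (poly_on (int r - 3) (edge_set e)) (\<lambda>_. 0)"
      "linear_functional_on (S0_ring (int r + 1) z) (\<lambda>_. 0)"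
      "linear_functional_on (L2_ring (int r - 1) z) (\<lambda>_. 0)"
      by (simp_all add: linear_functional_on_def)
  qed (simp_all only: fst_zero snd_zero mem[THEN 0] mem'[THEN 0])
  obtain n where n: "has_dim (S1 (int r) z) n" "6 * r * r + 3 \<le> n" using has_dim_S1_ge[OF r1] by blast
  have "n \<le> card I"
    using has_dim_le_card[where F = "dof_val z", OF fI fun_subspace_S1 lin inj] has_dim_unique[OF n(1)] by blast
  obtain s where s: "r = s + 2" using r by (metis add.commute le_Suc_ex)
  have le: "6 * r * r + 3 \<le> 15 + 6 * (2 * (r - 1)) + 6 * (r - 2) + nF + 3 * (r - 1) * (r - 2)"
    using n(2) \<open>n \<le> card I\<close> cI by linarith
  \<comment> \<open>With the maximal value of \<open>nF\<close> inserted, the number of functionals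
    is exactly the lower bound for the dimension of \<open>S1\<close>; a smaller \<open>nF\<close>
    would contradict \<open>le\<close>.\<close>
  have count: "15 + 6 * (2 * (r - 1)) + 6 * (r - 2) + 3 * (r - 1) * (r - 2) + 3 * (r - 1) * (r - 2) = 6 * r
      * r + 3"
    unfolding s by (simp add: algebra_simps)
  have nF_eq: "nF = 3 * (r - 1) * (r - 2)" using le count nF(1) by linarith
  then show "has_dim (S0_ring (int r + 1) z) (3 * (r - 1) * (r - 2))" using nF(2) by simp
  have "card I \<le> n" using cI count nF_eq n(2) by linarith
  fix a a' b c c' D E' F G
  assume DEFG: "\<forall>e\<in>bdry_edges z. linear_functional_on (vec_poly_on (int r - 2) (edge_set e)) (D e)"
    "\<forall>e\<in>bdry_edges z. linear_functional_on (poly_on (int r - 3) (edge_set e)) (E' e)"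
    "linear_functional_on (S0_ring (int r + 1) z) F" "linear_functional_on (L2_ring (int r - 1) z) G"
  \<comment> \<open>Indices up to 3 are vertices and larger ones edge points, so
    \<open>k - 3\<close> recovers the number of the edge. A vertex value is tested against the
    direction \<open>m\<close>.\<close>
  define t where "t d = (case d of Point_Val k m \<Rightarrow> if k \<le> 3 then a k \<bullet> m else c (k - 3)
    | Point_Div k \<Rightarrow> if k \<le> 3 then a' k else c' (k - 3) | Flux i \<Rightarrow> 0
    | Edge_Val e w \<Rightarrow> D e w | Edge_Div e q \<Rightarrow> E' e q | Rot_Moment q \<Rightarrow> F q | Div_Moment q \<Rightarrow> G q)" for d
  obtain v where v: "v \<in> S1 (int r) z" "\<forall>d\<in>I. dof_val z d v = t d"
    using functionals_surj[where F = "dof_val z" and c = t, OF fI \<open>card I \<le> n\<close> fun_subspace_S1 lin n(1) inj]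
        by blast
  have "has_dofs r z v a a' b c c' D E' F G"
  proof (rule ext[OF v(1) _ _ _ _ _ _ _ _ _ DEFG])
    fix i assume i: "i \<in> ?V"
    note vt = mem[OF i, THEN v(2)[rule_format]]
    show "dof_val z (Point_Val i (1, 0)) v = fst (a i)" "dof_val z (Point_Val i (0, 1)) v = snd (a i)"
      "dof_val z (Point_Div i) v = a' i" "dof_val z (Point_Val (3 + i) (normal (opp_edge z i))) v = c i"
          "dof_val z (Point_Div (3 + i)) v = c' i"
      unfolding vt using i by (auto simp: t_def inner_prod_def)
  qed (use mem' v(2) in \<open>simp_all add: t_def del: dof_val_simps\<close>)
  then show "\<exists>v\<in>S1 (int r) z. has_dofs r z v a a' b c c' D E' F G" using v(1) by blast
qed

text \<open>For \<open>r = 1\<close> the upper bound is already 0; otherwise the dimension comes out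
  of the count of functionals.\<close>

lemma has_dim_S0_ring:
  assumes "1 \<le> r" shows "has_dim (S0_ring (int r + 1) z) (3 * (r - 1) * (r - 2))"
proof (cases "r = 1")
  case True
  then show ?thesis using has_dim_S0_ring_le[of 1] by auto
next
  case False
  then show ?thesis using assms by (intro S1_dofs_onto(1)) simp
qed

end

theorem lemma4p7:
  fixes z :: "nat \<Rightarrow> R2" and r :: nat
  assumes "powell_sabin z" and "1 \<le> r"
  shows
    "(\<forall>v\<in>S1 (int r) z. \<forall>w\<in>S1 (int r) z. \<forall>a a' b c c' D E F G.
        has_dofs r z v a a' b c c' D E F G \<and> has_dofs r z w a a' b c c' D E F G \<longrightarrow> v = w) \<and>
     (2 \<le> r \<longrightarrow> (\<forall>a a' b c c' D E F G.
        (\<forall>e\<in>bdry_edges z. linear_functional_on (vec_poly_on (int r - 2) (edge_set e)) (D e)) \<and>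
        (\<forall>e\<in>bdry_edges z. linear_functional_on (poly_on (int r - 3) (edge_set e)) (E e)) \<and>
        linear_functional_on (S0_ring (int r + 1) z) F \<and>
        linear_functional_on (L2_ring (int r - 1) z) G \<longrightarrow>
        (\<exists>v\<in>S1 (int r) z. has_dofs r z v a a' b c c' D E F G))) \<and>
     card (bdry_edges z) = 6 \<and>
     (\<forall>e\<in>bdry_edges z. has_dim (vec_poly_on (int r - 2) (edge_set e)) (2 * (r - 1))) \<and>
     (\<forall>e\<in>bdry_edges z. has_dim (poly_on (int r - 3) (edge_set e)) (r - 2)) \<and>
     has_dim (S0_ring (int r + 1) z) (3 * (r - 1) * (r - 2)) \<and>
     has_dim (L2_ring (int r - 1) z) (3 * (r - 1) * (r - 2))"
proof -
  interpret ps_config z by unfold_locales (rule assms(1))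
  show ?thesis
    apply (intro conjI allI ballI impI; (elim conjE)?)
    subgoal by (rule has_dofs_unique[OF assms(2)])
    subgoal by (rule S1_dofs_onto(2))
    subgoal by (rule card_bdry_edges)
    subgoal by (rule dims(1))
    subgoal by (rule dims(2))
    subgoal by (rule has_dim_S0_ring[OF assms(2)])
    subgoal by (rule dims(3)[OF assms(2)])
    done
qed

end
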